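(* Let $\Omega\subset\mathbb{R}^n$ be a convex body containing the origin in its interior, with radial function $\rho$. Let $\omega$ and $\phi$ be functions defined on $\mathbb{S}^{n-1}$ and $\overline\Omega$ respectively, and for $a>0$ define $$N_a(z)=\int_\Omega\omega\Bigl(\frac{y-z}{|y-z|}\Bigr)\frac{\phi(y)}{|y-z|^{n-a}}\,dy,\qquad z\in\partial\Omega.$$ (i) Let $a>1$. If $\rho\in C^{k,\alpha}(\mathbb{S}^{n-1})$, $\omega\in C^{k,\alpha}\cap C^{1,1}(\mathbb{S}^{n-1})$ and $\phi\in C^{k-1,\alpha}(\Omega)$ for some integer $k\ge1$ and some $\alpha\in[0,1]$, then $N_a\in C^{k,\alpha}(\partial\Omega)$, and $\|N_a\|_{k,\alpha}\le C$ for a positive constant $C$ depending only on $n,a,\alpha,k,\|\omega\|_{k,\alpha},\|\omega\|_{1,1},\|\phi\|_{k-1,\alpha},\|\rho\|_{k,\alpha}$ and $1/\rho_{\min}$. (ii) Let $0<a\le1$. If $\rho\in C^{k,\alpha}(\mathbb{S}^{n-1})$, $\omega\in C^{k,\alpha}\cap C^{1,1}(\mathbb{S}^{n-1})$ and $\phi\in C^{k,\alpha}(\Omega)$ for some integer $k\ge1$ and some $\alpha\in(1-a,1]$, then $N_a\in C^{k,\alpha'}(\partial\Omega)$ for any $\alpha'\in(0,\alpha+a-1)$, and $\|N_a\|_{k,\alpha'}\le\widetilde C$ for a positive constant $\widetilde C$ depending only on $n,a,\alpha,\alpha',k,\|\omega\|_{k,\alpha},\|\omega\|_{1,1},\|\phi\|_{k,\alpha},\|\rho\|_{k,\alpha}$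 and $1/\rho_{\min}$.
   Context: A convex body is a compact convex subset of $\mathbb{R}^n$ with non-empty interior. The radial function of $\Omega$ is $\rho(u)=\max\{\lambda\ge0:\lambda u\in\Omega\}$, $u\in\mathbb{S}^{n-1}$, so $\partial\Omega=\{\rho(u)u:u\in\mathbb{S}^{n-1}\}$; $\rho_{\min}=\min_{\mathbb{S}^{n-1}}\rho$. $C^{k,\alpha}$ is the usual Hölder space with norm $\|\cdot\|_{k,\alpha}$ ($C^{k,0}=C^k$; $\alpha=1$ means Lipschitz $k$-th derivatives); $\Omega$ is compact, so $C^{k,\alpha}(\Omega)$ is understood up to the boundary; functions on $\partial\Omega$ are regarded as functions on $\mathbb{S}^{n-1}$ via the parametrization $u\mapsto\rho(u)u$. *)

theory Defs
  imports "HOL-Analysis.Analysis"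
begin

primrec partials :: "'n list \<Rightarrow> (real ^ 'n \<Rightarrow> real) \<Rightarrow> real ^ 'n::finite \<Rightarrow> real" where
  "partials [] f = f"
| "partials (i # js) f = (\<lambda>x. frechet_derivative (partials js f) (at x) (axis i 1))"

definition Ck_on :: "nat \<Rightarrow> (real ^ 'n::finite) set \<Rightarrow> (real ^ 'n \<Rightarrow> real) \<Rightarrow> bool" where
  "Ck_on k U f \<longleftrightarrow>
     (\<forall>js. length js < k \<longrightarrow> (\<forall>x\<in>U. partials js f differentiable (at x))) \<and>
     (\<forall>js. length js \<le> k \<longrightarrow> continuous_on U (partials js f))"

definition holder_on :: "real \<Rightarrow> 'a::metric_space set \<Rightarrow> ('a \<Rightarrow> real) \<Rightarrow> bool" where
  "holder_on \<alpha> S g \<longleftrightarrow> (\<exists>C. \<forall>x\<in>S. \<forall>y\<in>S. \<bar>g x - g y\<bar> \<le> C * dist x y powr \<alpha>)"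

definition holder_seminorm :: "real \<Rightarrow> 'a::metric_space set \<Rightarrow> ('a \<Rightarrow> real) \<Rightarrow> real" where
  "holder_seminorm \<alpha> S g =
     (SUP (x, y)\<in>{(x, y). x \<in> S \<and> y \<in> S \<and> x \<noteq> y}. \<bar>g x - g y\<bar> / dist x y powr \<alpha>)"

text \<open>The suprema are those of the real numbers, so this is meaningful only for functions
  whose derivatives are bounded and Hoelder continuous on \<open>S\<close>, as guaranteed by
  membership in the spaces below. For \<open>\<alpha> = 0\<close> it is the plain \<open>C\<^sup>k\<close> norm.\<close>

definition holder_norm :: "nat \<Rightarrow> real \<Rightarrow> (real ^ 'n::finite) set \<Rightarrow> (real ^ 'n \<Rightarrow> real) \<Rightarrow> real" where
  "holder_norm k \<alpha> S f =
     (\<Sum>j\<le>k. SUP js\<in>{js. length js = j}. SUP x\<in>S. \<bar>partials js f x\<bar>) +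
     (if \<alpha> = 0 then 0 else SUP js\<in>{js. length js = k}. holder_seminorm \<alpha> S (partials js f))"

text \<open>\<open>C\<^sup>k\<^sup>,\<^sup>\<alpha>(K)\<close> up to the boundary, for \<open>K\<close> compact with dense interior: the
  derivatives are taken in the interior and extend continuously to \<open>K\<close>. By continuity the
  suprema over the interior and over \<open>K\<close> agree.\<close>

definition holder_space_body :: "nat \<Rightarrow> real \<Rightarrow> (real ^ 'n::finite) set \<Rightarrow> (real ^ 'n \<Rightarrow> real) set" where
  "holder_space_body k \<alpha> K =
     {f. continuous_on K f \<and> Ck_on k (interior K) f \<and>
         (\<forall>js. length js \<le> k \<longrightarrow>
            (\<exists>g. continuous_on K g \<and> (\<forall>x\<in>interior K. g x = partials js f x))) \<and>
         (\<alpha> > 0 \<longrightarrow> (\<forall>js. length js = k \<longrightarrow> holder_on \<alpha> (interior K) (partials js f)))}"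

definition holder_norm_body :: "nat \<Rightarrow> real \<Rightarrow> (real ^ 'n::finite) set \<Rightarrow> (real ^ 'n \<Rightarrow> real) \<Rightarrow> real" where
  "holder_norm_body k \<alpha> K f = holder_norm k \<alpha> (interior K) f"

text \<open>Functions on the unit sphere are differentiated through their extension that is
  positively homogeneous of degree 0. Such a function is \<open>C\<^sup>k\<close> on the sphere (in charts) iff
  the extension is \<open>C\<^sup>k\<close> off the origin, and the norm below is equivalent to any norm
  built from a finite atlas, with constants depending only on \<open>n\<close> and \<open>k\<close>.
  Only the values of the function on the sphere matter.\<close>

definition hom_ext :: "(real ^ 'n::finite \<Rightarrow> real) \<Rightarrow> real ^ 'n \<Rightarrow> real" where
  "hom_ext f x = f (x /\<^sub>R norm x)"

definition holder_space_sphere :: "nat \<Rightarrow> real \<Rightarrow> (real ^ 'n::finite \<Rightarrow> real) set" where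
  "holder_space_sphere k \<alpha> =
     {f. Ck_on k (- {0}) (hom_ext f) \<and>
         (\<alpha> > 0 \<longrightarrow> (\<forall>js. length js = k \<longrightarrow> holder_on \<alpha> (sphere 0 1) (partials js (hom_ext f))))}"

definition holder_norm_sphere :: "nat \<Rightarrow> real \<Rightarrow> (real ^ 'n::finite \<Rightarrow> real) \<Rightarrow> real" where
  "holder_norm_sphere k \<alpha> f = holder_norm k \<alpha> (sphere 0 1) (hom_ext f)"

definition convex_body :: "(real ^ 'n::finite) set \<Rightarrow> bool" where
  "convex_body \<Omega> \<longleftrightarrow> compact \<Omega> \<and> convex \<Omega> \<and> interior \<Omega> \<noteq> {}"

text \<open>For a convex body with the origin in its interior, the supremum in \<open>radial\<close> and, \<open>radial \<Omega>\<close>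
  being continuous on the sphere, the infimum in \<open>radial_min\<close> are attained.\<close>

definition radial :: "(real ^ 'n::finite) set \<Rightarrow> real ^ 'n \<Rightarrow> real" where
  "radial \<Omega> u = Sup {l. 0 \<le> l \<and> l *\<^sub>R u \<in> \<Omega>}"

definition radial_min :: "(real ^ 'n::finite) set \<Rightarrow> real" where
  "radial_min \<Omega> = (INF u\<in>sphere 0 1. radial \<Omega> u)"

definition N_op ::
  "(real ^ 'n::finite) set \<Rightarrow> (real ^ 'n \<Rightarrow> real) \<Rightarrow> (real ^ 'n \<Rightarrow> real) \<Rightarrow> real \<Rightarrow> real ^ 'n \<Rightarrow> real" where
  "N_op \<Omega> \<omega> \<phi> a z =
     (LINT y:\<Omega>|lborel. \<omega> ((y - z) /\<^sub>R norm (y - z)) * (\<phi> y / norm (y - z) powr (real CARD('n) - a)))"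

text \<open>A function on the boundary of \<open>\<Omega>\<close>, regarded as a function on the sphere.\<close>

definition on_sphere :: "(real ^ 'n::finite) set \<Rightarrow> (real ^ 'n \<Rightarrow> real) \<Rightarrow> real ^ 'n \<Rightarrow> real" where
  "on_sphere \<Omega> h u = h (radial \<Omega> u *\<^sub>R u)"

end

theory Submission
  imports Defs
begin

text \<open>
  Extend \<open>\<rho>\<close> to be homogeneous of degree 0 and parametrise the body by \<open>v \<mapsto> \<rho>(v) v\<close> on
  the unit ball. Let the parametrisation rotate with the boundary point: for \<open>x\<close> near a unit vector
  \<open>e\<close>, the isometry \<open>R\<^sub>x\<close> (minus the reflection in \<open>x/|x| + e\<close>) takes \<open>e\<close> to \<open>x/|x|\<close> and is
  smooth in \<open>x\<close>. The potential becomes an integral over the fixed unit ball whose singularity stays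
  at \<open>w = e\<close>, the kernel being evaluated at
  \<open>\<delta>(x,w) = \<rho>(R\<^sub>x w) R\<^sub>x w - \<rho>(R\<^sub>x e) R\<^sub>x e\<close>. Near the singularity \<open>\<delta>/|w - e|\<close> stays in an
  annulus, and it has bounded \<open>C\<^bsup>k-1,\<alpha>\<^esup>\<close> norm in \<open>x\<close>, so homogeneous kernels composed with \<open>\<delta>\<close>
  have \<open>C\<^bsup>k-1,\<alpha>\<^esup>\<close> norm bounded by powers of \<open>|w - e|\<close>.

  For \<open>a > 1\<close> the potential is differentiated once in the source point, which leaves an integrable
  kernel, and then \<open>k - 1\<close> times in \<open>x\<close>. For \<open>a \<le> 1\<close> one differentiates \<open>k\<close> times in \<open>x\<close> under the
  integral sign: the top derivative of \<open>\<delta>\<close> is only \<open>O(|w - e|\<^sup>\<alpha>)\<close>, and interpolating this with its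
  \<open>\<alpha>\<close>-Hoelder continuity in \<open>x\<close> gives \<open>\<alpha>'\<close>-Hoelder constants of size \<open>|w - e|\<close> to the power
  \<open>a - n - 1 + \<alpha> - \<alpha>'\<close>, which is integrable exactly when \<open>\<alpha>' < \<alpha> + a - 1\<close>.
\<close>

section \<open>Hoelder bounds on open sets\<close>

text \<open>The obstacle is that \<rho> has exactly as many derivatives as are claimed for the
  potential. Writing \<delta> as a difference of two values of \<open>\<rho>(v) v\<close> gains the
  factor |w - e| but spends one derivative, so \<delta>/|w - e| is controlled to order k - 1 only.
  For a > 1 the missing derivative is taken in the point z, where it falls on the kernel: the
  gradient has degree a - n - 1, which is integrable precisely when a > 1, and \<phi> is then
  differentiated only k - 1 times. For a \<le> 1 this gradient is not integrable, and all k
  derivatives have to be taken in x; hence the extra derivative of \<phi> and the loss in the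
  exponent. The hypothesis C^{1,1} on \<omega> matters for k = 1: there \<delta>/|w - e| is merely
  \<alpha>-Hoelder in x, and composing it with a merely \<alpha>-Hoelder gradient of the kernel
  would give the exponent \<alpha>^2, whereas a Lipschitz gradient preserves \<alpha>.\<close>

definition hold0 :: "real \<Rightarrow> (real ^ 'n::finite) set \<Rightarrow> real \<Rightarrow> (real ^ 'n \<Rightarrow> real) \<Rightarrow> bool" where
  "hold0 \<alpha> U M f \<longleftrightarrow> continuous_on U f \<and> (\<forall>x\<in>U. \<bar>f x\<bar> \<le> M) \<and>
     (\<forall>x\<in>U. \<forall>y\<in>U. \<bar>f x - f y\<bar> \<le> M * dist x y powr \<alpha>)"

abbreviation lin_form :: "('n \<Rightarrow> real ^ 'n::finite \<Rightarrow> real) \<Rightarrow> real ^ 'n \<Rightarrow> real ^ 'n \<Rightarrow> real" where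
  "lin_form f' x \<equiv> (\<lambda>h. \<Sum>i\<in>UNIV. f' i x * h $ i)"

text \<open>The recursion asks for some gradient instead of speaking of \<open>partials\<close>, so
  closure under products, composition and integrals reduces to exhibiting one. All orders, not only
  the top one, carry the same exponent and constant, which closes the class under products without
  interpolation. For \<alpha> = 0 the Hoelder clause of \<open>hold0\<close> only bounds the
  oscillation, which is why continuity is a clause of its own there.\<close>

primrec holder_bd ::
  "nat \<Rightarrow> real \<Rightarrow> (real ^ 'n::finite) set \<Rightarrow> real \<Rightarrow> (real ^ 'n \<Rightarrow> real) \<Rightarrow> bool" where
  "holder_bd 0 \<alpha> U M f \<longleftrightarrow> hold0 \<alpha> U M f"
| "holder_bd (Suc k) \<alpha> U M f \<longleftrightarrow> hold0 \<alpha> U M f \<and>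
     (\<exists>f'. (\<forall>x\<in>U. (f has_derivative lin_form f' x) (at x)) \<and> (\<forall>i. holder_bd k \<alpha> U M (f' i)))"

lemma bd_SucE:
  assumes "holder_bd (Suc k) \<alpha> U M f"
  obtains f' where "\<And>x. x \<in> U \<Longrightarrow> (f has_derivative lin_form f' x) (at x)"
    "\<And>i. holder_bd k \<alpha> U M (f' i)"
  using assms unfolding holder_bd.simps by blast

lemma bd_Suc_intro:
  assumes "hold0 \<alpha> U M f" "\<And>x. x \<in> U \<Longrightarrow> (f has_derivative lin_form f' x) (at x)"
    "\<And>i. holder_bd k \<alpha> U M (f' i)"
  shows "holder_bd (Suc k) \<alpha> U M f"
  using assms unfolding holder_bd.simps by blast

lemma hold0_mono: "hold0 \<alpha> U M f \<Longrightarrow> M \<le> M' \<Longrightarrow> hold0 \<alpha> U M' f"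
  unfolding hold0_def by (meson mult_right_mono order_trans powr_ge_zero)

lemma bd_hold0: "holder_bd k \<alpha> U M f \<Longrightarrow> hold0 \<alpha> U M f"
  by (cases k) auto

lemma bd_mono: "holder_bd k \<alpha> U M f \<Longrightarrow> M \<le> M' \<Longrightarrow> holder_bd k \<alpha> U M' f"
proof (induction k arbitrary: f)
  case 0 then show ?case using hold0_mono by auto
next
  case (Suc k)
  then show ?case using hold0_mono[of \<alpha> U M f M'] by auto
qed

lemma bd_Suc_D: "holder_bd (Suc k) \<alpha> U M f \<Longrightarrow> holder_bd k \<alpha> U M f"
proof (induction k arbitrary: f)
  case 0 then show ?case by auto
next
  case (Suc k)
  then show ?case by (meson holder_bd.simps(2))
qed

lemma bd_le: "holder_bd k \<alpha> U M f \<Longrightarrow> j \<le> k \<Longrightarrow> holder_bd j \<alpha> U M f"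
  by (induction k) (use bd_Suc_D le_Suc_eq in blast)+

lemma bd_subset: "holder_bd k \<alpha> U M f \<Longrightarrow> T \<subseteq> U \<Longrightarrow> holder_bd k \<alpha> T M f"
proof (induction k arbitrary: f)
  case 0 then show ?case unfolding hold0_def holder_bd.simps
    by (meson continuous_on_subset subsetD)
next
  case (Suc k)
  have "hold0 \<alpha> T M f" using Suc.prems unfolding hold0_def holder_bd.simps
    by (meson continuous_on_subset subsetD)
  then show ?case using Suc unfolding holder_bd.simps by (meson subsetD)
qed

lemma hold0_cong: "(\<And>x. x \<in> U \<Longrightarrow> f x = g x) \<Longrightarrow> hold0 \<alpha> U M f \<Longrightarrow> hold0 \<alpha> U M g"
  unfolding hold0_def using continuous_on_cong[of U U f g] by auto

lemma bd_cong:
  assumes "open U" "\<And>x. x \<in> U \<Longrightarrow> f x = g x" "holder_bd k \<alpha> U M f"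
  shows "holder_bd k \<alpha> U M g"
proof (cases k)
  case 0 then show ?thesis using assms hold0_cong by (metis holder_bd.simps(1))
next
  case (Suc j)
  from assms(3)[unfolded Suc holder_bd.simps] obtain f' where
    f': "\<And>x. x \<in> U \<Longrightarrow> (f has_derivative lin_form f' x) (at x)" "\<And>i. holder_bd j \<alpha> U M (f' i)"
    by blast
  have "(g has_derivative lin_form f' x) (at x)" if "x \<in> U" for x
    using has_derivative_transform_within_open[OF f'(1)[OF that] assms(1) that] assms(2) by blast
  moreover have "hold0 \<alpha> U M g" using assms hold0_cong bd_hold0 by blast
  ultimately show ?thesis using f'(2) Suc by auto
qed

lemma bd_const: "\<bar>c\<bar> \<le> M \<Longrightarrow> holder_bd k \<alpha> U M (\<lambda>x. c)"
proof (induction k arbitrary: c)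
  case 0 then show ?case unfolding holder_bd.simps hold0_def
    by (auto intro!: mult_nonneg_nonneg)
next
  case (Suc k)
  have "hold0 \<alpha> U M (\<lambda>x. c)" using Suc.prems unfolding hold0_def
    by (auto intro!: mult_nonneg_nonneg)
  moreover have "holder_bd k \<alpha> U M (\<lambda>x. 0)" using Suc.IH[of 0] Suc.prems by auto
  ultimately show ?case unfolding holder_bd.simps by (intro conjI exI[of _ "\<lambda>i x. 0"]) auto
qed

lemma bd_coord:
  assumes "\<And>x. x \<in> U \<Longrightarrow> norm x \<le> M" "1 \<le> M"
  shows "holder_bd k 1 U M (\<lambda>x. x $ m)"
proof -
  have c: "\<bar>x $ m\<bar> \<le> norm x" for x :: "real^'a" using component_le_norm_cart by blast
  have "\<bar>x $ m - y $ m\<bar> \<le> M * dist x y" for x y :: "real^'a"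
    using c[of "x - y"] assms(2) mult_right_mono[of 1 M "dist x y"] by (simp add: dist_norm)
  then have h0: "hold0 1 U M (\<lambda>x. x $ m)" unfolding hold0_def
    using order_trans[OF c assms(1)] by (auto intro!: continuous_intros)
  show ?thesis
  proof (cases k)
    case 0 then show ?thesis using h0 by auto
  next
    case (Suc j)
    have "((\<lambda>x. x $ m) has_derivative lin_form (\<lambda>i x. if i = m then 1 else 0) x) (at x)" for x :: "real^'a"
    proof -
      have "lin_form (\<lambda>i x. if i = m then 1 else 0) x = (\<lambda>h. h $ m)"
        by (auto simp: if_distrib[of "\<lambda>u. u * _"] cong: if_cong)
      then show ?thesis by (simp add: bounded_linear_imp_has_derivative bounded_linear_vec_nth)
    qed
    moreover have "\<And>i. holder_bd j 1 U M ((\<lambda>i x. if i = m then 1 else 0) i)" 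
      using bd_const[of 1 M j 1 U] bd_const[of 0 M j 1 U] assms(2) by auto
    ultimately show ?thesis unfolding Suc by (intro bd_Suc_intro[OF h0])
  qed
qed

lemma bd_add:
  "holder_bd k \<alpha> U M f \<Longrightarrow> holder_bd k \<alpha> U N g \<Longrightarrow> holder_bd k \<alpha> U (M + N) (\<lambda>x. f x + g x)"
proof (induction k arbitrary: f g)
  case 0
  have "\<bar>f x + g x - (f y + g y)\<bar> \<le> (M + N) * dist x y powr \<alpha>"
    if "\<bar>f x - f y\<bar> \<le> M * dist x y powr \<alpha>" "\<bar>g x - g y\<bar> \<le> N * dist x y powr \<alpha>" for x y
    using that by (simp add: algebra_simps)
  moreover have "\<bar>f x + g x\<bar> \<le> M + N" if "\<bar>f x\<bar> \<le> M" "\<bar>g x\<bar> \<le> N" for x using that by auto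
  ultimately show ?case using 0 unfolding holder_bd.simps hold0_def
    by (auto intro!: continuous_intros)
next
  case (Suc k)
  have h: "hold0 \<alpha> U M f" "hold0 \<alpha> U N g" using Suc.prems bd_hold0 by blast+
  have "\<bar>f x + g x - (f y + g y)\<bar> \<le> (M + N) * dist x y powr \<alpha>"
    if "\<bar>f x - f y\<bar> \<le> M * dist x y powr \<alpha>" "\<bar>g x - g y\<bar> \<le> N * dist x y powr \<alpha>" for x y
    using that by (simp add: algebra_simps)
  moreover have "\<bar>f x + g x\<bar> \<le> M + N" if "\<bar>f x\<bar> \<le> M" "\<bar>g x\<bar> \<le> N" for x using that by auto
  ultimately have h0: "hold0 \<alpha> U (M+N) (\<lambda>x. f x + g x)" using h unfolding hold0_def
    by (auto intro!: continuous_intros)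
  from bd_SucE[OF Suc.prems(1)] obtain f' where
    f': "\<And>x. x \<in> U \<Longrightarrow> (f has_derivative lin_form f' x) (at x)" "\<And>i. holder_bd k \<alpha> U M (f' i)"
    by blast
  from bd_SucE[OF Suc.prems(2)] obtain g' where
    g': "\<And>x. x \<in> U \<Longrightarrow> (g has_derivative lin_form g' x) (at x)" "\<And>i. holder_bd k \<alpha> U N (g' i)"
    by blast
  have "((\<lambda>x. f x + g x) has_derivative lin_form (\<lambda>i x. f' i x + g' i x) x) (at x)" if "x \<in> U" for x
    using has_derivative_add[OF f'(1)[OF that] g'(1)[OF that]]
    by (simp add: algebra_simps sum.distrib)
  then show ?case by (intro bd_Suc_intro[OF h0 _ Suc.IH[OF f'(2) g'(2)]])
qed

lemma bd_nonneg: "holder_bd k \<alpha> U M f \<Longrightarrow> x \<in> U \<Longrightarrow> 0 \<le> M"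
  using bd_hold0 unfolding hold0_def by (meson abs_ge_zero order_trans)

lemma bd_sum:
  assumes "finite S" "\<And>m. m \<in> S \<Longrightarrow> holder_bd k \<alpha> U M (f m)" "0 \<le> M"
  shows "holder_bd k \<alpha> U (real (card S) * M) (\<lambda>x. \<Sum>m\<in>S. f m x)"
  using assms
proof (induction S)
  case empty then show ?case using bd_const[of 0 0] by auto
next
  case (insert a S)
  then have "holder_bd k \<alpha> U (M + real (card S) * M) (\<lambda>x. f a x + (\<Sum>m\<in>S. f m x))"
    by (intro bd_add) auto
  then show ?case using insert by (simp add: algebra_simps)
qed

lemma hold0_mult:
  assumes "hold0 \<alpha> U M f" "hold0 \<alpha> U N g" "0 \<le> M" "0 \<le> N"
  shows "hold0 \<alpha> U (2 * (M * N)) (\<lambda>x. f x * g x)"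
proof -
  have b: "\<bar>f x * g x\<bar> \<le> 2 * (M * N)" if "x \<in> U" for x
  proof -
    have "\<bar>f x\<bar> * \<bar>g x\<bar> \<le> M * N" using assms that unfolding hold0_def by (intro mult_mono) auto
    then show ?thesis using assms by (simp add: abs_mult) (smt (verit) mult_nonneg_nonneg)
  qed
  have "\<bar>f x * g x - f y * g y\<bar> \<le> 2 * (M * N) * dist x y powr \<alpha>" if "x \<in> U" "y \<in> U" for x y
  proof -
    have "f x * g x - f y * g y = f x * (g x - g y) + (f x - f y) * g y" by (simp add: algebra_simps)
    then have "\<bar>f x * g x - f y * g y\<bar> \<le> \<bar>f x\<bar> * \<bar>g x - g y\<bar> + \<bar>f x - f y\<bar> * \<bar>g y\<bar>"
      by (metis abs_mult abs_triangle_ineq)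
    also have "\<dots> \<le> M * (N * dist x y powr \<alpha>) + (M * dist x y powr \<alpha>) * N"
      using assms that unfolding hold0_def by (intro add_mono mult_mono) auto
    finally show ?thesis by (simp add: algebra_simps)
  qed
  then show ?thesis using assms b unfolding hold0_def by (auto intro!: continuous_intros)
qed

text \<open>One factor 2 comes from splitting the increment of a product, and one more from the two
  terms of the Leibniz rule at every derivative.\<close>

lemma bd_mult:
  assumes "0 \<le> M" "0 \<le> N"
  shows "holder_bd k \<alpha> U M f \<Longrightarrow> holder_bd k \<alpha> U N g \<Longrightarrow>
    holder_bd k \<alpha> U (2 ^ Suc k * (M * N)) (\<lambda>x. f x * g x)"
proof (induction k arbitrary: f g)
  case 0 then show ?case using hold0_mult assms by auto
next
  case (Suc k)
  have MN: "0 \<le> M * N" using assms by auto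
  have "hold0 \<alpha> U (2 * (M * N)) (\<lambda>x. f x * g x)"
    using Suc.prems bd_hold0 hold0_mult assms by blast
  then have h0: "hold0 \<alpha> U (2 ^ Suc (Suc k) * (M * N)) (\<lambda>x. f x * g x)"
  proof (rule hold0_mono)
    have "(2::real) \<le> 2 ^ Suc (Suc k)" using one_le_power[of "2::real" k] unfolding power_Suc by linarith
    then show "2 * (M * N) \<le> 2 ^ Suc (Suc k) * (M * N)" using MN by (rule mult_right_mono)
  qed
  from bd_SucE[OF Suc.prems(1)] obtain f' where
    f': "\<And>x. x \<in> U \<Longrightarrow> (f has_derivative lin_form f' x) (at x)" "\<And>i. holder_bd k \<alpha> U M (f' i)"
    by blast
  from bd_SucE[OF Suc.prems(2)] obtain g' where
    g': "\<And>x. x \<in> U \<Longrightarrow> (g has_derivative lin_form g' x) (at x)" "\<And>i. holder_bd k \<alpha> U N (g' i)"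
    by blast
  have "((\<lambda>x. f x * g x) has_derivative lin_form (\<lambda>i x. f x * g' i x + f' i x * g x) x) (at x)" if "x \<in> U" for x
    using has_derivative_mult[OF f'(1)[OF that] g'(1)[OF that]]
    by (simp add: algebra_simps sum.distrib sum_distrib_left)
  moreover have "holder_bd k \<alpha> U (2 ^ Suc (Suc k) * (M * N)) (\<lambda>x. f x * g' i x + f' i x * g x)" for i
    using bd_add[OF Suc.IH[OF bd_Suc_D[OF Suc.prems(1)] g'(2)] Suc.IH[OF f'(2) bd_Suc_D[OF Suc.prems(2)]]]
    by (simp add: algebra_simps)
  ultimately show ?case by (intro bd_Suc_intro[OF h0])
qed

lemma bd_cmult:
  "holder_bd k \<alpha> U M f \<Longrightarrow> holder_bd k \<alpha> U (\<bar>c\<bar> * M) (\<lambda>x. c * f x)"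
proof (induction k arbitrary: f)
  case 0
  have "\<bar>c * f x - c * f y\<bar> = \<bar>c\<bar> * \<bar>f x - f y\<bar>" for x y by (simp add: abs_mult[symmetric] algebra_simps)
  then show ?case using 0 unfolding holder_bd.simps hold0_def 
    by (auto intro!: continuous_intros simp: abs_mult mult_left_mono mult.assoc)
next
  case (Suc k)
  have "\<bar>c * f x - c * f y\<bar> = \<bar>c\<bar> * \<bar>f x - f y\<bar>" for x y by (simp add: abs_mult[symmetric] algebra_simps)
  then have h0: "hold0 \<alpha> U (\<bar>c\<bar> * M) (\<lambda>x. c * f x)" using bd_hold0[OF Suc.prems] unfolding hold0_def 
    by (auto intro!: continuous_intros simp: abs_mult mult_left_mono mult.assoc)
  from Suc.prems obtain f' where
    f': "\<And>x. x \<in> U \<Longrightarrow> (f has_derivative lin_form f' x) (at x)" "\<And>i. holder_bd k \<alpha> U M (f' i)"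
    by auto
  have "((\<lambda>x. c * f x) has_derivative lin_form (\<lambda>i x. c * f' i x) x) (at x)" if "x \<in> U" for x
    using has_derivative_mult_right[OF f'(1)[OF that], of c]
    by (simp add: sum_distrib_left mult.assoc)
  then show ?case by (intro bd_Suc_intro[OF h0 _ Suc.IH[OF f'(2)]])
qed

text \<open>Lowering the exponent is paid for by the diameter: dist powr \<alpha> is at most
  \<open>D powr (\<alpha> - \<alpha>')\<close> times dist powr \<alpha>'.\<close>

lemma hold0_exp:
  assumes "hold0 \<alpha> U M f" "\<alpha>' \<le> \<alpha>" "\<And>x y. x \<in> U \<Longrightarrow> y \<in> U \<Longrightarrow> dist x y \<le> D" "1 \<le> D" "0 \<le> M"
  shows "hold0 \<alpha>' U (D powr (\<alpha> - \<alpha>') * M) f"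
proof -
  have D1: "1 \<le> D powr (\<alpha> - \<alpha>')" using assms by (simp add: ge_one_powr_ge_zero)
  have "\<bar>f x - f y\<bar> \<le> D powr (\<alpha> - \<alpha>') * M * dist x y powr \<alpha>'" if "x \<in> U" "y \<in> U" for x y
  proof -
    have "dist x y powr \<alpha> = dist x y powr (\<alpha> - \<alpha>') * dist x y powr \<alpha>'"
      by (simp add: powr_add[symmetric])
    also have "\<dots> \<le> D powr (\<alpha> - \<alpha>') * dist x y powr \<alpha>'"
      using assms that by (intro mult_right_mono powr_mono2) auto
    finally have "M * dist x y powr \<alpha> \<le> M * (D powr (\<alpha> - \<alpha>') * dist x y powr \<alpha>')"
      using assms by (intro mult_left_mono) auto
    moreover have "\<bar>f x - f y\<bar> \<le> M * dist x y powr \<alpha>" using assms(1) that unfolding hold0_def by auto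
    ultimately show ?thesis by (simp add: algebra_simps)
  qed
  moreover have "\<bar>f x\<bar> \<le> D powr (\<alpha> - \<alpha>') * M" if "x \<in> U" for x
    using assms(1) that mult_right_mono[OF D1 assms(5)] unfolding hold0_def by force
  ultimately show ?thesis using assms(1) unfolding hold0_def by auto
qed

lemma bd_exp:
  assumes "\<alpha>' \<le> \<alpha>" "\<And>x y. x \<in> U \<Longrightarrow> y \<in> U \<Longrightarrow> dist x y \<le> D" "1 \<le> D" "0 \<le> M"
  shows "holder_bd k \<alpha> U M f \<Longrightarrow> holder_bd k \<alpha>' U (D powr (\<alpha> - \<alpha>') * M) f"
proof (induction k arbitrary: f)
  case 0 then show ?case unfolding holder_bd.simps by (rule hold0_exp[OF _ assms])
next
  case (Suc k)
  have "hold0 \<alpha>' U (D powr (\<alpha> - \<alpha>') * M) f" by (rule hold0_exp[OF bd_hold0[OF Suc.prems] assms])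
  then show ?case using Suc by auto
qed

section \<open>Mean value estimates and composition\<close>

lemma lin_form_bound:
  assumes "\<And>i. \<bar>f' i x\<bar> \<le> M"
  shows "\<bar>lin_form f' x h\<bar> \<le> real CARD('n) * M * norm (h :: real ^ 'n)"
proof -
  have "\<bar>lin_form f' x h\<bar> \<le> (\<Sum>i\<in>UNIV. \<bar>f' i x * h $ i\<bar>)" by (rule sum_abs)
  also have "\<dots> \<le> (\<Sum>i\<in>(UNIV::'n set). M * norm h)"
    unfolding abs_mult using assms component_le_norm_cart[of h]
    by (intro sum_mono mult_mono) (auto intro: order_trans[OF abs_ge_zero])
  finally show ?thesis by simp
qed

lemma lipschitz_if_grad_bound:
  fixes f :: "real ^ 'n::finite \<Rightarrow> real"
  assumes "convex U" "\<And>x. x \<in> U \<Longrightarrow> (f has_derivative lin_form f' x) (at x)"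
    "\<And>x i. x \<in> U \<Longrightarrow> \<bar>f' i x\<bar> \<le> M" "x \<in> U" "y \<in> U"
  shows "\<bar>f x - f y\<bar> \<le> real CARD('n) * M * dist x y"
proof -
  have "onorm (lin_form f' x) \<le> real CARD('n) * M" if "x \<in> U" for x
    using lin_form_bound[of f' x M] assms(3)[OF that] by (intro onorm_le) auto
  then show ?thesis
    using differentiable_bound[of U f "lin_form f'" "real CARD('n) * M" x y] assms
    by (auto simp: dist_norm intro: has_derivative_at_withinI)
qed

lemma bd_lipschitz:
  fixes f :: "real ^ 'n::finite \<Rightarrow> real"
  assumes "convex U" "holder_bd (Suc k) \<alpha> U M f" "x \<in> U" "y \<in> U"
  shows "\<bar>f x - f y\<bar> \<le> real CARD('n) * M * dist x y"
proof -
  from bd_SucE[OF assms(2)] obtain f' where f': "\<And>x. x \<in> U \<Longrightarrow> (f has_derivative lin_form f' x) (at x)"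
     "\<And>i. holder_bd k \<alpha> U M (f' i)" by blast
  have "\<And>x i. x \<in> U \<Longrightarrow> \<bar>f' i x\<bar> \<le> M" using f'(2) bd_hold0 unfolding hold0_def by blast
  then show ?thesis using lipschitz_if_grad_bound[of U f f' M x y] assms f' by blast
qed

text \<open>On a convex set of diameter at most 1 the mean value inequality yields a Lipschitz
  bound, and dist \<le> dist powr \<alpha> there. So a bound on the size of f and bounds on its
  gradient are enough; the Hoelder bound of f itself need not be checked.\<close>

lemma bd_SucI:
  fixes f :: "real ^ 'n::finite \<Rightarrow> real"
  assumes U: "convex U" "\<And>x y. x \<in> U \<Longrightarrow> y \<in> U \<Longrightarrow> dist x y \<le> 1" and al: "\<alpha> \<le> 1"
    and der: "\<And>x. x \<in> U \<Longrightarrow> (f has_derivative lin_form f' x) (at x)"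
    and bd: "\<And>x. x \<in> U \<Longrightarrow> \<bar>f x\<bar> \<le> M" "0 \<le> M" and f': "\<And>i. holder_bd k \<alpha> U N (f' i)" "0 \<le> N"
  shows "holder_bd (Suc k) \<alpha> U (M + real CARD('n) * N) f"
proof -
  let ?C = "M + real CARD('n) * N"
  have "\<bar>f' i x\<bar> \<le> N" if "x \<in> U" for i x using f'(1) bd_hold0 that unfolding hold0_def by blast
  then have lip: "\<bar>f x - f y\<bar> \<le> real CARD('n) * N * dist x y" if "x \<in> U" "y \<in> U" for x y
    using lipschitz_if_grad_bound[of U f f' N x y] U der that by blast
  have "dist x y \<le> dist x y powr \<alpha>" if "x \<in> U" "y \<in> U" for x y
    using powr_mono'[of \<alpha> 1 "dist x y"] U(2)[OF that] al by auto
  then have "real CARD('n) * N * dist x y \<le> ?C * dist x y powr \<alpha>" if "x \<in> U" "y \<in> U" for x y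
    using that bd(2) f'(2) by (intro mult_mono) auto
  then have "\<bar>f x - f y\<bar> \<le> ?C * dist x y powr \<alpha>" if "x \<in> U" "y \<in> U" for x y
    using lip that by (meson order_trans)
  moreover have "continuous_on U f" 
    by (meson der has_derivative_continuous continuous_at_imp_continuous_on)
  moreover have "\<bar>f x\<bar> \<le> ?C" if "x \<in> U" for x using bd(1)[OF that] f'(2)
    by (smt (verit) mult_nonneg_nonneg of_nat_0_le_iff)
  ultimately have "hold0 \<alpha> U ?C f" unfolding hold0_def by auto
  moreover have "N \<le> ?C"
  proof -
    have "1 * N \<le> real CARD('n) * N" using f'(2) by (intro mult_right_mono) (auto simp: Suc_leI)
    then show ?thesis using bd(2) by auto
  qed
  ultimately show ?thesis using der bd_mono[OF f'(1)] by (intro bd_Suc_intro)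
qed

lemma has_derivative_vec_components:
  fixes d :: "real ^ 'n::finite \<Rightarrow> real ^ 'm::finite"
  assumes "\<And>m. ((\<lambda>x. d x $ m) has_derivative lin_form (\<delta>' m) x) (at x)"
  shows "(d has_derivative (\<lambda>h. \<chi> m. lin_form (\<delta>' m) x h)) (at x)"
  using has_derivative_componentwise_within[of d "(\<lambda>h. \<chi> m. lin_form (\<delta>' m) x h)" x UNIV] assms
  by (auto simp: Basis_vec_def inner_axis)

lemma compose_form:
  fixes d :: "real ^ 'n::finite \<Rightarrow> real ^ 'm::finite"
  assumes "\<And>m. ((\<lambda>x. d x $ m) has_derivative lin_form (\<delta>' m) x) (at x)"
    "(g has_derivative lin_form g' (d x)) (at (d x))"
  shows "((\<lambda>x. g (d x)) has_derivative lin_form (\<lambda>i x. \<Sum>m\<in>UNIV. g' m (d x) * \<delta>' m i x) x) (at x)"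
proof -
  have "((\<lambda>x. g (d x)) has_derivative (\<lambda>h. lin_form g' (d x) (\<chi> m. lin_form (\<delta>' m) x h))) (at x)"
    using has_derivative_compose[OF has_derivative_vec_components[of d \<delta>' x, OF assms(1)] assms(2)] by simp
  moreover have "(\<lambda>h. lin_form g' (d x) (\<chi> m. lin_form (\<delta>' m) x h)) = lin_form (\<lambda>i x. \<Sum>m\<in>UNIV. g' m (d x) * \<delta>' m i x) x"
    by (rule ext) (simp add: sum_distrib_left sum_distrib_right mult.assoc, rule sum.swap)
  ultimately show ?thesis by simp
qed

text \<open>Exponents multiply: \<beta> belongs to g, \<gamma> to the map d as a whole, and the
  components of d already carry their product. The uses are \<beta> = \<alpha>, \<gamma> = 1 (d
  Lipschitz) and \<beta> = 1, \<gamma> = \<alpha> (g Lipschitz). The constant is fixed before U, V,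
  g and d and enters linearly in N, as uniformity over families requires.\<close>

lemma bd_compose:
  fixes D L \<beta> \<gamma> :: real
  assumes "0 \<le> D" "0 \<le> L" "0 \<le> \<beta>"
  shows "\<exists>c\<ge>0. \<forall>(U::(real^'n::finite) set) (V::(real^'m::finite) set) N g d. 0 \<le> N \<longrightarrow> holder_bd k \<beta> V N g \<longrightarrow>
     (\<forall>m. holder_bd k (\<beta> * \<gamma>) U D (\<lambda>x. d x $ m)) \<longrightarrow>
     (\<forall>x\<in>U. \<forall>y\<in>U. dist (d x) (d y) \<le> L * dist x y powr \<gamma>) \<longrightarrow> d ` U \<subseteq> V \<longrightarrow>
     holder_bd k (\<beta> * \<gamma>) U (c * N) (\<lambda>x. g (d x))"
proof (induction k)
  case 0
  have "hold0 (\<beta> * \<gamma>) U ((1 + L powr \<beta>) * N) (\<lambda>x. g (d x))"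
    if N: "0 \<le> N" and g: "hold0 \<beta> V N g" and d: "\<forall>m. hold0 (\<beta> * \<gamma>) U D (\<lambda>x. d x $ m)"
    and lip: "\<forall>x\<in>U. \<forall>y\<in>U. dist (d x) (d y) \<le> L * dist x y powr \<gamma>" and im: "d ` U \<subseteq> V"
    for U :: "(real^'n) set" and V :: "(real^'m) set" and N g d
  proof -
    have "continuous_on U (\<lambda>x. \<chi> m. d x $ m)" using d unfolding hold0_def by (intro continuous_on_vec_lambda) auto
    then have "continuous_on U d" by simp
    then have c: "continuous_on U (\<lambda>x. g (d x))"
      using continuous_on_compose2[of V g U d] g im unfolding hold0_def by blast
    have b: "\<bar>g (d x)\<bar> \<le> (1 + L powr \<beta>) * N" if "x \<in> U" for x
    proof -
      have "\<bar>g (d x)\<bar> \<le> N" using g im that unfolding hold0_def by auto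
      also have "\<dots> = 1 * N" by simp
      also have "\<dots> \<le> (1 + L powr \<beta>) * N" using N by (intro mult_right_mono) auto
      finally show ?thesis .
    qed
    have "\<bar>g (d x) - g (d y)\<bar> \<le> (1 + L powr \<beta>) * N * dist x y powr (\<beta> * \<gamma>)" if "x \<in> U" "y \<in> U" for x y
    proof -
      have "\<bar>g (d x) - g (d y)\<bar> \<le> N * dist (d x) (d y) powr \<beta>"
      proof -
        have "d x \<in> V" "d y \<in> V" using im that by auto
        moreover have "\<forall>u\<in>V. \<forall>v\<in>V. \<bar>g u - g v\<bar> \<le> N * dist u v powr \<beta>"
          using g unfolding hold0_def by (elim conjE)
        ultimately show ?thesis by (elim ballE[of _ _ "d x"] ballE[of _ _ "d y"]) blast+
      qed
      also have "\<dots> \<le> N * (L * dist x y powr \<gamma>) powr \<beta>"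
        using lip that N assms by (intro mult_left_mono powr_mono2) auto
      also have "\<dots> = (L powr \<beta>) * N * dist x y powr (\<beta> * \<gamma>)"
        using assms by (simp add: powr_mult powr_powr mult.commute)
      also have "\<dots> \<le> (1 + L powr \<beta>) * N * dist x y powr (\<beta> * \<gamma>)"
        using N by (intro mult_right_mono) auto
      finally show ?thesis .
    qed
    then show ?thesis using b c unfolding hold0_def by auto
  qed
  then show ?case unfolding holder_bd.simps by (intro exI[of _ "1 + L powr \<beta>"]) auto
next
  case (Suc k)
  then obtain c where c: "c \<ge> 0" "\<And>(U::(real^'n) set) (V::(real^'m) set) N g d. 0 \<le> N \<Longrightarrow> holder_bd k \<beta> V N g \<Longrightarrow>
     (\<And>m. holder_bd k (\<beta> * \<gamma>) U D (\<lambda>x. d x $ m)) \<Longrightarrow>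
     (\<forall>x\<in>U. \<forall>y\<in>U. dist (d x) (d y) \<le> L * dist x y powr \<gamma>) \<Longrightarrow> d ` U \<subseteq> V \<Longrightarrow>
     holder_bd k (\<beta> * \<gamma>) U (c * N) (\<lambda>x. g (d x))"
    by (auto simp del: dist_norm)
  \<comment> \<open>The bound for the composite itself, plus one product per summand of the chain
    rule, each estimated by \<open>bd_mult\<close>.\<close>
  define c' where "c' = c + real CARD('m) * (2 ^ Suc k * (c * D))"
  have c'0: "c \<le> c'" "0 \<le> c'" using c(1) assms unfolding c'_def by (auto intro!: add_nonneg_nonneg mult_nonneg_nonneg)
  have main: "holder_bd (Suc k) (\<beta> * \<gamma>) U (c' * N) (\<lambda>x. g (d x))"
    if N: "0 \<le> N" and g: "holder_bd (Suc k) \<beta> V N g" and d: "\<And>m. holder_bd (Suc k) (\<beta> * \<gamma>) U D (\<lambda>x. d x $ m)"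
    and lip: "\<forall>x\<in>U. \<forall>y\<in>U. dist (d x) (d y) \<le> L * dist x y powr \<gamma>" and im: "d ` U \<subseteq> V"
    for U :: "(real^'n) set" and V :: "(real^'m) set" and N g d
  proof -
    have d1: "holder_bd k (\<beta> * \<gamma>) U D (\<lambda>x. d x $ m)" for m by (rule bd_Suc_D[OF d])
    have "holder_bd k (\<beta> * \<gamma>) U (c * N) (\<lambda>x. g (d x))"
      by (rule c(2)[OF N bd_Suc_D[OF g] d1 lip im])
    then have h0: "hold0 (\<beta> * \<gamma>) U (c' * N) (\<lambda>x. g (d x))"
      by (rule hold0_mono[OF bd_hold0 mult_right_mono[OF c'0(1) N]])
    obtain g' where g'0: "\<forall>x\<in>V. (g has_derivative lin_form g' x) (at x)"
      "\<forall>m. holder_bd k \<beta> V N (g' m)" using g unfolding holder_bd.simps by (elim conjE exE)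
    then have g': "x \<in> V \<Longrightarrow> (g has_derivative lin_form g' x) (at x)" "holder_bd k \<beta> V N (g' m)" for x m
      by blast+
    have "\<forall>m. \<exists>d'. (\<forall>x\<in>U. ((\<lambda>x. d x $ m) has_derivative lin_form d' x) (at x)) \<and> (\<forall>i. holder_bd k (\<beta> * \<gamma>) U D (d' i))"
      using d[unfolded holder_bd.simps, THEN conjunct2] by (rule allI)
    from choice[OF this] obtain d' where d'0: "\<forall>m. (\<forall>x\<in>U. ((\<lambda>x. d x $ m) has_derivative lin_form (d' m) x) (at x)) \<and>
        (\<forall>i. holder_bd k (\<beta> * \<gamma>) U D (d' m i))" by (elim exE)
    have d': "((\<lambda>x. d x $ m) has_derivative lin_form (d' m) x) (at x)" if "x \<in> U" for m x
      by (rule d'0[THEN spec, THEN conjunct1, THEN bspec, OF that])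
    have d'2: "holder_bd k (\<beta> * \<gamma>) U D (d' m i)" for m i
      by (rule d'0[THEN spec, THEN conjunct2, THEN spec])
    have "((\<lambda>x. g (d x)) has_derivative lin_form (\<lambda>i x. \<Sum>m\<in>UNIV. g' m (d x) * d' m i x) x) (at x)" if "x \<in> U" for x
    proof -
      have "d x \<in> V" using im that by auto
      from compose_form[of d d' x g g', OF d'[OF that] g'(1)[OF this]] show ?thesis .
    qed
    moreover have "holder_bd k (\<beta> * \<gamma>) U (c' * N) (\<lambda>x. \<Sum>m\<in>UNIV. g' m (d x) * d' m i x)" for i
    proof -
      have 1: "holder_bd k (\<beta> * \<gamma>) U (c * N) (\<lambda>x. g' m (d x))" for m
        by (rule c(2)[OF N g'(2) d1 lip im])
      have "holder_bd k (\<beta> * \<gamma>) U (2 ^ Suc k * (c * N * D)) (\<lambda>x. g' m (d x) * d' m i x)" for m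
        using bd_mult[OF _ _ 1 d'2] c(1) N assms by auto
      then have "holder_bd k (\<beta> * \<gamma>) U (real CARD('m) * (2 ^ Suc k * (c * N * D))) (\<lambda>x. \<Sum>m\<in>UNIV. g' m (d x) * d' m i x)"
        by (intro bd_sum) (use c(1) N assms in auto)
      then show ?thesis
        by (rule bd_mono) (use c(1) N assms in \<open>auto simp: c'_def algebra_simps\<close>)
    qed
    ultimately show ?thesis by (intro bd_Suc_intro[OF h0])
  qed
  show ?case
  proof (intro exI[of _ c'] conjI allI impI, rule c'0(2))
    fix U :: "(real^'n) set" and V :: "(real^'m) set" and N g d
    assume a: "0 \<le> N" "holder_bd (Suc k) \<beta> V N g" "\<forall>m. holder_bd (Suc k) (\<beta> * \<gamma>) U D (\<lambda>x. d x $ m)"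
      "\<forall>x\<in>U. \<forall>y\<in>U. dist (d x) (d y) \<le> L * dist x y powr \<gamma>" "d ` U \<subseteq> V"
    show "holder_bd (Suc k) (\<beta> * \<gamma>) U (c' * N) (\<lambda>x. g (d x))"
      by (rule main[OF a(1,2) spec[OF a(3)] a(4,5)])
  qed
qed

section \<open>Powers, and the norm away from the origin\<close>

lemma hold0_powr:
  fixes s M c :: real
  assumes "0 < c" "0 \<le> M" "hold0 \<alpha> U M f" "\<And>x. x \<in> U \<Longrightarrow> c \<le> f x"
  shows "hold0 \<alpha> U (c powr s + max M c powr s + \<bar>s\<bar> * (c powr (s - 1) + max M c powr (s - 1)) * M) (\<lambda>x. f x powr s)"
proof -
  \<comment> \<open>Adding the values at both ends covers increasing and decreasing powers at once;
    \<open>max M c\<close> keeps the interval nonempty whatever M is.\<close>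
  have B: "t powr s \<le> c powr s + max M c powr s" if "c \<le> t" "t \<le> max M c" for t s :: real
  proof (cases "0 \<le> s")
    case True
    then have "t powr s \<le> max M c powr s" using that assms(1) by (intro powr_mono2) auto
    then show ?thesis by (smt (verit) powr_ge_zero)
  next
    case False
    then have "t powr s \<le> c powr s" using that assms(1) by (intro powr_mono2') auto
    then show ?thesis by (smt (verit) powr_ge_zero)
  qed
  let ?L = "\<bar>s\<bar> * (c powr (s - 1) + max M c powr (s - 1))"
  have L0: "0 \<le> ?L" by (intro mult_nonneg_nonneg add_nonneg_nonneg) auto
  have lip: "\<bar>t powr s - u powr s\<bar> \<le> ?L * \<bar>t - u\<bar>" if "t \<in> {c..max M c}" "u \<in> {c..max M c}" for t u
  proof -
    have "norm (t powr s - u powr s) \<le> ?L * norm (t - u)"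
    proof (rule field_differentiable_bound[of "{c..max M c}" "\<lambda>t. t powr s" "\<lambda>t. s * t powr (s - 1)"])
      fix z assume z: "z \<in> {c..max M c}"
      then have "z > 0" using assms(1) by auto
      then show "((\<lambda>t. t powr s) has_field_derivative s * z powr (s - 1)) (at z within {c..max M c})"
        using has_real_derivative_powr[of z s] by (auto intro: has_field_derivative_at_within)
      have "\<bar>s\<bar> * z powr (s - 1) \<le> ?L" using z by (intro mult_left_mono B) auto
      then show "norm (s * z powr (s - 1)) \<le> ?L" by (simp add: abs_mult)
    qed (use that in auto)
    then show ?thesis by simp
  qed
  have fx: "f x \<in> {c..max M c}" if "x \<in> U" for x
  proof -
    have "\<bar>f x\<bar> \<le> M" using assms(3) that unfolding hold0_def by auto
    then show ?thesis using assms(4)[OF that] by auto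
  qed
  have c: "continuous_on U (\<lambda>x. f x powr s)"
    using assms(3) assms(1) fx unfolding hold0_def by (intro continuous_intros) force+
  have b: "\<bar>f x powr s\<bar> \<le> c powr s + max M c powr s + ?L * M" if "x \<in> U" for x
    using B[of "f x" s] fx[OF that] mult_nonneg_nonneg[OF L0 assms(2)] by auto
  have "\<bar>f x powr s - f y powr s\<bar> \<le> (c powr s + max M c powr s + ?L * M) * dist x y powr \<alpha>"
    if "x \<in> U" "y \<in> U" for x y
  proof -
    have "\<bar>f x powr s - f y powr s\<bar> \<le> ?L * \<bar>f x - f y\<bar>" using lip fx that by blast
    also have "\<dots> \<le> ?L * (M * dist x y powr \<alpha>)"
      using assms(3) that L0 unfolding hold0_def by (intro mult_left_mono) auto
    also have "\<dots> = (?L * M) * dist x y powr \<alpha>" by simp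
    also have "\<dots> \<le> (c powr s + max M c powr s + ?L * M) * dist x y powr \<alpha>"
      by (intro mult_right_mono) auto
    finally show ?thesis .
  qed
  then show ?thesis unfolding hold0_def using b c by blast
qed

text \<open>The induction runs over all s, because each derivative lowers the exponent of f by
  one.\<close>

lemma bd_powr:
  fixes s M c :: real
  assumes "0 < c" "0 \<le> M"
  shows "\<exists>C\<ge>0. \<forall>(U::(real^'n::finite) set) f. holder_bd k \<alpha> U M f \<longrightarrow> (\<forall>x\<in>U. c \<le> f x) \<longrightarrow>
    holder_bd k \<alpha> U C (\<lambda>x. f x powr s)"
proof (induction k arbitrary: s)
  case 0
  let ?C = "c powr s + max M c powr s + \<bar>s\<bar> * (c powr (s - 1) + max M c powr (s - 1)) * M"
  have "0 \<le> ?C" using assms by (intro add_nonneg_nonneg mult_nonneg_nonneg) auto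
  then show ?case using hold0_powr[OF assms] unfolding holder_bd.simps by blast
next
  case (Suc k)
  let ?C0 = "c powr s + max M c powr s + \<bar>s\<bar> * (c powr (s - 1) + max M c powr (s - 1)) * M"
  have C0: "0 \<le> ?C0" using assms by (intro add_nonneg_nonneg mult_nonneg_nonneg) auto
  from Suc.IH[of "s - 1"] obtain C1 where C1: "C1 \<ge> 0" 
    "\<forall>(U::(real^'n::finite) set) f. holder_bd k \<alpha> U M f \<longrightarrow> (\<forall>x\<in>U. c \<le> f x) \<longrightarrow>
    holder_bd k \<alpha> U C1 (\<lambda>x. f x powr (s - 1))" by auto
  define C where "C = ?C0 + \<bar>s\<bar> * (2 ^ Suc k * (C1 * M))"
  have C: "?C0 \<le> C" "\<bar>s\<bar> * (2 ^ Suc k * (C1 * M)) \<le> C" "0 \<le> C"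
    using C0 C1(1) assms unfolding C_def by (auto intro!: add_nonneg_nonneg mult_nonneg_nonneg)
  show ?case
  proof (intro exI[of _ C] conjI allI impI, rule C(3))
    fix U :: "(real^'n) set" and f assume f: "holder_bd (Suc k) \<alpha> U M f" and low: "\<forall>x\<in>U. c \<le> f x"
    have h0: "hold0 \<alpha> U C (\<lambda>x. f x powr s)"
      using hold0_mono[OF hold0_powr[OF assms bd_hold0[OF f]] C(1)] low by blast
    obtain f' where f': "\<forall>x\<in>U. (f has_derivative lin_form f' x) (at x)"
      "\<forall>m. holder_bd k \<alpha> U M (f' m)" using f unfolding holder_bd.simps by (elim conjE exE)
    show "holder_bd (Suc k) \<alpha> U C (\<lambda>x. f x powr s)"
    proof (rule bd_Suc_intro[OF h0])
      fix x assume x: "x \<in> U"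
      then have "0 < f x" using low assms by force
      from DERIV_compose_FDERIV[OF has_real_derivative_powr[OF this, of s] bspec[OF f'(1) x]]
      show "((\<lambda>x. f x powr s) has_derivative lin_form (\<lambda>i x. s * (f x powr (s - 1) * f' i x)) x) (at x)"
        by (simp add: sum_distrib_left mult_ac)
    next
      fix i
      have 1: "holder_bd k \<alpha> U C1 (\<lambda>x. f x powr (s - 1))"
        using C1(2)[rule_format, OF bd_Suc_D[OF f]] low by blast
      show "holder_bd k \<alpha> U C (\<lambda>x. s * (f x powr (s - 1) * f' i x))"
        by (rule bd_mono[OF bd_cmult[OF bd_mult[OF C1(1) assms(2) 1 spec[OF f'(2), of i]]] C(2)])
    qed
  qed
qed

text \<open>The gradient of the norm is x times the inverse of the norm, so a bound of order k for
  the norm, fed through \<open>bd_powr\<close>, produces one of order k + 1.\<close>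

lemma bd_norm:
  fixes c D :: real
  assumes "0 < c"
  shows "\<exists>C\<ge>0. \<forall>U::(real^'n::finite) set. (\<forall>x\<in>U. c \<le> norm x \<and> norm x \<le> D) \<longrightarrow> holder_bd k 1 U C norm"
proof (induction k)
  case 0
  have "\<bar>norm x - norm y\<bar> \<le> max D 1 * dist x y" for x y :: "real^'n"
    using norm_triangle_ineq3[of x y] mult_right_mono[of 1 "max D 1" "dist x y"] by (simp add: dist_norm)
  then have "\<forall>U::(real^'n) set. (\<forall>x\<in>U. c \<le> norm x \<and> norm x \<le> D) \<longrightarrow> holder_bd 0 1 U (max D 1) norm"
    unfolding holder_bd.simps hold0_def by (auto intro!: continuous_intros)
  then show ?case by (intro exI[of _ "max D 1"]) auto
next
  case (Suc k)
  then obtain C0 where C0: "C0 \<ge> 0" "\<And>U::(real^'n::finite) set. (\<forall>x\<in>U. c \<le> norm x \<and> norm x \<le> D) \<Longrightarrow> holder_bd k 1 U C0 norm"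
    by auto
  obtain C1 where C1: "C1 \<ge> 0" 
    "\<forall>(U::(real^'n::finite) set) f. holder_bd k 1 U C0 f \<longrightarrow> (\<forall>x\<in>U. c \<le> f x) \<longrightarrow>
    holder_bd k 1 U C1 (\<lambda>x. f x powr -1)" using bd_powr[OF assms C0(1)] by blast
  define C where "C = C0 + 2 ^ Suc k * (max D 1 * C1)"
  have C: "C0 \<le> C" "2 ^ Suc k * (max D 1 * C1) \<le> C" "0 \<le> C"
    using C0 C1(1) assms unfolding C_def by (auto intro!: add_nonneg_nonneg mult_nonneg_nonneg)
  show ?case
  proof (intro exI[of _ C] conjI allI impI, rule C(3))
    fix U :: "(real^'n) set" assume U: "\<forall>x\<in>U. c \<le> norm x \<and> norm x \<le> D"
    note n = C0(2)[OF U]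
    show "holder_bd (Suc k) 1 U C norm"
    proof (rule bd_Suc_intro[OF hold0_mono[OF bd_hold0[OF n] C(1)]])
      fix x assume x: "x \<in> U"
      then have "x \<noteq> 0" using U assms by auto
      have "(\<lambda>h. inner (sgn x) h) = lin_form (\<lambda>i x. x $ i * norm x powr -1) x"
        using \<open>x \<noteq> 0\<close> by (auto simp: sgn_div_norm inner_vec_def powr_minus mult_ac)
      then show "(norm has_derivative lin_form (\<lambda>i x. x $ i * norm x powr -1) x) (at x)"
        using has_derivative_norm[OF \<open>x \<noteq> 0\<close>] by (simp add: inner_commute)
    next
      fix i
      have 1: "holder_bd k 1 U C1 (\<lambda>x. norm x powr -1)"
        using C1(2)[rule_format, OF n] U by blast
      have 2: "holder_bd k 1 U (max D 1) (\<lambda>x. x $ i)" using U by (intro bd_coord) auto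
      show "holder_bd k 1 U C (\<lambda>x. x $ i * norm x powr -1)"
        by (rule bd_mono[OF bd_mult[OF _ C1(1) 2 1] C(2)]) auto
    qed
  qed
qed

lemma bounded_linear_lin_form: "bounded_linear (lin_form f' x)"
  by (intro bounded_linear_sum bounded_linear_const_mult bounded_linear_vec_nth)

lemma lin_form_axis: "lin_form f' x (axis i 1) = f' i x"
  by (simp add: axis_def if_distrib[of "\<lambda>u. _ * u"] cong: if_cong)

text \<open>Serves to show a partial derivative measurable in a parameter: along a fixed null
  sequence it is a pointwise limit of difference quotients.\<close>

lemma directional_derivative_seq:
  fixes f :: "real ^ 'n::finite \<Rightarrow> real"
  assumes "(f has_derivative D) (at x)" "t \<longlonglongrightarrow> 0" "\<And>n. t n \<noteq> (0::real)"
  shows "(\<lambda>n. (f (x + t n *\<^sub>R v) - f x) / t n) \<longlonglongrightarrow> D v"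
proof -
  have 0: "((\<lambda>s::real. x + s *\<^sub>R v) has_derivative (\<lambda>s. s *\<^sub>R v)) (at 0)"
    by (auto intro!: derivative_eq_intros)
  have "((\<lambda>s. f (x + s *\<^sub>R v)) has_derivative (\<lambda>s. D (s *\<^sub>R v))) (at 0)"
    by (rule has_derivative_compose[OF 0]) (use assms in simp)
  then have "((\<lambda>s. f (x + s *\<^sub>R v)) has_real_derivative D v) (at 0)"
    unfolding has_field_derivative_def
    using linear_cmul[OF has_derivative_linear[OF assms(1)]] by (simp add: mult_commute_abs)
  then have "((\<lambda>h. (f (x + h *\<^sub>R v) - f x) / h) \<longlongrightarrow> D v) (at 0)"
    by (simp add: DERIV_def)
  then show ?thesis
    using assms(2,3) unfolding tendsto_at_iff_sequentially comp_def by auto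
qed

section \<open>Integrals depending on a parameter\<close>

lemma integral_abs_le:
  fixes f :: "'a \<Rightarrow> real"
  assumes "integrable M f" "integrable M g" "\<And>x. x \<in> space M \<Longrightarrow> \<bar>f x\<bar> \<le> g x"
  shows "\<bar>\<integral>x. f x \<partial>M\<bar> \<le> (\<integral>x. g x \<partial>M)"
proof -
  have "\<bar>\<integral>x. f x \<partial>M\<bar> \<le> (\<integral>x. norm (f x) \<partial>M)" using integral_norm_bound[of M f] by simp
  also have "\<dots> \<le> (\<integral>x. g x \<partial>M)"
    by (rule Bochner_Integration.integral_mono[OF integrable_norm[OF assms(1)] assms(2)]) (use assms(3) in simp)
  finally show ?thesis .
qed

text \<open>Size and Hoelder constants simply integrate. Continuity does not follow from them when
  \<alpha> = 0 and comes from dominated convergence.\<close>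

lemma hold0_integral:
  fixes f :: "'a \<Rightarrow> real ^ 'n::finite \<Rightarrow> real"
  assumes h: "\<And>w. w \<in> space \<nu> \<Longrightarrow> hold0 \<alpha> U (M w) (f w)"
    and meas: "\<And>x. x \<in> U \<Longrightarrow> (\<lambda>w. f w x) \<in> borel_measurable \<nu>" and int: "integrable \<nu> M"
  shows "hold0 \<alpha> U (\<integral>w. M w \<partial>\<nu>) (\<lambda>x. \<integral>w. f w x \<partial>\<nu>)"
    and "x \<in> U \<Longrightarrow> integrable \<nu> (\<lambda>w. f w x)"
proof -
  have b: "\<bar>f w x\<bar> \<le> M w" if "w \<in> space \<nu>" "x \<in> U" for w x
    using h[OF that(1)] that(2) unfolding hold0_def by auto
  have i: "integrable \<nu> (\<lambda>w. f w x)" if "x \<in> U" for x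
    by (rule Bochner_Integration.integrable_bound[OF int meas[OF that]]) (use b[OF _ that] in force)
  then show "x \<in> U \<Longrightarrow> integrable \<nu> (\<lambda>w. f w x)" .
  have "\<bar>\<integral>w. f w x \<partial>\<nu>\<bar> \<le> (\<integral>w. M w \<partial>\<nu>)" if "x \<in> U" for x
    using integral_abs_le[OF i[OF that] int] b[OF _ that] by auto
  moreover have "\<bar>(\<integral>w. f w x \<partial>\<nu>) - (\<integral>w. f w y \<partial>\<nu>)\<bar> \<le> (\<integral>w. M w \<partial>\<nu>) * dist x y powr \<alpha>"
    if "x \<in> U" "y \<in> U" for x y
  proof -
    have "abs (\<integral>w. f w x - f w y \<partial>\<nu>) \<le> (\<integral>w. M w * dist x y powr \<alpha> \<partial>\<nu>)"
      using h that unfolding hold0_def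
      by (intro integral_abs_le Bochner_Integration.integrable_diff i integrable_mult_left int) auto
    then show ?thesis using i that int by simp
  qed
  moreover have "continuous_on U (\<lambda>x. \<integral>w. f w x \<partial>\<nu>)"
  proof (rule continuous_on_sequentiallyI)
    fix u a assume u: "\<forall>n. u n \<in> U" "a \<in> U" "u \<longlonglongrightarrow> a"
    show "(\<lambda>n. \<integral>w. f w (u n) \<partial>\<nu>) \<longlonglongrightarrow> (\<integral>w. f w a \<partial>\<nu>)"
    proof (rule integral_dominated_convergence[OF meas[OF u(2)] meas int])
      show "u n \<in> U" for n using u by auto
      show "AE w in \<nu>. (\<lambda>n. f w (u n)) \<longlonglongrightarrow> f w a"
      proof (rule AE_I2)
        fix w assume "w \<in> space \<nu>"
        then have "continuous_on U (f w)" using h unfolding hold0_def by auto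
        then show "(\<lambda>n. f w (u n)) \<longlonglongrightarrow> f w a" using u unfolding continuous_on_sequentially comp_def by auto
      qed
      show "AE w in \<nu>. norm (f w (u n)) \<le> M w" for n using b u by (intro AE_I2) auto
    qed
  qed
  ultimately show "hold0 \<alpha> U (\<integral>w. M w \<partial>\<nu>) (\<lambda>x. \<integral>w. f w x \<partial>\<nu>)"
    unfolding hold0_def by blast
qed

text \<open>Dominated convergence for the normalised Frechet remainder. Measurability of the
  derivative in w is a conclusion here, since the gradients are later obtained by choice and nothing
  else is known of their dependence on w.\<close>

lemma has_derivative_integral_param:
  fixes f :: "'a \<Rightarrow> real ^ 'n::finite \<Rightarrow> real"
  assumes U: "open U" and x: "x \<in> U"
    and der: "\<And>w y. w \<in> space \<nu> \<Longrightarrow> y \<in> U \<Longrightarrow> (f w has_derivative lin_form (f' w) y) (at y)"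
    and b: "\<And>w y i. w \<in> space \<nu> \<Longrightarrow> y \<in> U \<Longrightarrow> \<bar>f' w i y\<bar> \<le> M w"
    and i: "\<And>y. y \<in> U \<Longrightarrow> integrable \<nu> (\<lambda>w. f w y)" and int: "integrable \<nu> M"
  shows "(\<lambda>w. f' w i x) \<in> borel_measurable \<nu>"
    and "((\<lambda>x. \<integral>w. f w x \<partial>\<nu>) has_derivative lin_form (\<lambda>i x. \<integral>w. f' w i x \<partial>\<nu>) x) (at x)"
proof -
  obtain d where d: "d > 0" "ball x d \<subseteq> U" using U x by (meson open_contains_ball)
  have meas: "(\<lambda>w. f w y) \<in> borel_measurable \<nu>" if "y \<in> U" for y using i[OF that] by auto
  have m': "(\<lambda>w. f' w i x) \<in> borel_measurable \<nu>" for i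
  proof (rule borel_measurable_LIMSEQ_real)
    \<comment> \<open>Dividing by n + 2 keeps every step strictly below d, the one for n = 0
      included.\<close>
    let ?t = "\<lambda>n. d / (real n + 2)"
    have t: "?t \<longlonglongrightarrow> 0" by real_asymp
    have t0: "0 < ?t n" "?t n < d" for n using d(1) by (auto simp: field_simps intro: add_pos_nonneg)
    show "(\<lambda>n. (f w (x + ?t n *\<^sub>R axis i 1) - f w x) / ?t n) \<longlonglongrightarrow> f' w i x" if "w \<in> space \<nu>" for w
      using directional_derivative_seq[OF der[OF that x] t, of "axis i 1"] t0(1) unfolding lin_form_axis
      by (metis less_irrefl)
    show "(\<lambda>w. (f w (x + ?t n *\<^sub>R axis i 1) - f w x) / ?t n) \<in> borel_measurable \<nu>" for n
    proof -
      have "x + ?t n *\<^sub>R axis i 1 \<in> U" using d(2) t0[of n] by (auto simp: subset_eq dist_norm)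
      then show ?thesis using meas x by (intro borel_measurable_divide borel_measurable_diff) auto
    qed
  qed
  then show "(\<lambda>w. f' w i x) \<in> borel_measurable \<nu>" .
  have i': "integrable \<nu> (\<lambda>w. f' w i x)" for i
  proof (rule Bochner_Integration.integrable_bound[OF int m'], rule AE_I2)
    show "norm (f' w i x) \<le> norm (M w)" if "w \<in> space \<nu>" for w using b[OF that x, of i] by simp
  qed
  let ?F = "\<lambda>x. \<integral>w. f w x \<partial>\<nu>" and ?D = "lin_form (\<lambda>i x. \<integral>w. f' w i x \<partial>\<nu>) x"
  have "((\<lambda>h. norm (?F (x + h) - ?F x - ?D h) / norm h) \<longlongrightarrow> 0) (at 0)"
    unfolding tendsto_at_iff_sequentially comp_def
  proof (intro allI impI)
    fix X :: "nat \<Rightarrow> real ^ 'n" assume X: "\<forall>n. X n \<in> UNIV - {0}" "X \<longlonglongrightarrow> 0"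
    from X(2) have "\<forall>\<^sub>F n in sequentially. norm (X n) < d" using d(1) 
      by (metis (no_types, lifting) eventually_mono tendstoD dist_0_norm dist_commute)
    then obtain N where N: "\<And>n. n \<ge> N \<Longrightarrow> norm (X n) < d" unfolding eventually_sequentially by auto
    \<comment> \<open>Dropping the first N terms puts all increments inside the ball where the mean
      value bound holds; \<open>LIMSEQ_offset\<close> restores them at the end.\<close>
    let ?Y = "\<lambda>n. X (n + N)"
    have Y: "?Y \<longlonglongrightarrow> 0" "\<And>n. ?Y n \<noteq> 0" "\<And>n. norm (?Y n) < d" using X N by (auto intro: LIMSEQ_ignore_initial_segment)
    let ?g = "\<lambda>n w. (f w (x + ?Y n) - f w x - lin_form (f' w) x (?Y n)) / norm (?Y n)"
    have xY: "x + ?Y n \<in> ball x d" for n using Y(3)[of n] by (auto simp: dist_norm)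
    have lim: "(\<lambda>n. \<integral>w. ?g n w \<partial>\<nu>) \<longlonglongrightarrow> (\<integral>w. 0 \<partial>\<nu>)"
    \<comment> \<open>One copy of the gradient bound for the increment of f, one for its linear
      part.\<close>
    proof (rule integral_dominated_convergence[where w = "\<lambda>w. 2 * (real CARD('n) * M w)"])
      show "?g n \<in> borel_measurable \<nu>" for n
        by (intro borel_measurable_divide borel_measurable_diff borel_measurable_sum borel_measurable_times m'
          meas[OF x] meas[OF subsetD[OF d(2) xY]] borel_measurable_const)
      show "integrable \<nu> (\<lambda>w. 2 * (real CARD('n) * M w))" using int by auto
      show "AE w in \<nu>. (\<lambda>n. ?g n w) \<longlonglongrightarrow> 0"
      proof (rule AE_I2)
        fix w assume w: "w \<in> space \<nu>"
        have "((\<lambda>h. norm (f w (x + h) - f w x - lin_form (f' w) x h) / norm h) \<longlongrightarrow> 0) (at 0)"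
          using der[OF w x] unfolding has_derivative_at by auto
        then have "(\<lambda>n. norm (f w (x + ?Y n) - f w x - lin_form (f' w) x (?Y n)) / norm (?Y n)) \<longlonglongrightarrow> 0"
          using Y unfolding tendsto_at_iff_sequentially comp_def by auto
        then show "(\<lambda>n. ?g n w) \<longlonglongrightarrow> 0"
          by (subst tendsto_rabs_zero_iff[symmetric]) (simp add: abs_divide)
      qed
      show "AE w in \<nu>. norm (?g n w) \<le> 2 * (real CARD('n) * M w)" for n
      proof (rule AE_I2)
        fix w assume w: "w \<in> space \<nu>"
        have 1: "\<bar>f w (x + ?Y n) - f w x\<bar> \<le> real CARD('n) * M w * dist (x + ?Y n) x"
          by (rule lipschitz_if_grad_bound[of "ball x d" "f w" "f' w"]) (use der[OF w] b[OF w] d xY in auto)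
        have 2: "\<bar>lin_form (f' w) x (?Y n)\<bar> \<le> real CARD('n) * M w * norm (?Y n)"
          by (rule lin_form_bound[of "f' w" x "M w", OF b[OF w x]])
        have "\<bar>f w (x + ?Y n) - f w x - lin_form (f' w) x (?Y n)\<bar> \<le> 2 * (real CARD('n) * M w) * norm (?Y n)"
          using 1 2 by (simp add: dist_norm)
        then show "norm (?g n w) \<le> 2 * (real CARD('n) * M w)"
          using Y(2)[of n] by (simp add: abs_divide divide_le_eq)
      qed
    qed auto
    have eq: "(\<integral>w. ?g n w \<partial>\<nu>) = (?F (x + ?Y n) - ?F x - ?D (?Y n)) / norm (?Y n)" for n
    proof -
      have "x + ?Y n \<in> U" using xY d(2) by auto
      then show ?thesis using i x i' by simp
    qed
    have "(\<lambda>n. (?F (x + ?Y n) - ?F x - ?D (?Y n)) / norm (?Y n)) \<longlonglongrightarrow> 0"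
      using lim unfolding eq Bochner_Integration.integral_zero .
    then have "(\<lambda>n. norm (?F (x + ?Y n) - ?F x - ?D (?Y n)) / norm (?Y n)) \<longlonglongrightarrow> 0"
      by (subst (asm) tendsto_rabs_zero_iff[symmetric]) (simp add: abs_divide)
    then show "(\<lambda>n. norm (?F (x + X n) - ?F x - ?D (X n)) / norm (X n)) \<longlonglongrightarrow> 0"
      by (rule LIMSEQ_offset)
  qed
  then show "(?F has_derivative ?D) (at x)" unfolding has_derivative_at by (intro conjI bounded_linear_lin_form)
qed

text \<open>The gradients are picked separately for each w. That they can be integrated again, so
  that the induction hypothesis applies to them, rests on the first conclusion of
  \<open>has_derivative_integral_param\<close>.\<close>

lemma bd_integral:
  fixes f :: "'a \<Rightarrow> real ^ 'n::finite \<Rightarrow> real"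
  assumes U: "open U" and int: "integrable \<nu> M"
  shows "(\<And>w. w \<in> space \<nu> \<Longrightarrow> holder_bd k \<alpha> U (M w) (f w)) \<Longrightarrow>
    (\<And>x. x \<in> U \<Longrightarrow> (\<lambda>w. f w x) \<in> borel_measurable \<nu>) \<Longrightarrow>
    holder_bd k \<alpha> U (\<integral>w. M w \<partial>\<nu>) (\<lambda>x. \<integral>w. f w x \<partial>\<nu>)"
proof (induction k arbitrary: f)
  case 0
  then show ?case unfolding holder_bd.simps by (rule hold0_integral(1)[OF _ _ int])
next
  case (Suc k)
  note h0 = hold0_integral[of \<nu> \<alpha> U M f, OF bd_hold0[OF Suc.prems(1)] Suc.prems(2) int]
  have "\<forall>w\<in>space \<nu>. \<exists>f'. (\<forall>x\<in>U. (f w has_derivative lin_form f' x) (at x)) \<and> (\<forall>i. holder_bd k \<alpha> U (M w) (f' i))"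
    using Suc.prems(1)[unfolded holder_bd.simps, THEN conjunct2] by (rule ballI)
  from bchoice[OF this] obtain f' where f'0: "\<forall>w\<in>space \<nu>. (\<forall>x\<in>U. (f w has_derivative lin_form (f' w) x) (at x)) \<and>
     (\<forall>i. holder_bd k \<alpha> U (M w) (f' w i))" by (elim exE)
  have der: "(f w has_derivative lin_form (f' w) y) (at y)" if "w \<in> space \<nu>" "y \<in> U" for w y
    by (rule f'0[THEN bspec, OF that(1), THEN conjunct1, THEN bspec, OF that(2)])
  have bd: "holder_bd k \<alpha> U (M w) (f' w i)" if "w \<in> space \<nu>" for w i
    by (rule f'0[THEN bspec, OF that, THEN conjunct2, THEN spec])
  have b: "\<bar>f' w i y\<bar> \<le> M w" if "w \<in> space \<nu>" "y \<in> U" for w i y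
    using bd_hold0[OF bd[OF that(1)], unfolded hold0_def] that(2) by blast
  have i: "integrable \<nu> (\<lambda>w. f w y)" if "y \<in> U" for y by (rule h0(2)[OF _ _ that])
  note D = has_derivative_integral_param[of U _ \<nu> f f' M, OF U _ der b i int]
  show ?case
  proof (rule bd_Suc_intro)
    show "hold0 \<alpha> U (\<integral>w. M w \<partial>\<nu>) (\<lambda>x. \<integral>w. f w x \<partial>\<nu>)" by (rule h0(1))
    show "((\<lambda>x. \<integral>w. f w x \<partial>\<nu>) has_derivative lin_form (\<lambda>i x. \<integral>w. f' w i x \<partial>\<nu>) x) (at x)" if "x \<in> U" for x
      by (rule D(2)[OF that])
    show "holder_bd k \<alpha> U (\<integral>w. M w \<partial>\<nu>) (\<lambda>x. \<integral>w. f' w i x \<partial>\<nu>)" for i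
      by (rule Suc.IH[OF bd D(1)])
  qed
qed

section \<open>Dilations and isometries of Lebesgue measure\<close>

lemma nn_integral_affine:
  fixes f :: "'a::euclidean_space \<Rightarrow> ennreal"
  assumes [measurable]: "f \<in> borel_measurable borel" and c: "c \<noteq> 0"
  shows "(\<integral>\<^sup>+x. f x \<partial>lborel) = ennreal (\<bar>c\<bar> ^ DIM('a)) * (\<integral>\<^sup>+x. f (t + c *\<^sub>R x) \<partial>lborel)"
  by (subst lborel_affine[OF c, of t])
     (simp add: nn_integral_density nn_integral_distr nn_integral_cmult)

lemma nn_integral_translate:
  fixes f :: "'a::euclidean_space \<Rightarrow> ennreal"
  assumes "f \<in> borel_measurable borel"
  shows "(\<integral>\<^sup>+x. f (t + x) \<partial>lborel) = (\<integral>\<^sup>+x. f x \<partial>lborel)" 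
    and "(\<integral>\<^sup>+x. f (t - x) \<partial>lborel) = (\<integral>\<^sup>+x. f x \<partial>lborel)"
  using nn_integral_affine[OF assms, of 1 t] nn_integral_affine[OF assms, of "-1" t] by auto

lemma nn_integral_isometry:
  fixes f :: "'a::euclidean_space \<Rightarrow> ennreal" and R :: "'a \<Rightarrow> 'a"
  assumes f[measurable]: "f \<in> borel_measurable borel" and R: "linear R" "surj R" "\<And>x. norm (R x) = norm x"
  shows "(\<integral>\<^sup>+x. f (R x) \<partial>lborel) = (\<integral>\<^sup>+x. f x \<partial>lborel)"
proof -
  let ?g = "indicator (ball 0 1) :: 'a \<Rightarrow> ennreal"
  have Rm[measurable]: "R \<in> borel_measurable borel"
    using R(1) by (intro borel_measurable_continuous_onI linear_continuous_on) (simp add: linear_conv_bounded_linear)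
  have gm[measurable]: "?g \<in> borel_measurable borel" by (intro borel_measurable_indicator) auto
  have gR: "?g (R x) = ?g x" for x using R(3) by (auto simp: indicator_def)
  have "(\<integral>\<^sup>+x. f (R x) \<partial>lborel) * (\<integral>\<^sup>+y. ?g y \<partial>lborel) = (\<integral>\<^sup>+x. f (R x) * (\<integral>\<^sup>+y. ?g y \<partial>lborel) \<partial>lborel)"
    by (subst nn_integral_multc) auto
  also have "\<dots> = (\<integral>\<^sup>+x. f (R x) * (\<integral>\<^sup>+y. ?g (R x + y) \<partial>lborel) \<partial>lborel)"
    by (subst nn_integral_translate(1)) auto
  also have "\<dots> = (\<integral>\<^sup>+x. \<integral>\<^sup>+y. f (R x) * ?g (R x + y) \<partial>lborel \<partial>lborel)"
    by (intro nn_integral_cong, subst nn_integral_cmult) auto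
  also have "\<dots> = (\<integral>\<^sup>+y. \<integral>\<^sup>+x. f (R x) * ?g (R x + y) \<partial>lborel \<partial>lborel)"
    by (rule lborel_pair.Fubini'[symmetric]) (simp add: case_prod_unfold)
  also have "\<dots> = (\<integral>\<^sup>+y. \<integral>\<^sup>+x. f (R x - y) * ?g (R x) \<partial>lborel \<partial>lborel)"
  proof (rule nn_integral_cong)
    fix y
    \<comment> \<open>Surjectivity turns the translation by y in the target into a translation by v
      in the source.\<close>
    obtain v where v: "y = R v" using R(2) by (metis surjD)
    have "(\<integral>\<^sup>+x. f (R x) * ?g (R x + y) \<partial>lborel) = (\<integral>\<^sup>+x. f (R (- v + x)) * ?g (R (- v + x) + y) \<partial>lborel)"
      by (rule nn_integral_translate(1)[symmetric]) measurable
    also have "\<dots> = (\<integral>\<^sup>+x. f (R x - y) * ?g (R x) \<partial>lborel)"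
    proof -
      have "R (- v + x) = R x - y" for x using linear_add[OF R(1), of "- v" x] linear_neg[OF R(1), of v] v by simp
      then show ?thesis by simp
    qed
    finally show "(\<integral>\<^sup>+x. f (R x) * ?g (R x + y) \<partial>lborel) = (\<integral>\<^sup>+x. f (R x - y) * ?g (R x) \<partial>lborel)" .
  qed
  also have "\<dots> = (\<integral>\<^sup>+x. \<integral>\<^sup>+y. f (R x - y) * ?g (R x) \<partial>lborel \<partial>lborel)"
    by (rule lborel_pair.Fubini') (simp add: case_prod_unfold)
  also have "\<dots> = (\<integral>\<^sup>+x. (\<integral>\<^sup>+y. f (R x - y) \<partial>lborel) * ?g x \<partial>lborel)"
    unfolding gR by (intro nn_integral_cong, subst nn_integral_multc) auto
  also have "\<dots> = (\<integral>\<^sup>+x. (\<integral>\<^sup>+y. f y \<partial>lborel) * ?g x \<partial>lborel)"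
    by (subst nn_integral_translate(2)) auto
  also have "\<dots> = (\<integral>\<^sup>+y. f y \<partial>lborel) * (\<integral>\<^sup>+y. ?g y \<partial>lborel)"
    by (subst nn_integral_cmult) auto
  finally have eq: "(\<integral>\<^sup>+x. f (R x) \<partial>lborel) * (\<integral>\<^sup>+y. ?g y \<partial>lborel) = (\<integral>\<^sup>+y. f y \<partial>lborel) * (\<integral>\<^sup>+y. ?g y \<partial>lborel)" .
  have "unit_ball_vol (real DIM('a)) > 0" by simp
  then have "unit_ball_vol (real DIM('a)) \<noteq> 0" by (rule less_imp_neq[symmetric])
  moreover have "(\<integral>\<^sup>+y. ?g y \<partial>lborel) = ennreal (unit_ball_vol (DIM('a)))"
    using emeasure_ball[of 1 "0::'a"] by simp
  ultimately show ?thesis using eq by (simp add: mult.commute[of _ "ennreal _"] ennreal_mult_cancel_left)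
qed

text \<open>The logarithmic average over dilations replaces polar coordinates and Jacobians: after
  scaling out the norm, the substitution \<open>t = q s\<close> on each ray removes \<open>q\<close> altogether.\<close>

lemma nn_integral_radial_scaling:
  fixes F :: "'a::euclidean_space \<Rightarrow> ennreal" and q :: "'a \<Rightarrow> real"
  assumes F[measurable]: "F \<in> borel_measurable borel" and q[measurable]: "q \<in> borel_measurable borel"
    and q0: "\<And>w. 0 < q w" and hom: "\<And>t w. 0 < t \<Longrightarrow> q (t *\<^sub>R w) = q w"
  shows "(\<integral>\<^sup>+w. F (q w *\<^sub>R w) * ennreal (q w ^ DIM('a)) \<partial>lborel) = (\<integral>\<^sup>+w. F w \<partial>lborel)"
proof -
  define n where "n = DIM('a)"
  \<comment> \<open>Of this weight only that its integral \<kappa> is neither 0 nor infinite is used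
    in the end. Since r h(r t) integrates to \<kappa> for every r > 0, the choice r = |w| lets it be
    inserted at every w except 0.\<close>
  define h :: "real \<Rightarrow> real" where "h = (\<lambda>t. indicator {1<..2} t / t)"
  have [measurable]: "h \<in> borel_measurable borel" unfolding h_def by measurable
  have h0: "0 \<le> h t" for t unfolding h_def by (auto simp: indicator_def)
  have hneg: "h t = 0" if "t \<le> 0" for t using that unfolding h_def by auto
  define \<kappa> where "\<kappa> = (\<integral>\<^sup>+t. ennreal (h t) \<partial>lborel)"
  have "\<kappa> \<le> (\<integral>\<^sup>+t. indicator {1<..2::real} t \<partial>lborel)"
    unfolding \<kappa>_def by (intro nn_integral_mono) (auto simp: h_def indicator_def)
  then have k1: "\<kappa> \<noteq> top" by (auto simp: top_unique)
  have "(\<integral>\<^sup>+t. ennreal (1/2) * indicator {1<..2::real} t \<partial>lborel) \<le> \<kappa>"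
    unfolding \<kappa>_def
  proof (intro nn_integral_mono)
    fix t :: real
    have "t \<in> {1<..2} \<Longrightarrow> 1 / 2 \<le> 1 / t" by (auto simp: field_simps)
    then show "ennreal (1/2) * indicator {1<..2} t \<le> ennreal (h t)"
    proof (cases "t \<in> {1<..2}")
      case True
      then have "ennreal (1/2) * indicator {1<..2} t = ennreal (1/2)" "h t = 1 / t" unfolding h_def by (simp_all only: indicator_simps mult_1_right)
      then show ?thesis using True \<open>t \<in> {1<..2} \<Longrightarrow> 1 / 2 \<le> 1 / t\<close> by (simp only: ennreal_leI)
    next
      case False
      then have "indicator {1<..2} t = (0::ennreal)" by (rule indicator_simps(2))
      then show ?thesis by simp
    qed
  qed
  then have k2: "\<kappa> \<noteq> 0" by (auto simp: nn_integral_cmult)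
  have kr: "(\<integral>\<^sup>+t. ennreal (r * h (r * t)) \<partial>lborel) = \<kappa>" if "0 < r" for r
    using nn_integral_real_affine[of "\<lambda>t. ennreal (h t)" r 0] that unfolding \<kappa>_def
    by (simp add: ennreal_mult h0 nn_integral_cmult)
  \<comment> \<open>The common value: it no longer mentions q, so the integral for the given q and
    the one for the constant 1 both equal Q after multiplication by \<kappa>.\<close>
  define Q where "Q = (\<integral>\<^sup>+x. ennreal (norm x * h (norm x)) *
    (\<integral>\<^sup>+s. ennreal (indicator {0<..} s * inverse s ^ Suc n) * F (inverse s *\<^sub>R x) \<partial>lborel) \<partial>lborel)"
  have main: "(\<integral>\<^sup>+w. F (q w *\<^sub>R w) * ennreal (q w ^ n) \<partial>lborel) * \<kappa> = Q"
    if [measurable]: "q \<in> borel_measurable borel" and q0: "\<And>w. 0 < q w" and hom: "\<And>t w. 0 < t \<Longrightarrow> q (t *\<^sub>R w) = q w"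
    for q :: "'a \<Rightarrow> real"
  proof -
    let ?f = "\<lambda>w t. F (q w *\<^sub>R w) * ennreal (q w ^ n) * ennreal (norm w * h (norm w * t))"
    have "(\<integral>\<^sup>+w. F (q w *\<^sub>R w) * ennreal (q w ^ n) \<partial>lborel) * \<kappa> =
       (\<integral>\<^sup>+w. F (q w *\<^sub>R w) * ennreal (q w ^ n) * \<kappa> \<partial>lborel)"
      by (subst nn_integral_multc) auto
    also have "\<dots> = (\<integral>\<^sup>+w. F (q w *\<^sub>R w) * ennreal (q w ^ n) * (\<integral>\<^sup>+t. ennreal (norm w * h (norm w * t)) \<partial>lborel) \<partial>lborel)"
      using AE_lborel_singleton[of 0] by (intro nn_integral_cong_AE) (auto simp: kr elim!: eventually_mono)
    also have "\<dots> = (\<integral>\<^sup>+w. \<integral>\<^sup>+t. ?f w t \<partial>lborel \<partial>lborel)"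
      by (intro nn_integral_cong, subst nn_integral_cmult) auto
    also have "\<dots> = (\<integral>\<^sup>+t. \<integral>\<^sup>+w. ?f w t \<partial>lborel \<partial>lborel)"
      by (rule lborel_pair.Fubini'[symmetric]) (simp add: case_prod_unfold)
    also have "\<dots> = (\<integral>\<^sup>+t. \<integral>\<^sup>+x. ennreal (norm x * h (norm x)) *
        (ennreal (indicator {0<..} t * inverse t ^ Suc n * q x ^ n) * F ((q x / t) *\<^sub>R x)) \<partial>lborel \<partial>lborel)"
    proof (rule nn_integral_cong)
      fix t :: real
      show "(\<integral>\<^sup>+w. ?f w t \<partial>lborel) = (\<integral>\<^sup>+x. ennreal (norm x * h (norm x)) *
        (ennreal (indicator {0<..} t * inverse t ^ Suc n * q x ^ n) * F ((q x / t) *\<^sub>R x)) \<partial>lborel)"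
      proof (cases "0 < t")
        case False
        then have "h (norm w * t) = 0" for w :: 'a by (intro hneg) (simp add: mult_nonneg_nonpos)
        then show ?thesis using False by simp
      next
        case True
        \<comment> \<open>The dilation w = x / t removes t from the weight h and moves it into the
          argument of F.\<close>
        have "(\<integral>\<^sup>+w. ?f w t \<partial>lborel) = ennreal (\<bar>inverse t\<bar> ^ n) * (\<integral>\<^sup>+w. ?f (0 + inverse t *\<^sub>R w) t \<partial>lborel)"
          unfolding n_def by (rule nn_integral_affine) (use True in auto)
        also have "\<dots> = (\<integral>\<^sup>+w. ennreal (\<bar>inverse t\<bar> ^ n) * ?f (inverse t *\<^sub>R w) t \<partial>lborel)"
          by (subst nn_integral_cmult) auto
        also have "\<dots> = (\<integral>\<^sup>+x. ennreal (norm x * h (norm x)) *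
           (ennreal (indicator {0<..} t * inverse t ^ Suc n * q x ^ n) * F ((q x / t) *\<^sub>R x)) \<partial>lborel)"
        proof (rule nn_integral_cong)
          fix x :: 'a
          let ?A = "ennreal (\<bar>inverse t\<bar> ^ n)" and ?B = "ennreal (q x ^ n)" and ?C = "ennreal (norm (inverse t *\<^sub>R x) * h (norm x))"
            and ?E = "ennreal (norm x * h (norm x))" and ?G = "ennreal (indicator {0<..} t * inverse t ^ Suc n * q x ^ n)"
            and ?F = "F ((q x / t) *\<^sub>R x)"
          have e1: "q (inverse t *\<^sub>R x) = q x" using hom True by simp
          have e2: "norm (inverse t *\<^sub>R x) * t = norm x" using True by simp
          have e3: "q x *\<^sub>R inverse t *\<^sub>R x = (q x / t) *\<^sub>R x" by (simp add: divide_inverse)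
          have "\<bar>inverse t\<bar> ^ n * (q x ^ n * (norm (inverse t *\<^sub>R x) * h (norm x))) =
             norm x * h (norm x) * (indicator {0<..} t * inverse t ^ Suc n * q x ^ n)"
            using True by simp
          then have key: "?A * (?B * ?C) = ?E * ?G"
            using True q0[of x] h0[of "norm x"] by (simp add: ennreal_mult[symmetric])
          have "?A * ?f (inverse t *\<^sub>R x) t = ?A * (?F * ?B * ?C)" unfolding e1 e2 e3 ..
          also have "\<dots> = ?A * (?B * ?C) * ?F" by (simp only: mult_ac)
          also have "\<dots> = ?E * (?G * ?F)" by (simp only: key mult.assoc)
          finally show "?A * ?f (inverse t *\<^sub>R x) t = ?E * (?G * ?F)" .
        qed
        finally show ?thesis .
      qed
    qed
    also have "\<dots> = (\<integral>\<^sup>+x. \<integral>\<^sup>+t. ennreal (norm x * h (norm x)) *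
        (ennreal (indicator {0<..} t * inverse t ^ Suc n * q x ^ n) * F ((q x / t) *\<^sub>R x)) \<partial>lborel \<partial>lborel)"
      by (rule lborel_pair.Fubini') (simp add: case_prod_unfold)
    also have "\<dots> = Q" unfolding Q_def
    proof (rule nn_integral_cong)
      fix x :: 'a
      have "(\<integral>\<^sup>+t. ennreal (norm x * h (norm x)) *
        (ennreal (indicator {0<..} t * inverse t ^ Suc n * q x ^ n) * F ((q x / t) *\<^sub>R x)) \<partial>lborel) = 
        ennreal (norm x * h (norm x)) *
        (\<integral>\<^sup>+t. ennreal (indicator {0<..} t * inverse t ^ Suc n * q x ^ n) * F ((q x / t) *\<^sub>R x) \<partial>lborel)"
        by (subst nn_integral_cmult) auto
      also have "(\<integral>\<^sup>+t. ennreal (indicator {0<..} t * inverse t ^ Suc n * q x ^ n) * F ((q x / t) *\<^sub>R x) \<partial>lborel) =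
        ennreal \<bar>q x\<bar> * (\<integral>\<^sup>+s. ennreal (indicator {0<..} (0 + q x * s) * inverse (0 + q x * s) ^ Suc n * q x ^ n) * F ((q x / (0 + q x * s)) *\<^sub>R x) \<partial>lborel)"
        by (rule nn_integral_real_affine) (use q0[of x] in auto)
      also have "\<dots> = (\<integral>\<^sup>+s. ennreal \<bar>q x\<bar> * (ennreal (indicator {0<..} (0 + q x * s) * inverse (0 + q x * s) ^ Suc n * q x ^ n) * F ((q x / (0 + q x * s)) *\<^sub>R x)) \<partial>lborel)"
        by (subst nn_integral_cmult) auto
      also have "\<dots> = (\<integral>\<^sup>+s. ennreal (indicator {0<..} s * inverse s ^ Suc n) * F (inverse s *\<^sub>R x) \<partial>lborel)"
      proof (rule nn_integral_cong)
        fix s :: real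
        have "\<bar>q x\<bar> * (indicator {0<..} (0 + q x * s) * inverse (0 + q x * s) ^ Suc n * q x ^ n) = indicator {0<..} s * inverse s ^ Suc n"
          using q0[of x] by (auto simp: indicator_def zero_less_mult_iff power_mult_distrib field_simps)
        moreover have "q x / (0 + q x * s) = inverse s" using q0[of x] by (simp add: divide_simps)
        ultimately show "ennreal \<bar>q x\<bar> * (ennreal (indicator {0<..} (0 + q x * s) * inverse (0 + q x * s) ^ Suc n * q x ^ n) * F ((q x / (0 + q x * s)) *\<^sub>R x)) =
           ennreal (indicator {0<..} s * inverse s ^ Suc n) * F (inverse s *\<^sub>R x)"
          by (metis (no_types, lifting) ennreal_mult' abs_ge_zero mult.assoc)
      qed
      finally show "(\<integral>\<^sup>+t. ennreal (norm x * h (norm x)) *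
        (ennreal (indicator {0<..} t * inverse t ^ Suc n * q x ^ n) * F ((q x / t) *\<^sub>R x)) \<partial>lborel) = 
        ennreal (norm x * h (norm x)) * (\<integral>\<^sup>+s. ennreal (indicator {0<..} s * inverse s ^ Suc n) * F (inverse s *\<^sub>R x) \<partial>lborel)" .
    qed
    finally show ?thesis .
  qed
  have "(\<integral>\<^sup>+w. F (q w *\<^sub>R w) * ennreal (q w ^ n) \<partial>lborel) * \<kappa> = (\<integral>\<^sup>+w. F w \<partial>lborel) * \<kappa>"
    using main[of q] main[of "\<lambda>_. 1"] q0 hom by simp
  then show ?thesis unfolding n_def[symmetric] using k1 k2
    by (simp add: mult.commute[of _ \<kappa>] ennreal_mult_cancel_left)
qed

text \<open>The measure with density q^n, pushed forward along the scaling followed by R, is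
  Lebesgue measure itself. Stating this for measures transfers the formula to real F without any
  integrability assumption.\<close>

lemma integral_radial_scaling:
  fixes F :: "'a::euclidean_space \<Rightarrow> real" and q :: "'a \<Rightarrow> real" and R :: "'a \<Rightarrow> 'a"
  assumes F[measurable]: "F \<in> borel_measurable borel" and q[measurable]: "q \<in> borel_measurable borel"
    and q0: "\<And>w. 0 < q w" and hom: "\<And>t w. 0 < t \<Longrightarrow> q (t *\<^sub>R w) = q w"
    and R: "linear R" "surj R" "\<And>x. norm (R x) = norm x"
  shows "(\<integral>w. F (R (q w *\<^sub>R w)) * q w ^ DIM('a) \<partial>lborel) = (\<integral>w. F w \<partial>lborel)"
proof -
  have Rm[measurable]: "R \<in> borel_measurable borel"
    using R(1) by (intro borel_measurable_continuous_onI linear_continuous_on) (simp add: linear_conv_bounded_linear)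
  have "distr (density lborel (\<lambda>w. ennreal (q w ^ DIM('a)))) borel (\<lambda>w. R (q w *\<^sub>R w)) = (lborel :: 'a measure)"
  proof (rule measure_eqI)
    fix A assume "A \<in> sets (distr (density lborel (\<lambda>w. ennreal (q w ^ DIM('a)))) borel (\<lambda>w. R (q w *\<^sub>R w)))"
    then have A[measurable]: "A \<in> sets borel" by simp
    have "emeasure (distr (density lborel (\<lambda>w. ennreal (q w ^ DIM('a)))) borel (\<lambda>w. R (q w *\<^sub>R w))) A =
      (\<integral>\<^sup>+x. indicator A x \<partial>distr (density lborel (\<lambda>w. ennreal (q w ^ DIM('a)))) borel (\<lambda>w. R (q w *\<^sub>R w)))"
      by simp
    also have "\<dots> = (\<integral>\<^sup>+w. ennreal (q w ^ DIM('a)) * indicator A (R (q w *\<^sub>R w)) \<partial>lborel)"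
      by (simp add: nn_integral_distr nn_integral_density del: nn_integral_indicator)
    also have "\<dots> = (\<integral>\<^sup>+w. indicator A (R w) \<partial>lborel)"
      using nn_integral_radial_scaling[of "\<lambda>w. indicator A (R w)" q] q0 hom by (simp add: mult.commute)
    also have "\<dots> = emeasure lborel A"
      using nn_integral_isometry[of "indicator A" R] R by simp
    finally show "emeasure (distr (density lborel (\<lambda>w. ennreal (q w ^ DIM('a)))) borel (\<lambda>w. R (q w *\<^sub>R w))) A = emeasure lborel A" .
  qed simp
  then have "(\<integral>w. F w \<partial>lborel) = (\<integral>w. F w \<partial>distr (density lborel (\<lambda>w. ennreal (q w ^ DIM('a)))) borel (\<lambda>w. R (q w *\<^sub>R w)))"
    by simp
  also have "\<dots> = (\<integral>w. q w ^ DIM('a) *\<^sub>R F (R (q w *\<^sub>R w)) \<partial>lborel)"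
    using q0 by (simp add: integral_distr integral_density less_imp_le)
  finally show ?thesis by (simp add: mult.commute)
qed

text \<open>Dyadic shells: where |x| lies between 2 powr (-j - 1) and 2 powr (-j) and b < n, the
  integrand is at most \<open>?c j\<close>, and the shell sits in a ball of volume proportional to 2
  powr ((1 - j) n). The products form a geometric series of ratio 2 powr (-b). For b \<ge> n the
  integrand is bounded.\<close>

lemma integrable_norm_powr:
  fixes D b :: real
  assumes b: "0 < b"
  shows "integrable lborel (\<lambda>x::'a::euclidean_space. indicator (ball 0 D) x * norm x powr (b - DIM('a)))"
proof -
  define n where "n = real DIM('a)"
  define V where "V = unit_ball_vol (DIM('a))"
  have V0: "0 \<le> V" unfolding V_def by simp
  let ?f = "\<lambda>x::'a. indicator (ball 0 D) x * norm x powr (b - n)"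
  have [measurable]: "?f \<in> borel_measurable borel"
    by (intro borel_measurable_times borel_measurable_indicator powr_real_measurable borel_measurable_norm) auto
  let ?C = "max 1 (D powr (b - n))"
  let ?c = "\<lambda>j::nat. 2 powr ((real j + 1) * \<bar>n - b\<bar>)"
  let ?B = "\<lambda>j::nat. ball (0::'a) (2 powr (1 - real j))"
  have [measurable]: "indicator (ball (0::'a) r) \<in> borel_measurable borel" for r :: real
    by (intro borel_measurable_indicator) auto
  have pt: "ennreal (?f x) \<le> ennreal ?C * indicator (ball 0 D) x + (\<Sum>j. ennreal (?c j) * indicator (?B j) x)" for x
  proof (cases "x = 0 \<or> x \<notin> ball 0 D")
    case True then show ?thesis by auto
  next
    case x: False
    show ?thesis
    proof (cases "b \<ge> n \<or> norm x \<ge> 1")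
      case True
      have "norm x powr (b - n) \<le> ?C"
      proof (cases "b \<ge> n")
        case True then have "norm x powr (b - n) \<le> D powr (b - n)" using x by (intro powr_mono2) auto
        then show ?thesis by simp
      next
        case False
        then have "norm x powr (b - n) \<le> norm x powr 0" using True by (intro powr_mono) auto
        then show ?thesis using x by simp
      qed
      then have "ennreal (?f x) \<le> ennreal ?C * indicator (ball 0 D) x" using x by (simp add: ennreal_leI)
      then show ?thesis by (meson add_increasing2 order_trans zero_le add_mono order_refl le_iff_add)
    next
      case False
      define L where "L = - log 2 (norm x)"
      have L: "norm x = 2 powr (- L)" "0 < L" using x False unfolding L_def by auto
      define j where "j = nat \<lfloor>L\<rfloor>"
      have j: "real j \<le> L" "L \<le> real j + 1" using L(2) unfolding j_def by linarith+
      have "norm x powr (b - n) = 2 powr (L * (n - b))" unfolding L(1) by (simp add: powr_powr algebra_simps)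
      also have "\<dots> \<le> ?c j" using False j by (intro powr_mono mult_mono) auto
      finally have 1: "?f x \<le> ?c j" using x by simp
      have "norm x < 2 powr (1 - real j)" unfolding L(1) using j by (intro powr_less_mono) auto
      then have "ennreal (?f x) \<le> ennreal (?c j) * indicator (?B j) x" using 1 by (simp add: ennreal_leI)
      also have "\<dots> \<le> (\<Sum>j. ennreal (?c j) * indicator (?B j) x)"
      proof -
        define u where "u = (\<lambda>j. ennreal (?c j) * indicator (?B j) x)"
        have "sum u {j} \<le> suminf u" by (rule sum_le_suminf) auto
        then have "u j \<le> suminf u" by simp
        then show ?thesis unfolding u_def .
      qed
      finally show ?thesis by (meson add_increasing zero_le)
    qed
  qed
  have eB: "emeasure lborel (?B j) = ennreal (V * (2 powr (1 - real j)) ^ DIM('a))" for j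
    unfolding V_def by (rule emeasure_ball) auto
  have "(\<integral>\<^sup>+x. ennreal (?f x) \<partial>lborel) < top"
  proof (cases "b \<ge> n")
    case True
    have "norm x powr (b - n) \<le> ?C" if "x \<in> ball 0 D" for x :: 'a
    proof -
      have "norm x powr (b - n) \<le> D powr (b - n)" using that True by (intro powr_mono2) auto
      then show ?thesis by simp
    qed
    then have "(\<integral>\<^sup>+x. ennreal (?f x) \<partial>lborel) \<le> (\<integral>\<^sup>+x. ennreal ?C * indicator (ball 0 D) (x::'a) \<partial>lborel)"
      by (intro nn_integral_mono) (auto simp: indicator_def ennreal_leI)
    also have "\<dots> = ennreal ?C * emeasure lborel (ball (0::'a) D)" by (simp add: nn_integral_cmult)
    also have "\<dots> < top" using emeasure_bounded_finite[of "ball (0::'a) D"] by (simp add: ennreal_mult_less_top)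
    finally show ?thesis .
  next
    case False
    have "(\<integral>\<^sup>+x. ennreal (?f x) \<partial>lborel) \<le> (\<integral>\<^sup>+x. ennreal ?C * indicator (ball 0 D) x + (\<Sum>j. ennreal (?c j) * indicator (?B j) x) \<partial>lborel)"
      by (intro nn_integral_mono pt)
    also have "\<dots> = ennreal ?C * emeasure lborel (ball (0::'a) D) + (\<Sum>j. ennreal (?c j) * emeasure lborel (?B j))"
      by (simp add: nn_integral_add nn_integral_cmult nn_integral_suminf)
    also have "(\<lambda>j. ennreal (?c j) * emeasure lborel (?B j)) = (\<lambda>j. ennreal (V * 2 powr (n + (n - b)) * (2 powr (- b)) ^ j))"
    proof
      fix j :: nat
      have "?c j * (V * (2 powr (1 - real j)) ^ DIM('a)) = V * (2 powr ((real j + 1) * (n - b)) * 2 powr ((1 - real j) * n))"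
        using False by (simp add: n_def powr_powr powr_realpow[symmetric] mult_ac)
      also have "\<dots> = V * 2 powr (n + (n - b)) * (2 powr (- b)) ^ j"
        by (simp add: powr_add[symmetric] powr_powr powr_realpow[symmetric] algebra_simps)
      finally show "ennreal (?c j) * emeasure lborel (?B j) = ennreal (V * 2 powr (n + (n - b)) * (2 powr (- b)) ^ j)"
        unfolding eB using V0 by (simp add: ennreal_mult[symmetric])
    qed
    also have "ennreal ?C * emeasure lborel (ball (0::'a) D) + (\<Sum>j. ennreal (V * 2 powr (n + (n - b)) * (2 powr (- b)) ^ j)) < top"
    proof -
      have "(2::real) powr (- b) < 2 powr 0" using b by (intro powr_less_mono) auto
      then have "summable (\<lambda>j. V * 2 powr (n + (n - b)) * (2 powr (- b)) ^ j)"
        by (intro summable_mult summable_geometric) auto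
      then have "(\<Sum>j. ennreal (V * 2 powr (n + (n - b)) * (2 powr (- b)) ^ j)) \<noteq> top"
        using V0 by (intro ennreal_suminf_neq_top) auto
      then show ?thesis using emeasure_bounded_finite[of "ball (0::'a) D"]
        by (simp add: ennreal_mult_less_top top.not_eq_extremum)
    qed
    finally show ?thesis .
  qed
  then have "integrable lborel ?f" by (intro integrableI_nonneg) auto
  then show ?thesis unfolding n_def .
qed

section \<open>Partial derivatives and homogeneous extensions\<close>

text \<open>\<open>partials\<close> puts the outermost derivative at the head of the list, while
  \<open>holder_bd\<close> differentiates f itself first; removing indices from the end of the list
  reconciles the two.\<close>

lemma partials_append: "partials (js @ [i]) f = partials js (partials [i] f)"
  by (induction js) auto

lemma differentiable_lin_form:
  assumes "f differentiable (at x)"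
  shows "(f has_derivative lin_form (\<lambda>i. partials [i] f) x) (at (x :: real ^ 'n::finite))"
proof -
  let ?D = "frechet_derivative f (at x)"
  have D: "(f has_derivative ?D) (at x)" using assms frechet_derivative_works by blast
  have "?D h = lin_form (\<lambda>i. partials [i] f) x h" for h
  proof -
    have "?D h = ?D (\<Sum>i\<in>UNIV. h $ i *\<^sub>R axis i 1)"
      using basis_expansion[of h] by (simp add: scalar_mult_eq_scaleR)
    also have "\<dots> = (\<Sum>i\<in>UNIV. h $ i * ?D (axis i 1))"
      using has_derivative_linear[OF D] by (simp add: linear_sum linear_cmul)
    finally show ?thesis by (simp add: mult.commute)
  qed
  then have "?D = lin_form (\<lambda>i. partials [i] f) x" by blast
  then show ?thesis using D by simp
qed

lemma partial_eq:
  assumes "(f has_derivative lin_form f' x) (at x)"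
  shows "partials [i] f x = f' i x"
proof -
  have "partials [i] f x = frechet_derivative f (at x) (axis i 1)" by (simp only: partials.simps)
  also have "\<dots> = lin_form f' x (axis i 1)" by (rule fun_cong[OF frechet_derivative_at[OF assms, symmetric]])
  finally show ?thesis unfolding lin_form_axis .
qed

lemma bd_partial:
  assumes "open U" "holder_bd (Suc k) \<alpha> U M f"
  shows "holder_bd k \<alpha> U M (partials [i] f)" and "x \<in> U \<Longrightarrow> f differentiable (at x)"
proof -
  obtain f' where f': "\<forall>x\<in>U. (f has_derivative lin_form f' x) (at x)"
    "\<forall>m. holder_bd k \<alpha> U M (f' m)" using assms(2) unfolding holder_bd.simps by (elim conjE exE)
  have "f' i x = partials [i] f x" if "x \<in> U" for x using partial_eq[of f f' x i, OF bspec[OF f'(1) that]] by (rule sym)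
  then show "holder_bd k \<alpha> U M (partials [i] f)" using bd_cong[OF assms(1) _ spec[OF f'(2)]] by blast
  show "x \<in> U \<Longrightarrow> f differentiable (at x)" using f'(1) unfolding differentiable_def by blast
qed

lemma bd_partials:
  assumes "open U"
  shows "holder_bd k \<alpha> U M f \<Longrightarrow> length js \<le> k \<Longrightarrow> holder_bd (k - length js) \<alpha> U M (partials js f)"
proof (induction js arbitrary: k f rule: rev_induct)
  case Nil then show ?case by simp
next
  case (snoc i js)
  then obtain k' where k: "k = Suc k'" by (cases k) auto
  have "holder_bd k' \<alpha> U M (partials [i] f)" using bd_partial(1)[OF assms] snoc.prems(1) k by blast
  then show ?case using snoc.IH[of k' "partials [i] f"] snoc.prems(2) k unfolding partials_append by simp
qed

lemma bd_from_partials: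
  fixes F :: "real ^ 'n::finite \<Rightarrow> real"
  shows "(\<And>js. length js \<le> k \<Longrightarrow> hold0 \<alpha> V M (partials js F)) \<Longrightarrow>
    (\<And>js x. length js < k \<Longrightarrow> x \<in> V \<Longrightarrow> partials js F differentiable (at x)) \<Longrightarrow> holder_bd k \<alpha> V M F"
proof (induction k arbitrary: F)
  case 0 then show ?case using "0.prems"(1)[of "[]"] by simp
next
  case (Suc k)
  have "holder_bd k \<alpha> V M (partials [i] F)" for i
    using Suc.prems(1)[of "_ @ [i]"] Suc.prems(2)[of "_ @ [i]"] unfolding partials_append
    by (intro Suc.IH) auto
  moreover have "(F has_derivative lin_form (\<lambda>i. partials [i] F) x) (at x)" if "x \<in> V" for x
    using Suc.prems(2)[of "[]"] that by (intro differentiable_lin_form) auto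
  moreover have "hold0 \<alpha> V M F" using Suc.prems(1)[of "[]"] by simp
  ultimately show ?case by (intro bd_Suc_intro)
qed

text \<open>To read pointwise bounds off the norm, each real supremum must be a genuine upper bound,
  which is what boundedness and \<open>holder_on\<close> give, and every summand must be nonnegative
  so that it is at most the total. The two distinct points make the sets of the suprema
  nonempty.\<close>

lemma holder_norm_bounds:
  fixes F :: "real ^ 'n::finite \<Rightarrow> real"
  assumes bdd0: "\<forall>js. length js \<le> k \<longrightarrow> bdd_above ((\<lambda>x. \<bar>partials js F x\<bar>) ` S)"
    and hol0: "\<forall>js. 0 < \<alpha> \<longrightarrow> length js = k \<longrightarrow> holder_on \<alpha> S (partials js F)"
    and ne: "p \<in> S" "p' \<in> S" "p \<noteq> p'" and N: "holder_norm k \<alpha> S F \<le> M" and a0: "0 \<le> \<alpha>"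
  shows "length js \<le> k \<Longrightarrow> x \<in> S \<Longrightarrow> \<bar>partials js F x\<bar> \<le> M"
    and "0 < \<alpha> \<Longrightarrow> length js = k \<Longrightarrow> x \<in> S \<Longrightarrow> y \<in> S \<Longrightarrow> \<bar>partials js F x - partials js F y\<bar> \<le> M * dist x y powr \<alpha>"
proof -
  note bdd = bdd0[rule_format] and hol = hol0[rule_format]
  define b where "b js = (SUP x\<in>S. \<bar>partials js F x\<bar>)" for js
  define B where "B j = (SUP js\<in>{js. length js = j}. b js)" for j
  define s where "s js = holder_seminorm \<alpha> S (partials js F)" for js
  define T where "T = (if \<alpha> = 0 then 0 else SUP js\<in>{js. length js = k}. s js)"
  have fin: "finite {js :: 'n list. length js = j}" for j using finite_lists_length_eq[of "UNIV :: 'n set" j] by simp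
  have bx: "\<bar>partials js F x\<bar> \<le> b js" if "length js \<le> k" "x \<in> S" for js x
    unfolding b_def by (rule cSUP_upper[OF that(2) bdd[OF that(1)]])
  have b0: "0 \<le> b js" if "length js \<le> k" for js using bx[OF that ne(1)] by linarith
  have bB: "b js \<le> B (length js)" for js unfolding B_def
    by (rule cSUP_upper[OF _ bdd_above_finite[OF finite_imageI[OF fin]]]) simp
  \<comment> \<open>\<open>replicate j undefined\<close> is merely some list of length j.\<close>
  have B0: "0 \<le> B j" if "j \<le> k" for j
    using b0[of "replicate j undefined"] bB[of "replicate j undefined"] that by simp
  have s: "\<bar>partials js F x - partials js F y\<bar> / dist x y powr \<alpha> \<le> s js"
    if "0 < \<alpha>" "length js = k" "x \<in> S" "y \<in> S" "x \<noteq> y" for js x y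
  proof -
    from hol[OF that(1,2)] obtain C where C: "\<forall>x\<in>S. \<forall>y\<in>S. \<bar>partials js F x - partials js F y\<bar> \<le> C * dist x y powr \<alpha>"
      unfolding holder_on_def by blast
    have "bdd_above ((\<lambda>(x, y). \<bar>partials js F x - partials js F y\<bar> / dist x y powr \<alpha>) ` {(x, y). x \<in> S \<and> y \<in> S \<and> x \<noteq> y})"
      using C by (intro bdd_aboveI2[of _ _ C]) (auto simp: divide_le_eq)
    then have "(\<lambda>(x, y). \<bar>partials js F x - partials js F y\<bar> / dist x y powr \<alpha>) (x, y) \<le> s js"
      unfolding s_def holder_seminorm_def using that by (intro cSUP_upper) auto
    then show ?thesis by simp
  qed
  have s0: "0 \<le> s js" if "0 < \<alpha>" "length js = k" for js
    using s[OF that ne] by (smt (verit) divide_nonneg_nonneg powr_ge_zero)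
  have sT: "s js \<le> T" if "0 < \<alpha>" "length js = k" for js
    unfolding T_def using that cSUP_upper[OF _ bdd_above_finite[OF finite_imageI[OF fin]], of js k s] by simp
  have T0: "0 \<le> T"
  proof (cases "\<alpha> = 0")
    case False
    then have "0 < \<alpha>" using a0 by simp
    then show ?thesis using s0[of "replicate k undefined"] sT[of "replicate k undefined"] by simp
  qed (simp add: T_def)
  have tot: "(\<Sum>j\<le>k. B j) + T \<le> M" using N unfolding holder_norm_def T_def B_def b_def s_def .
  show "length js \<le> k \<Longrightarrow> x \<in> S \<Longrightarrow> \<bar>partials js F x\<bar> \<le> M"
  proof -
    assume a: "length js \<le> k" "x \<in> S"
    have "B (length js) \<le> (\<Sum>j\<le>k. B j)" using B0 a(1) by (intro member_le_sum) auto
    then show ?thesis using bx[OF a] bB[of js] T0 tot by linarith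
  qed
  show "0 < \<alpha> \<Longrightarrow> length js = k \<Longrightarrow> x \<in> S \<Longrightarrow> y \<in> S \<Longrightarrow> \<bar>partials js F x - partials js F y\<bar> \<le> M * dist x y powr \<alpha>"
  proof -
    assume a: "0 < \<alpha>" "length js = k" "x \<in> S" "y \<in> S"
    show ?thesis
    proof (cases "x = y")
      case False
      have "0 \<le> (\<Sum>j\<le>k. B j)" using B0 by (intro sum_nonneg) auto
      then have "\<bar>partials js F x - partials js F y\<bar> / dist x y powr \<alpha> \<le> M"
        using s[OF a False] sT[OF a(1,2)] tot by linarith
      then show ?thesis using False by (simp add: divide_le_eq)
    qed simp
  qed
qed

text \<open>Off the origin P equals a times P after the dilation by 1/c; differentiating this gives
  the factor a/c. A single dilation with a free factor a serves both the extensions of degree 0,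
  with their derivatives, and the kernels of real degree s.\<close>

lemma homogeneous_derivative:
  fixes P :: "real ^ 'n::finite \<Rightarrow> real"
  assumes hom: "\<forall>y. y \<noteq> 0 \<longrightarrow> P (c *\<^sub>R y) = a * P y"
    and d: "P differentiable (at x)" and x: "x \<noteq> 0" "0 < c"
  shows "P differentiable (at (c *\<^sub>R x))" and "partials [i] P (c *\<^sub>R x) = a / c * partials [i] P x"
proof -
  let ?D = "lin_form (\<lambda>i. partials [i] P) x"
  have D: "(P has_derivative ?D) (at x)" by (rule differentiable_lin_form[OF d])
  have D': "(P has_derivative ?D) (at (inverse c *\<^sub>R (c *\<^sub>R x)))" using D x by simp
  have 0: "((\<lambda>y. inverse c *\<^sub>R y) has_derivative (\<lambda>h. inverse c *\<^sub>R h)) (at (c *\<^sub>R x))"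
    by (auto intro!: derivative_eq_intros)
  have "((\<lambda>y. P (inverse c *\<^sub>R y)) has_derivative (\<lambda>h. ?D (inverse c *\<^sub>R h))) (at (c *\<^sub>R x))"
    by (rule has_derivative_compose[OF 0 D'])
  then have "((\<lambda>y. a * P (inverse c *\<^sub>R y)) has_derivative (\<lambda>h. a * ?D (inverse c *\<^sub>R h))) (at (c *\<^sub>R x))"
    by (rule has_derivative_mult_right)
  then have "(P has_derivative (\<lambda>h. a * ?D (inverse c *\<^sub>R h))) (at (c *\<^sub>R x))"
  proof (rule has_derivative_transform_within_open[where s = "-{0}"])
    fix y :: "real ^ 'n" assume "y \<in> - {0}"
    then have "P (c *\<^sub>R (inverse c *\<^sub>R y)) = a * P (inverse c *\<^sub>R y)" using x by (intro hom[rule_format]) auto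
    then show "a * P (inverse c *\<^sub>R y) = P y" using x by simp
  qed (use x in auto)
  moreover have "(\<lambda>h. a * ?D (inverse c *\<^sub>R h)) = lin_form (\<lambda>i z. a / c * partials [i] P x) (c *\<^sub>R x)"
    by (rule ext) (simp add: sum_distrib_left divide_inverse mult_ac del: partials.simps)
  ultimately have "(P has_derivative lin_form (\<lambda>i z. a / c * partials [i] P x) (c *\<^sub>R x)) (at (c *\<^sub>R x))" by simp
  then show "P differentiable (at (c *\<^sub>R x))" "partials [i] P (c *\<^sub>R x) = a / c * partials [i] P x"
    using partial_eq[of P "\<lambda>i z. a / c * partials [i] P x" "c *\<^sub>R x"] unfolding differentiable_def by blast+
qed

lemma hom_ext_scale: "0 < t \<Longrightarrow> hom_ext f (t *\<^sub>R y) = hom_ext f y"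
proof -
  assume "0 < t"
  then have "inverse (norm (t *\<^sub>R y)) * t = inverse (norm y)" by (simp add: field_simps)
  then have "inverse (norm (t *\<^sub>R y)) *\<^sub>R t *\<^sub>R y = inverse (norm y) *\<^sub>R y" by (simp only: scaleR_scaleR)
  then show ?thesis unfolding hom_ext_def by (rule arg_cong)
qed

text \<open>Antipodal points are two distinct points of the sphere in every dimension, dimension one
  included.\<close>

lemma axis_neq_uminus: "axis i 1 \<noteq> (- axis i 1 :: real ^ 'n::finite)"
proof
  assume "axis i 1 = (- axis i 1 :: real ^ 'n)"
  then have "(axis i 1 :: real ^ 'n) $ i = (- axis i 1) $ i" by (rule arg_cong)
  then show False by (simp add: axis_def)
qed

text \<open>A derivative of order j is homogeneous of degree -j. The two conclusions feed each
  other: homogeneity at order j spreads differentiability from the sphere to all nonzero points, and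
  differentiability gives homogeneity at order j + 1.\<close>

lemma partials_hom_ext_scale:
  fixes f :: "real ^ 'n::finite \<Rightarrow> real"
  assumes d0: "\<forall>js x. length js < k \<longrightarrow> norm x = 1 \<longrightarrow> partials js (hom_ext f) differentiable (at x)"
  shows "length js \<le> k \<Longrightarrow> x \<noteq> 0 \<Longrightarrow> 0 < t \<Longrightarrow> partials js (hom_ext f) (t *\<^sub>R x) = partials js (hom_ext f) x / t ^ length js"
    and "length js < k \<Longrightarrow> x \<noteq> 0 \<Longrightarrow> partials js (hom_ext f) differentiable (at x)"
proof -
  note d = d0[rule_format]
  have dd: "partials js (hom_ext f) differentiable (at x)"
    if h: "\<forall>x t. x \<noteq> 0 \<longrightarrow> 0 < t \<longrightarrow> partials js (hom_ext f) (t *\<^sub>R x) = partials js (hom_ext f) x / t ^ length js"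
      and j: "length js < k" and x: "x \<noteq> 0" for js x
  proof -
    have n: "norm (x /\<^sub>R norm x) = 1" using x by simp
    have "partials js (hom_ext f) differentiable (at (norm x *\<^sub>R (x /\<^sub>R norm x)))"
    proof (rule homogeneous_derivative(1)[where a = "1 / norm x ^ length js", OF _ d[OF j n]])
      show "\<forall>y. y \<noteq> 0 \<longrightarrow> partials js (hom_ext f) (norm x *\<^sub>R y) = 1 / norm x ^ length js * partials js (hom_ext f) y"
        using h x by simp
    qed (use x in auto)
    then show ?thesis using x by simp
  qed
  have h: "length js \<le> k \<Longrightarrow> x \<noteq> 0 \<Longrightarrow> 0 < t \<Longrightarrow> partials js (hom_ext f) (t *\<^sub>R x) = partials js (hom_ext f) x / t ^ length js"
    for js x t
  proof (induction js arbitrary: x t)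
    case Nil then show ?case by (simp add: hom_ext_scale)
  next
    case (Cons i js)
    have IH: "\<forall>x t. x \<noteq> 0 \<longrightarrow> 0 < t \<longrightarrow> partials js (hom_ext f) (t *\<^sub>R x) = partials js (hom_ext f) x / t ^ length js"
      using Cons.IH Cons.prems(1) by simp
    have "partials js (hom_ext f) differentiable (at x)" using dd[OF IH _ Cons.prems(2)] Cons.prems(1) by simp
    have "\<forall>y. y \<noteq> 0 \<longrightarrow> partials js (hom_ext f) (t *\<^sub>R y) = 1 / t ^ length js * partials js (hom_ext f) y"
      using IH Cons.prems(3) by simp
    from homogeneous_derivative(2)[OF this \<open>partials js (hom_ext f) differentiable (at x)\<close> Cons.prems(2,3), of i]
    show ?case by (simp add: mult.commute)
  qed
  then show "length js \<le> k \<Longrightarrow> x \<noteq> 0 \<Longrightarrow> 0 < t \<Longrightarrow> partials js (hom_ext f) (t *\<^sub>R x) = partials js (hom_ext f) x / t ^ length js" .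
  show "length js < k \<Longrightarrow> x \<noteq> 0 \<Longrightarrow> partials js (hom_ext f) differentiable (at x)"
  proof -
    assume a: "length js < k" "x \<noteq> 0"
    have "\<forall>x t. x \<noteq> 0 \<longrightarrow> 0 < t \<longrightarrow> partials js (hom_ext f) (t *\<^sub>R x) = partials js (hom_ext f) x / t ^ length js"
      using h a(1) by simp
    from dd[OF this a] show ?thesis .
  qed
qed

text \<open>Points closer than 1/2 share a ball. Farther apart, two values differ by at most 2 C,
  and dist powr \<alpha> is at least 1/2 because \<alpha> \<le> 1; hence the seminorm bound 4 C.
  With the k + 1 suprema of orders 0 to k this adds up to (k + 5) C.\<close>

lemma sphere_out:
  fixes g :: "real ^ 'n::finite \<Rightarrow> real"
  assumes bd: "\<And>e. norm e = 1 \<Longrightarrow> holder_bd k \<alpha> (ball e (1/2)) C (hom_ext g)"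
    and al: "0 \<le> \<alpha>" "\<alpha> \<le> 1" and C: "0 \<le> C"
  shows "g \<in> holder_space_sphere k \<alpha>" and "holder_norm_sphere k \<alpha> g \<le> (real k + 5) * C"
proof -
  let ?P = "\<lambda>js. partials js (hom_ext g)"
  have P: "holder_bd (k - length js) \<alpha> (ball e (1/2)) C (?P js)" if "norm e = 1" "length js \<le> k" for e js
    by (rule bd_partials[OF open_ball bd[OF that(1)] that(2)])
  have P0: "hold0 \<alpha> (ball e (1/2)) C (?P js)" if "norm e = 1" "length js \<le> k" for e js
    by (rule bd_hold0[OF P[OF that]])
  have d: "?P js differentiable (at x)" if "length js < k" "norm x = 1" for js x
  proof -
    have "k - length js = Suc (k - length js - 1)" using that by simp
    moreover have "holder_bd (k - length js) \<alpha> (ball x (1/2)) C (?P js)" using P[OF that(2)] that(1) by simp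
    ultimately have "holder_bd (Suc (k - length js - 1)) \<alpha> (ball x (1/2)) C (?P js)" by (simp only:)
    then show ?thesis by (rule bd_partial(2)[OF open_ball]) simp
  qed
  have dA: "\<forall>js x. length js < k \<longrightarrow> norm x = 1 \<longrightarrow> ?P js differentiable (at x)" using d by (intro allI impI)
  note sc = partials_hom_ext_scale[of k g, OF dA]
  have cont: "continuous_on (- {0}) (?P js)" if j: "length js \<le> k" for js
    unfolding continuous_on_eq_continuous_at[OF open_Compl[OF closed_singleton]]
  proof
    fix x :: "real ^ 'n" assume "x \<in> - {0}"
    then have x: "x \<noteq> 0" by simp
    let ?c = "norm x" let ?e = "x /\<^sub>R norm x"
    have e: "norm ?e = 1" using x by simp
    have "continuous_on (ball ?e (1/2)) (?P js)" using P0[OF e j] unfolding hold0_def by blast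
    then have "isCont (?P js) ?e" by (rule continuous_on_interior) simp
    then have "isCont (\<lambda>y. ?P js (y /\<^sub>R ?c) / ?c ^ length js) x"
      using x by (intro continuous_intros isCont_o2[of x "\<lambda>y. y /\<^sub>R ?c" "?P js"]) auto
    moreover have "\<forall>\<^sub>F y in nhds x. ?P js (y /\<^sub>R ?c) / ?c ^ length js = ?P js y"
    proof -
      have "\<forall>\<^sub>F y in nhds x. y \<in> - {0}" using x by (intro eventually_nhds_in_open) auto
      then show ?thesis
      proof (rule eventually_mono)
        fix y :: "real ^ 'n" assume "y \<in> - {0}"
        then have "?P js (?c *\<^sub>R (y /\<^sub>R ?c)) = ?P js (y /\<^sub>R ?c) / ?c ^ length js" using x j by (intro sc(1)) auto
        then show "?P js (y /\<^sub>R ?c) / ?c ^ length js = ?P js y" using x by simp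
      qed
    qed
    ultimately show "isCont (?P js) x" using isCont_cong by fastforce
  qed
  have b: "\<bar>?P js x\<bar> \<le> C" if "length js \<le> k" "norm x = 1" for js x
    using P0[OF that(2,1)] unfolding hold0_def by auto
  have h: "\<bar>?P js x - ?P js y\<bar> \<le> 4 * C * dist x y powr \<alpha>" if "length js \<le> k" "norm x = 1" "norm y = 1" for js x y
  proof (cases "dist x y < 1/2")
    case True
    then have "\<bar>?P js x - ?P js y\<bar> \<le> C * dist x y powr \<alpha>" using P0[OF that(2,1)] unfolding hold0_def by auto
    also have "\<dots> \<le> 4 * C * dist x y powr \<alpha>" using C by (intro mult_right_mono) auto
    finally show ?thesis .
  next
    case False
    have "1/2 = (1/2) powr (1::real)" by simp
    also have "\<dots> \<le> (1/2::real) powr \<alpha>" using al by (intro powr_mono') auto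
    also have "\<dots> \<le> dist x y powr \<alpha>" using False al by (intro powr_mono2) auto
    finally have "4 * C * (1/2) \<le> 4 * C * dist x y powr \<alpha>" using C by (intro mult_left_mono) auto
    then show ?thesis using b[OF that(1,2)] b[OF that(1,3)] by linarith
  qed
  show "g \<in> holder_space_sphere k \<alpha>"
  proof -
    have "holder_on \<alpha> (sphere 0 1) (?P js)" if "length js = k" for js
      unfolding holder_on_def using h[of js] that by (intro exI[of _ "4 * C"]) simp
    moreover have "?P js differentiable (at x)" if "length js < k" "x \<in> - {0}" for js x
      using sc(2) that by simp
    ultimately show ?thesis unfolding holder_space_sphere_def Ck_on_def using cont by simp
  qed
  obtain i :: 'n where True by simp
  let ?p = "axis i 1 :: real ^ 'n"
  have p: "norm ?p = 1" "norm (- ?p) = 1" by auto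
  have ne: "{js :: 'n list. length js = j} \<noteq> {}" for j using Ex_list_of_length[of j] by auto
  have 1: "(\<Sum>j\<le>k. SUP js\<in>{js. length js = j}. SUP x\<in>sphere 0 1. \<bar>?P js x\<bar>) \<le> (\<Sum>j\<le>k. C)"
  proof (intro sum_mono cSUP_least[OF ne] cSUP_least)
    show "sphere (0::real^'n) 1 \<noteq> {}" using p(1) by (metis empty_iff mem_sphere_0)
  qed (use b in auto)
  have 2: "(if \<alpha> = 0 then 0 else SUP js\<in>{js. length js = k}. holder_seminorm \<alpha> (sphere 0 1) (?P js)) \<le> 4 * C"
  proof (cases "\<alpha> = 0")
    case False
    have "(SUP js\<in>{js. length js = k}. holder_seminorm \<alpha> (sphere 0 1) (?P js)) \<le> 4 * C"
    proof (rule cSUP_least[OF ne])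
      fix js :: "'n list" assume "js \<in> {js. length js = k}"
      then have j: "length js \<le> k" by simp
      show "holder_seminorm \<alpha> (sphere 0 1) (?P js) \<le> 4 * C" unfolding holder_seminorm_def
      proof (rule cSUP_least)
        have "?p \<noteq> - ?p" by (rule axis_neq_uminus)
        then have "(?p, - ?p) \<in> {(x, y). x \<in> sphere 0 1 \<and> y \<in> sphere 0 1 \<and> x \<noteq> y}" using p by simp
        then show "{(x, y). x \<in> sphere (0::real^'n) 1 \<and> y \<in> sphere 0 1 \<and> x \<noteq> y} \<noteq> {}" by blast
      qed (use h[OF j] in \<open>auto simp: divide_le_eq\<close>)
    qed
    then show ?thesis using False by simp
  qed (use C in simp)
  show "holder_norm_sphere k \<alpha> g \<le> (real k + 5) * C"
    using 1 2 unfolding holder_norm_sphere_def holder_norm_def by (simp add: algebra_simps)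
qed

section \<open>Local bounds from the norms on the sphere and on the body\<close>

lemma unit_diff:
  fixes x y :: "'a::real_normed_vector"
  assumes "x \<noteq> 0" "y \<noteq> 0"
  shows "norm (x /\<^sub>R norm x - y /\<^sub>R norm y) \<le> 2 / norm x * norm (x - y)"
proof -
  have "x /\<^sub>R norm x - y /\<^sub>R norm y = (x - y) /\<^sub>R norm x + (inverse (norm x) - inverse (norm y)) *\<^sub>R y"
    by (simp add: algebra_simps)
  also have "norm \<dots> \<le> norm ((x - y) /\<^sub>R norm x) + norm ((inverse (norm x) - inverse (norm y)) *\<^sub>R y)" by (rule norm_triangle_ineq)
  also have "norm ((inverse (norm x) - inverse (norm y)) *\<^sub>R y) = \<bar>norm y - norm x\<bar> / norm x"
    using assms by (simp add: divide_simps abs_mult[symmetric] algebra_simps)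
  also have "\<dots> \<le> norm (x - y) / norm x"
    using norm_triangle_ineq3[of y x] by (intro divide_right_mono) (auto simp: norm_minus_commute)
  finally show ?thesis by (simp add: divide_inverse)
qed

text \<open>The norm sees only the sphere and contains a Hoelder bound only at order k. Lower orders
  are Hoelder because their gradients, controlled near the sphere by homogeneity, make them
  Lipschitz. Everything is then carried to the annulus by writing a derivative of order j at x as
  |x| powr (-j) times its value at x/|x|.\<close>

lemma sphere_in:
  fixes c D :: real
  assumes c: "0 < c" and al: "0 \<le> \<alpha>" "\<alpha> \<le> 1"
  shows "\<exists>B\<ge>0. \<forall>(g :: real ^ 'n::finite \<Rightarrow> real) M. 0 \<le> M \<longrightarrow> g \<in> holder_space_sphere k \<alpha> \<longrightarrow>
    holder_norm_sphere k \<alpha> g \<le> M \<longrightarrow> holder_bd k \<alpha> {x. c < norm x \<and> norm x < D} (B * M) (hom_ext g)"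
proof -
  define V where "V = {x :: real^'n. c < norm x \<and> norm x < D}"
  \<comment> \<open>The outer 2 comes from dist \<le> 2 dist powr \<alpha> on the sphere,
    \<open>n * 2 ^ Suc k\<close> from the gradient at points of norm above 1/2, and 4 from pairs at
    distance at least 1/2.\<close>
  define A where "A = 2 * (real CARD('n) * 2 ^ Suc k + 4)"
  have A: "2 \<le> A" "4 \<le> A" unfolding A_def by auto
  have sph: "\<bar>partials js (hom_ext g) x\<bar> \<le> M" 
     "\<bar>partials js (hom_ext g) x - partials js (hom_ext g) y\<bar> \<le> A * M * dist x y powr \<alpha>"
    if M: "0 \<le> M" and g: "g \<in> holder_space_sphere k \<alpha>" and N: "holder_norm_sphere k \<alpha> g \<le> M"
      and j: "length js \<le> k" and xy: "norm x = 1" "norm y = 1"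
    for g :: "real^'n \<Rightarrow> real" and M js x y
  proof -
    let ?P = "\<lambda>js. partials js (hom_ext g)"
    have cont: "continuous_on (-{0}) (?P js)" if "length js \<le> k" for js using g that unfolding holder_space_sphere_def Ck_on_def by auto
    have d: "?P js differentiable (at x)" if "length js < k" "x \<noteq> 0" for js x
      using g that unfolding holder_space_sphere_def Ck_on_def by auto
    have dA: "\<forall>js x. length js < k \<longrightarrow> norm x = 1 \<longrightarrow> ?P js differentiable (at x)"
    proof (intro allI impI)
      fix js :: "'n list" and x :: "real^'n" assume a: "length js < k" "norm x = 1"
      then have "x \<noteq> 0" by auto
      then show "?P js differentiable (at x)" by (rule d[OF a(1)])
    qed
    have bdd: "bdd_above ((\<lambda>x. \<bar>?P js x\<bar>) ` sphere 0 1)" if "length js \<le> k" for js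
    proof -
      have "continuous_on (sphere 0 1) (?P js)" by (rule continuous_on_subset[OF cont[OF that]]) auto
      then show ?thesis
        by (intro bounded_imp_bdd_above compact_imp_bounded compact_continuous_image continuous_on_rabs compact_sphere)
    qed
    have hol: "holder_on \<alpha> (sphere 0 1) (?P js)" if "0 < \<alpha>" "length js = k" for js
      using g that unfolding holder_space_sphere_def by auto
    obtain i :: 'n where True by simp
    have p: "axis i 1 \<in> sphere (0::real^'n) 1" "- axis i 1 \<in> sphere (0::real^'n) 1" by auto
    note p = p axis_neq_uminus
    have bddA: "\<forall>js. length js \<le> k \<longrightarrow> bdd_above ((\<lambda>x. \<bar>?P js x\<bar>) ` sphere 0 1)" using bdd by (intro allI impI)
    have holA: "\<forall>js. 0 < \<alpha> \<longrightarrow> length js = k \<longrightarrow> holder_on \<alpha> (sphere 0 1) (?P js)" using hol by (intro allI impI)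
    note B = holder_norm_bounds[of k "hom_ext g" "sphere 0 1" \<alpha>, OF bddA holA p N[unfolded holder_norm_sphere_def] al(1)]
    show b: "\<bar>?P js x\<bar> \<le> M" using B(1)[OF j] xy by simp
    have b': "\<bar>?P js y\<bar> \<le> M" using B(1)[OF j] xy by simp
    show "\<bar>?P js x - ?P js y\<bar> \<le> A * M * dist x y powr \<alpha>"
    proof (cases "length js = k")
      case True
      show ?thesis
      proof (cases "\<alpha> = 0")
        case True
        have "2 * M \<le> A * M" using A M by (intro mult_right_mono) auto
        then show ?thesis using True b b' by (cases "x = y") auto
      next
        case False
        then have "\<bar>?P js x - ?P js y\<bar> \<le> M * dist x y powr \<alpha>" using B(2)[OF _ True] al(1) xy by simp
        also have "\<dots> \<le> A * M * dist x y powr \<alpha>" using A M mult_right_mono[of 1 A M] by (intro mult_right_mono) auto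
        finally show ?thesis .
      qed
    next
      case False
      then have jk: "length js < k" using j by simp
      have "dist x y \<le> 2" using norm_triangle_ineq4[of x y] xy by (simp add: dist_norm)
      then have dp: "dist x y \<le> 2 * dist x y powr \<alpha>"
      proof -
        have "dist x y = dist x y powr (1 - \<alpha>) * dist x y powr \<alpha>" by (simp add: powr_add[symmetric])
        also have "\<dots> \<le> 2 powr (1 - \<alpha>) * dist x y powr \<alpha>" using \<open>dist x y \<le> 2\<close> al by (intro mult_right_mono powr_mono2) auto
        also have "(2::real) powr (1 - \<alpha>) \<le> 2 powr 1" using al by (intro powr_mono) auto
        finally show ?thesis by (simp add: mult_right_mono)
      qed
      have "\<bar>?P js x - ?P js y\<bar> \<le> (real CARD('n) * 2 ^ Suc k + 4) * M * dist x y"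
      proof (cases "dist x y < 1/2")
        case True
        \<comment> \<open>The segment from x to y leaves the sphere but stays in this ball, away
          from the origin.\<close>
        have low: "1/2 < norm z" if "z \<in> ball x (1/2)" for z
          using that norm_triangle_ineq2[of x "x - z"] xy by (simp add: dist_norm)
        have gb: "\<bar>partials [i] (?P js) z\<bar> \<le> 2 ^ Suc k * M" if z: "z \<in> ball x (1/2)" for i z
        proof -
          have z0: "z \<noteq> 0" using low[OF z] by auto
          have sj: "length (i # js) \<le> k" using jk by simp
          have "?P (i # js) (norm z *\<^sub>R (z /\<^sub>R norm z)) = ?P (i # js) (z /\<^sub>R norm z) / norm z ^ length (i # js)"
            by (rule partials_hom_ext_scale(1)[OF dA sj]) (use z0 in auto)
          then have "\<bar>?P (i # js) z\<bar> = \<bar>?P (i # js) (z /\<^sub>R norm z)\<bar> * inverse (norm z) ^ length (i # js)"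
            using z0 by (simp add: abs_mult divide_inverse power_inverse del: partials.simps)
          also have "\<dots> \<le> M * 2 ^ length (i # js)"
          proof (intro mult_mono power_mono)
            show "\<bar>?P (i # js) (z /\<^sub>R norm z)\<bar> \<le> M" using B(1)[OF sj] z0 by simp
            show "inverse (norm z) \<le> 2" using low[OF z] le_imp_inverse_le[of "1/2" "norm z"] by simp
          qed (use M in auto)
          also have "\<dots> \<le> M * 2 ^ Suc k" using sj M by (intro mult_left_mono power_increasing) auto
          finally show ?thesis by (simp add: mult.commute)
        qed
        have "\<bar>?P js x - ?P js y\<bar> \<le> real CARD('n) * (2 ^ Suc k * M) * dist x y"
        proof (rule lipschitz_if_grad_bound[of "ball x (1/2)" _ "\<lambda>i. partials [i] (?P js)"])
          fix z assume "z \<in> ball x (1/2)"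
          then have "z \<noteq> 0" using low by fastforce
          then show "(?P js has_derivative lin_form (\<lambda>i. partials [i] (?P js)) z) (at z)"
            by (intro differentiable_lin_form d jk)
        qed (use True gb in auto)
        also have "\<dots> \<le> (real CARD('n) * 2 ^ Suc k + 4) * M * dist x y" using M by (intro mult_right_mono) (auto simp: algebra_simps)
        finally show ?thesis .
      next
        case False
        have "\<bar>?P js x - ?P js y\<bar> \<le> 4 * M * (1/2)" using b b' by simp
        also have "\<dots> \<le> (real CARD('n) * 2 ^ Suc k + 4) * M * dist x y" using False M
          by (intro mult_mono mult_right_mono) auto
        finally show ?thesis .
      qed
      also have "\<dots> \<le> (real CARD('n) * 2 ^ Suc k + 4) * M * (2 * dist x y powr \<alpha>)" using dp M by (intro mult_left_mono) auto
      finally show ?thesis unfolding A_def by (simp add: algebra_simps)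
    qed
  qed
  have "\<exists>B\<ge>0. hold0 \<alpha> V B (\<lambda>x. norm x powr - real m)" for m :: nat
  proof -
    obtain C1 where C1: "C1 \<ge> 0" "\<forall>U::(real^'n) set. (\<forall>x\<in>U. c \<le> norm x \<and> norm x \<le> D) \<longrightarrow> holder_bd 0 1 U C1 norm"
      using bd_norm[OF c] by blast
    obtain C2 where C2: "C2 \<ge> 0" "\<forall>(U::(real^'n) set) f. holder_bd 0 1 U C1 f \<longrightarrow> (\<forall>x\<in>U. c \<le> f x) \<longrightarrow>
      holder_bd 0 1 U C2 (\<lambda>x. f x powr - real m)" using bd_powr[OF c C1(1)] by blast
    have "holder_bd 0 1 V C1 norm" using C1(2) unfolding V_def by auto
    then have "holder_bd 0 1 V C2 (\<lambda>x. norm x powr - real m)" using C2(2) unfolding V_def by auto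
    moreover have "dist x y \<le> max 1 (2 * D)" if "x \<in> V" "y \<in> V" for x y
      using that norm_triangle_ineq4[of x y] unfolding V_def dist_norm mem_Collect_eq le_max_iff_disj by linarith
    ultimately have "holder_bd 0 \<alpha> V (max 1 (2 * D) powr (1 - \<alpha>) * C2) (\<lambda>x. norm x powr - real m)"
      using bd_exp[OF al(2), of V "max 1 (2 * D)" C2 0] C2(1) by simp
    then show ?thesis using C2(1) by (intro exI[of _ "max 1 (2 * D) powr (1 - \<alpha>) * C2"]) auto
  qed
  then obtain Q where Q: "\<And>m. 0 \<le> Q m" "\<And>m. hold0 \<alpha> V (Q m) (\<lambda>x. norm x powr - real m)" by metis
  \<comment> \<open>E accounts for composing with x/|x|, whose Lipschitz constant on the annulus is
    at most 2/c; B sums over all orders so that one constant fits each.\<close>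
  define E where "E = A * (1 + (2 / c) powr \<alpha>)"
  define B where "B = (\<Sum>m\<le>k. 2 * (Q m * E))"
  have E0: "0 \<le> E" unfolding E_def using A by (intro mult_nonneg_nonneg add_nonneg_nonneg) auto
  have B0: "0 \<le> B" unfolding B_def using Q(1) E0 by (intro sum_nonneg) auto
  have "holder_bd k \<alpha> V (B * M) (hom_ext g)" 
    if M: "0 \<le> M" and g: "g \<in> holder_space_sphere k \<alpha>" and N: "holder_norm_sphere k \<alpha> g \<le> M"
    for g :: "real^'n \<Rightarrow> real" and M
  proof (rule bd_from_partials)
    let ?P = "\<lambda>js. partials js (hom_ext g)"
    have d: "?P js differentiable (at x)" if "length js < k" "x \<noteq> 0" for js x
      using g that unfolding holder_space_sphere_def Ck_on_def by auto
    have dA: "\<forall>js x. length js < k \<longrightarrow> norm x = 1 \<longrightarrow> ?P js differentiable (at x)"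
    proof (intro allI impI)
      fix js :: "'n list" and x :: "real^'n" assume a: "length js < k" "norm x = 1"
      then have "x \<noteq> 0" by auto
      then show "?P js differentiable (at x)" by (rule d[OF a(1)])
    qed
    show "?P js differentiable (at x)" if "length js < k" "x \<in> V" for js x
    proof -
      have "x \<noteq> 0" using that(2) c unfolding V_def by auto
      then show ?thesis by (rule d[OF that(1)])
    qed
    fix js :: "'n list" assume j: "length js \<le> k"
    have cont: "continuous_on (-{0}) (?P js)" using g j unfolding holder_space_sphere_def Ck_on_def by auto
    have V0: "x \<noteq> 0" "c \<le> norm x" if "x \<in> V" for x using that c unfolding V_def by auto
    note S = sph[OF M g N j]
    have "hold0 \<alpha> V (E * M) (\<lambda>x. ?P js (x /\<^sub>R norm x))" unfolding hold0_def
    proof (intro conjI ballI)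
      show "continuous_on V (\<lambda>x. ?P js (x /\<^sub>R norm x))"
        by (rule continuous_on_compose2[OF cont]) (use V0 in \<open>auto intro!: continuous_intros\<close>)
    next
      fix x assume "x \<in> V"
      have "M = 1 * 1 * M" by simp
      also have "\<dots> \<le> E * M" unfolding E_def using A M by (intro mult_mono mult_right_mono) auto
      finally show "\<bar>?P js (x /\<^sub>R norm x)\<bar> \<le> E * M" using S(1)[of "x /\<^sub>R norm x" "x /\<^sub>R norm x"] V0[OF \<open>x \<in> V\<close>] by auto
    next
      fix x y assume xy: "x \<in> V" "y \<in> V"
      have "\<bar>?P js (x /\<^sub>R norm x) - ?P js (y /\<^sub>R norm y)\<bar> \<le> A * M * dist (x /\<^sub>R norm x) (y /\<^sub>R norm y) powr \<alpha>"
        using S(2) V0 xy by simp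
      also have "\<dots> \<le> A * M * ((2 / c) * dist x y) powr \<alpha>"
      proof (intro mult_left_mono powr_mono2)
        have "dist (x /\<^sub>R norm x) (y /\<^sub>R norm y) \<le> 2 / norm x * dist x y" unfolding dist_norm using V0 xy by (intro unit_diff) auto
        also have "\<dots> \<le> 2 / c * dist x y" using V0 xy c by (intro mult_right_mono divide_left_mono) auto
        finally show "dist (x /\<^sub>R norm x) (y /\<^sub>R norm y) \<le> 2 / c * dist x y" .
      qed (use A M al in auto)
      also have "\<dots> = A * M * (2 / c) powr \<alpha> * dist x y powr \<alpha>"
        by (subst powr_mult) (use c in auto)
      also have "\<dots> \<le> E * M * dist x y powr \<alpha>" unfolding E_def using A M by (intro mult_right_mono) (auto simp: algebra_simps)
      finally show "\<bar>?P js (x /\<^sub>R norm x) - ?P js (y /\<^sub>R norm y)\<bar> \<le> E * M * dist x y powr \<alpha>" .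
    qed
    from hold0_mult[OF Q(2)[of "length js"] this Q(1)] have 
      "hold0 \<alpha> V (2 * (Q (length js) * (E * M))) (\<lambda>x. norm x powr - real (length js) * ?P js (x /\<^sub>R norm x))" using E0 M by simp
    then have "hold0 \<alpha> V (2 * (Q (length js) * (E * M))) (?P js)"
    proof (rule hold0_cong[rotated])
      fix x assume x: "x \<in> V"
      have "?P js (norm x *\<^sub>R (x /\<^sub>R norm x)) = ?P js (x /\<^sub>R norm x) / norm x ^ length js"
        by (rule partials_hom_ext_scale(1)[OF dA j]) (use V0[OF x] in auto)
      then show "norm x powr - real (length js) * ?P js (x /\<^sub>R norm x) = ?P js x"
        using V0[OF x] by (simp add: powr_minus powr_realpow divide_inverse)
    qed
    then show "hold0 \<alpha> V (B * M) (?P js)"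
    proof (rule hold0_mono)
      have "2 * (Q (length js) * E) \<le> B" unfolding B_def using j Q(1) E0 
        by (intro member_le_sum[of "length js" _ "\<lambda>m. 2 * (Q m * E)"]) auto
      then have "2 * (Q (length js) * E) * M \<le> B * M" using M by (rule mult_right_mono)
      then show "2 * (Q (length js) * (E * M)) \<le> B * M" by (simp add: mult_ac)
    qed
  qed
  then show ?thesis using B0 unfolding V_def by blast
qed

text \<open>Orders below k inherit a Hoelder bound from the mean value inequality, which applies
  because the interior is convex. The body influences the constant only through D, as a bound on the
  diameter.\<close>

lemma body_in:
  fixes D :: real
  assumes al: "0 \<le> \<alpha>" "\<alpha> \<le> 1"
  shows "\<exists>B\<ge>0. \<forall>(\<Omega> :: (real ^ 'n::finite) set) \<phi> M. convex_body \<Omega> \<longrightarrow> \<Omega> \<subseteq> cball 0 D \<longrightarrow> 0 \<le> M \<longrightarrow> \<phi> \<in> holder_space_body k \<alpha> \<Omega> \<longrightarrow>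
    holder_norm_body k \<alpha> \<Omega> \<phi> \<le> M \<longrightarrow> holder_bd k \<alpha> (interior \<Omega>) (B * M) \<phi>"
proof -
  define E where "E = max 1 (2 * D)"
  \<comment> \<open>2 is for \<alpha> = 0, where only the difference of two values bounded by M is
    known; n E is for the orders below k.\<close>
  define B where "B = 2 + real CARD('n) * E"
  have EB: "1 \<le> E" "2 \<le> B" "real CARD('n) * E \<le> B" unfolding E_def B_def by auto
  have "holder_bd k \<alpha> (interior \<Omega>) (B * M) \<phi>"
    if cb: "convex_body \<Omega>" and sub: "\<Omega> \<subseteq> cball 0 D" and M: "0 \<le> M" and f: "\<phi> \<in> holder_space_body k \<alpha> \<Omega>" and
     N: "holder_norm_body k \<alpha> \<Omega> \<phi> \<le> M" for \<Omega> :: "(real ^ 'n) set" and \<phi> M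
  proof (rule bd_from_partials)
    let ?P = "\<lambda>js. partials js \<phi>"
    have d: "?P js differentiable (at x)" if "length js < k" "x \<in> interior \<Omega>" for js x
      using f that unfolding holder_space_body_def Ck_on_def by auto
    then show "length js < k \<Longrightarrow> x \<in> interior \<Omega> \<Longrightarrow> ?P js differentiable (at x)" for js x .
    have co: "compact \<Omega>" "convex \<Omega>" "interior \<Omega> \<noteq> {}" using cb unfolding convex_body_def by auto
    have bdd: "bdd_above ((\<lambda>x. \<bar>?P js x\<bar>) ` interior \<Omega>)" if j: "length js \<le> k" for js
    proof -
      obtain g where g: "continuous_on \<Omega> g" "\<forall>x\<in>interior \<Omega>. g x = ?P js x"
        using f j unfolding holder_space_body_def by blast
      have "bdd_above ((\<lambda>x. \<bar>g x\<bar>) ` \<Omega>)"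
        using g(1) co(1) by (intro bounded_imp_bdd_above compact_imp_bounded compact_continuous_image continuous_intros)
      then have "bdd_above ((\<lambda>x. \<bar>g x\<bar>) ` interior \<Omega>)"
        by (rule bdd_above_mono) (use interior_subset in blast)
      moreover have "(\<lambda>x. \<bar>g x\<bar>) ` interior \<Omega> = (\<lambda>x. \<bar>?P js x\<bar>) ` interior \<Omega>" using g(2) by (intro image_cong) auto
      ultimately show ?thesis by simp
    qed
    have hol: "holder_on \<alpha> (interior \<Omega>) (?P js)" if "0 < \<alpha>" "length js = k" for js
      using f that unfolding holder_space_body_def by auto
    obtain p where p: "p \<in> interior \<Omega>" using co(3) by auto
    then obtain r where r: "r > 0" "ball p r \<subseteq> interior \<Omega>" by (meson open_contains_ball open_interior)
    obtain i :: 'n where True by simp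
    have p': "p + (r/2) *\<^sub>R axis i 1 \<in> interior \<Omega>" "p \<noteq> p + (r/2) *\<^sub>R axis i 1"
      using r by (auto simp: subset_eq dist_norm axis_eq_0_iff)
    have bddA: "\<forall>js. length js \<le> k \<longrightarrow> bdd_above ((\<lambda>x. \<bar>?P js x\<bar>) ` interior \<Omega>)" using bdd by (intro allI impI)
    have holA: "\<forall>js. 0 < \<alpha> \<longrightarrow> length js = k \<longrightarrow> holder_on \<alpha> (interior \<Omega>) (?P js)" using hol by (intro allI impI)
    note B = holder_norm_bounds[of k \<phi> "interior \<Omega>" \<alpha>, OF bddA holA p p' N[unfolded holder_norm_body_def] al(1)]
    fix js :: "'n list" assume j: "length js \<le> k"
    have M2: "2 * M \<le> B * M" "M \<le> B * M" using EB(2) M mult_right_mono[of 2 B M] by auto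
    show "hold0 \<alpha> (interior \<Omega>) (B * M) (?P js)" unfolding hold0_def
    proof (intro conjI ballI)
      show "continuous_on (interior \<Omega>) (?P js)" using f j unfolding holder_space_body_def Ck_on_def by auto
      show "\<bar>?P js x\<bar> \<le> B * M" if "x \<in> interior \<Omega>" for x using B(1)[OF j that] M2 by simp
      fix x y assume xy: "x \<in> interior \<Omega>" "y \<in> interior \<Omega>"
      show "\<bar>?P js x - ?P js y\<bar> \<le> B * M * dist x y powr \<alpha>"
      proof (cases "length js = k")
        case True
        show ?thesis
        proof (cases "\<alpha> = 0")
          case True
          then show ?thesis using B(1)[OF j xy(1)] B(1)[OF j xy(2)] M2 by (cases "x = y") auto
        next
          case False
          then have "\<bar>?P js x - ?P js y\<bar> \<le> M * dist x y powr \<alpha>" using B(2)[OF _ True xy] al(1) by simp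
          also have "\<dots> \<le> B * M * dist x y powr \<alpha>" using M2 by (intro mult_right_mono) auto
          finally show ?thesis .
        qed
      next
        case False
        then have jk: "length js < k" using j by simp
        have "\<bar>?P js x - ?P js y\<bar> \<le> real CARD('n) * M * dist x y"
        proof (rule lipschitz_if_grad_bound[of "interior \<Omega>" _ "\<lambda>i. partials [i] (?P js)"])
          show "(?P js has_derivative lin_form (\<lambda>i. partials [i] (?P js)) z) (at z)" if "z \<in> interior \<Omega>" for z
            using that by (intro differentiable_lin_form d jk)
          show "\<bar>partials [i] (?P js) z\<bar> \<le> M" if "z \<in> interior \<Omega>" for z i
            using B(1)[of "i # js" z] that jk by simp
        qed (use co(2) xy in \<open>auto intro: convex_interior\<close>)
        also have "\<dots> \<le> real CARD('n) * M * (E * dist x y powr \<alpha>)"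
        proof (intro mult_left_mono)
          have "x \<in> cball 0 D" "y \<in> cball 0 D" using xy sub interior_subset by blast+
          then have "dist x y \<le> E" using norm_triangle_ineq4[of x y] unfolding E_def dist_norm le_max_iff_disj mem_cball_0 by linarith
          have "dist x y = dist x y powr (1 - \<alpha>) * dist x y powr \<alpha>" by (simp add: powr_add[symmetric])
          also have "\<dots> \<le> E powr (1 - \<alpha>) * dist x y powr \<alpha>" using \<open>dist x y \<le> E\<close> al by (intro mult_right_mono powr_mono2) auto
          also have "\<dots> \<le> E powr 1 * dist x y powr \<alpha>" using al EB by (intro mult_right_mono powr_mono) auto
          finally show "dist x y \<le> E * dist x y powr \<alpha>" using EB by simp
        qed (use M in auto)
        also have "\<dots> = real CARD('n) * E * (M * dist x y powr \<alpha>)" by simp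
        also have "\<dots> \<le> B * (M * dist x y powr \<alpha>)" using EB(3) M by (intro mult_right_mono) auto
        finally show ?thesis by simp
      qed
    qed
  qed
  then show ?thesis using EB(2) by (intro exI[of _ B]) auto
qed

section \<open>Uniformly bounded families\<close>

text \<open>Families bounded uniformly up to a weight \<open>m\<close>. All constants are hidden in this
  definition, so that the index set can range over all admissible data at once.\<close>

definition unif_bd :: "nat \<Rightarrow> real \<Rightarrow> ('i \<Rightarrow> (real ^ 'n::finite) set) \<Rightarrow> 'i set \<Rightarrow> ('i \<Rightarrow> real) \<Rightarrow>
    ('i \<Rightarrow> real ^ 'n \<Rightarrow> real) \<Rightarrow> bool" where
  "unif_bd k \<alpha> U I m f \<longleftrightarrow> (\<exists>C\<ge>0. \<forall>i\<in>I. holder_bd k \<alpha> (U i) (C * m i) (f i))"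

lemma unif_bdI: "0 \<le> C \<Longrightarrow> (\<And>i. i \<in> I \<Longrightarrow> holder_bd k \<alpha> (U i) (C * m i) (f i)) \<Longrightarrow> unif_bd k \<alpha> U I m f"
  unfolding unif_bd_def by blast

lemma unif_bdE:
  assumes "unif_bd k \<alpha> U I m f"
  obtains C where "0 \<le> C" "\<forall>i\<in>I. holder_bd k \<alpha> (U i) (C * m i) (f i)"
  using assms unfolding unif_bd_def by (elim exE conjE)

lemma unif_bd_subset: "unif_bd k \<alpha> U I m f \<Longrightarrow> J \<subseteq> I \<Longrightarrow> unif_bd k \<alpha> U J m f"
  unfolding unif_bd_def by blast

lemma unif_bd_le: "unif_bd k \<alpha> U I m f \<Longrightarrow> j \<le> k \<Longrightarrow> unif_bd j \<alpha> U I m f"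
  unfolding unif_bd_def using bd_le by meson

lemma unif_bd_weight:
  assumes "unif_bd k \<alpha> U I m f" "0 \<le> c" "\<And>i. i \<in> I \<Longrightarrow> m i \<le> c * m' i"
  shows "unif_bd k \<alpha> U I m' f"
proof -
  obtain C where C0: "0 \<le> C" "\<forall>i\<in>I. holder_bd k \<alpha> (U i) (C * m i) (f i)"
    by (rule unif_bdE[OF assms(1)])
  note C = C0(1) C0(2)[THEN bspec]
  show ?thesis
  proof (rule unif_bdI[of "C * c"])
    show "0 \<le> C * c" using C assms by simp
    fix i assume i: "i \<in> I"
    have "C * m i \<le> C * (c * m' i)" using C(1) assms(3)[OF i] by (rule mult_left_mono[rotated])
    then show "holder_bd k \<alpha> (U i) (C * c * m' i) (f i)" using bd_mono[OF C(2)[OF i]] by (simp add: mult.assoc)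
  qed
qed

lemma unif_bd_cong:
  assumes "unif_bd k \<alpha> U I m f" "\<And>i. i \<in> I \<Longrightarrow> open (U i)" "\<And>i x. i \<in> I \<Longrightarrow> x \<in> U i \<Longrightarrow> f i x = g i x"
  shows "unif_bd k \<alpha> U I m g"
proof -
  obtain C where C0: "0 \<le> C" "\<forall>i\<in>I. holder_bd k \<alpha> (U i) (C * m i) (f i)"
    by (rule unif_bdE[OF assms(1)])
  note C = C0(1) C0(2)[THEN bspec]
  show ?thesis using bd_cong[OF assms(2,3) C(2)] by (intro unif_bdI[OF C(1)])
qed

text \<open>Later the predicate separates integration points near the singularity, where a
  difference must be estimated, from those at a fixed distance, where the weight is bounded
  below.\<close>

lemma unif_bd_split:
  assumes "unif_bd k \<alpha> U {i\<in>I. P i} m f" "unif_bd k \<alpha> U {i\<in>I. \<not> P i} m f" "\<And>i. i \<in> I \<Longrightarrow> 0 \<le> m i"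
  shows "unif_bd k \<alpha> U I m f"
proof -
  obtain C where C0: "0 \<le> C" "\<forall>i\<in>{i\<in>I. P i}. holder_bd k \<alpha> (U i) (C * m i) (f i)"
    by (rule unif_bdE[OF assms(1)])
  note C = C0(1) C0(2)[THEN bspec]
  obtain D where D0: "0 \<le> D" "\<forall>i\<in>{i\<in>I. \<not> P i}. holder_bd k \<alpha> (U i) (D * m i) (f i)"
    by (rule unif_bdE[OF assms(2)])
  note D = D0(1) D0(2)[THEN bspec]
  show ?thesis
  proof (rule unif_bdI[of "C + D"])
    fix i assume i: "i \<in> I"
    have "C * m i \<le> (C + D) * m i" "D * m i \<le> (C + D) * m i" using C(1) D(1) assms(3)[OF i] by (auto intro!: mult_right_mono)
    then show "holder_bd k \<alpha> (U i) ((C + D) * m i) (f i)" using bd_mono[OF C(2), of i] bd_mono[OF D(2), of i] i by blast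
  qed (use C D in simp)
qed

lemma unif_bd_mult:
  assumes "unif_bd k \<alpha> U I m f" "unif_bd k \<alpha> U I n g" "\<And>i. i \<in> I \<Longrightarrow> 0 \<le> m i" "\<And>i. i \<in> I \<Longrightarrow> 0 \<le> n i"
  shows "unif_bd k \<alpha> U I (\<lambda>i. m i * n i) (\<lambda>i x. f i x * g i x)"
proof -
  obtain C where C0: "0 \<le> C" "\<forall>i\<in>I. holder_bd k \<alpha> (U i) (C * m i) (f i)"
    by (rule unif_bdE[OF assms(1)])
  note C = C0(1) C0(2)[THEN bspec]
  obtain D where D0: "0 \<le> D" "\<forall>i\<in>I. holder_bd k \<alpha> (U i) (D * n i) (g i)"
    by (rule unif_bdE[OF assms(2)])
  note D = D0(1) D0(2)[THEN bspec]
  show ?thesis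
  proof (rule unif_bdI[of "2 ^ Suc k * (C * D)"])
    fix i assume i: "i \<in> I"
    show "holder_bd k \<alpha> (U i) (2 ^ Suc k * (C * D) * (m i * n i)) (\<lambda>x. f i x * g i x)"
      using bd_mult[OF _ _ C(2)[OF i] D(2)[OF i]] C(1) D(1) assms(3,4)[OF i] by (simp add: mult_ac)
  qed (use C D in simp)
qed

lemma unif_bd_add:
  assumes "unif_bd k \<alpha> U I m f" "unif_bd k \<alpha> U I m g" "\<And>i. i \<in> I \<Longrightarrow> 0 \<le> m i"
  shows "unif_bd k \<alpha> U I m (\<lambda>i x. f i x + g i x)"
proof -
  obtain C where C0: "0 \<le> C" "\<forall>i\<in>I. holder_bd k \<alpha> (U i) (C * m i) (f i)"
    by (rule unif_bdE[OF assms(1)])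
  note C = C0(1) C0(2)[THEN bspec]
  obtain D where D0: "0 \<le> D" "\<forall>i\<in>I. holder_bd k \<alpha> (U i) (D * m i) (g i)"
    by (rule unif_bdE[OF assms(2)])
  note D = D0(1) D0(2)[THEN bspec]
  show ?thesis using bd_add[OF C(2) D(2)] C(1) D(1) by (intro unif_bdI[of "C + D"]) (auto simp: distrib_right)
qed

lemma unif_bd_scale:
  assumes "unif_bd k \<alpha> U I m f"
  shows "unif_bd k \<alpha> U I (\<lambda>i. \<bar>c i\<bar> * m i) (\<lambda>i x. c i * f i x)"
proof -
  obtain C where C0: "0 \<le> C" "\<forall>i\<in>I. holder_bd k \<alpha> (U i) (C * m i) (f i)"
    by (rule unif_bdE[OF assms])
  note C = C0(1) C0(2)[THEN bspec]
  show ?thesis using bd_cmult[OF C(2), of _ "c _"] by (intro unif_bdI[OF C(1)]) (simp add: mult_ac)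
qed

lemma unif_bd_diff:
  assumes "unif_bd k \<alpha> U I m f" "unif_bd k \<alpha> U I m g" "\<And>i. i \<in> I \<Longrightarrow> 0 \<le> m i"
  shows "unif_bd k \<alpha> U I m (\<lambda>i x. f i x - g i x)"
  using unif_bd_add[OF assms(1) _ assms(3), of "\<lambda>i x. - 1 * g i x"] unif_bd_scale[OF assms(2), of "\<lambda>_. -1"] by simp

lemma unif_bd_const: "unif_bd k \<alpha> U I (\<lambda>i. \<bar>c i\<bar>) (\<lambda>i x. c i)"
  by (rule unif_bdI[of 1]) (auto intro: bd_const)

lemma unif_bd_sum:
  assumes "finite S" "\<And>l. l \<in> S \<Longrightarrow> unif_bd k \<alpha> U I m (f l)" "\<And>i. i \<in> I \<Longrightarrow> 0 \<le> m i"
  shows "unif_bd k \<alpha> U I m (\<lambda>i x. \<Sum>l\<in>S. f l i x)"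
  using assms
proof (induction S)
  case empty
  show ?case using unif_bd_weight[OF unif_bd_const[of k \<alpha> U I "\<lambda>_. 0"], of 1 m] empty by simp
next
  case (insert a S)
  then show ?case using unif_bd_add[of k \<alpha> U I m "f a" "\<lambda>i x. \<Sum>l\<in>S. f l i x"] by simp
qed

lemma unif_bd_exp:
  assumes "unif_bd k \<alpha> U I m f" "\<alpha>' \<le> \<alpha>" "\<And>i x y. i \<in> I \<Longrightarrow> x \<in> U i \<Longrightarrow> y \<in> U i \<Longrightarrow> dist x y \<le> D" "1 \<le> D" "\<And>i. i \<in> I \<Longrightarrow> 0 \<le> m i"
  shows "unif_bd k \<alpha>' U I m f"
proof -
  obtain C where C0: "0 \<le> C" "\<forall>i\<in>I. holder_bd k \<alpha> (U i) (C * m i) (f i)"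
    by (rule unif_bdE[OF assms(1)])
  note C = C0(1) C0(2)[THEN bspec]
  show ?thesis
  proof (rule unif_bdI[of "D powr (\<alpha> - \<alpha>') * C"])
    fix i assume i: "i \<in> I"
    have "holder_bd k \<alpha>' (U i) (D powr (\<alpha> - \<alpha>') * (C * m i)) (f i)"
      by (rule bd_exp[OF assms(2) _ assms(4) _ C(2)[OF i]]) (use assms(3)[OF i] C(1) assms(5)[OF i] in auto)
    then show "holder_bd k \<alpha>' (U i) (D powr (\<alpha> - \<alpha>') * C * m i) (f i)" by (simp add: mult.assoc)
  qed (use C in simp)
qed

lemma unif_bd_common:
  assumes "\<And>l. unif_bd k \<alpha> U I (\<lambda>_. 1) (f l)"
  shows "\<exists>C\<ge>0. \<forall>l::'l::finite. \<forall>i\<in>I. holder_bd k \<alpha> (U i) C (f l i)"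
proof -
  have "\<forall>l. \<exists>C\<ge>0. \<forall>i\<in>I. holder_bd k \<alpha> (U i) C (f l i)" using assms unfolding unif_bd_def by simp
  then obtain C where C: "\<And>l. 0 \<le> C l" "\<And>l i. i \<in> I \<Longrightarrow> holder_bd k \<alpha> (U i) (C l) (f l i)" by metis
  have le: "C l \<le> (\<Sum>l\<in>UNIV. C l)" for l using C(1) by (intro member_le_sum) auto
  show ?thesis using C(1) bd_mono[OF C(2) le] by (intro exI[of _ "\<Sum>l\<in>UNIV. C l"]) (auto intro: sum_nonneg)
qed

lemma unif_bd_compose:
  fixes d :: "'i \<Rightarrow> real ^ 'n::finite \<Rightarrow> real ^ 'm::finite"
  assumes g: "unif_bd k \<beta> V I n g" and d: "\<And>m. unif_bd k (\<beta> * \<gamma>) U I (\<lambda>_. 1) (\<lambda>i x. d i x $ m)"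
    and lip: "0 \<le> L" "\<And>i x y. i \<in> I \<Longrightarrow> x \<in> U i \<Longrightarrow> y \<in> U i \<Longrightarrow> dist (d i x) (d i y) \<le> L * dist x y powr \<gamma>"
    and im: "\<And>i x. i \<in> I \<Longrightarrow> x \<in> U i \<Longrightarrow> d i x \<in> V i" and n: "\<And>i. i \<in> I \<Longrightarrow> 0 \<le> n i" and b: "0 \<le> \<beta>"
  shows "unif_bd k (\<beta> * \<gamma>) U I n (\<lambda>i x. g i (d i x))"
proof -
  obtain C where C0: "0 \<le> C" "\<forall>i\<in>I. holder_bd k \<beta> (V i) (C * n i) (g i)"
    by (rule unif_bdE[OF g])
  note C = C0(1) C0(2)[THEN bspec]
  obtain D where D: "0 \<le> D" "\<forall>m. \<forall>i\<in>I. holder_bd k (\<beta> * \<gamma>) (U i) D (\<lambda>x. d i x $ m)"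
    using unif_bd_common[where f = "\<lambda>m i x. d i x $ m", OF d] by (elim exE conjE)
  obtain c where c: "c \<ge> 0" "\<forall>(U::(real^'n) set) (V::(real^'m) set) N g d. 0 \<le> N \<longrightarrow> holder_bd k \<beta> V N g \<longrightarrow>
     (\<forall>m. holder_bd k (\<beta> * \<gamma>) U D (\<lambda>x. d x $ m)) \<longrightarrow>
     (\<forall>x\<in>U. \<forall>y\<in>U. dist (d x) (d y) \<le> L * dist x y powr \<gamma>) \<longrightarrow> d ` U \<subseteq> V \<longrightarrow>
     holder_bd k (\<beta> * \<gamma>) U (c * N) (\<lambda>x. g (d x))" using bd_compose[OF D(1) lip(1) b, where k = k and \<gamma> = \<gamma>] by (elim exE conjE)
  show ?thesis
  proof (rule unif_bdI[of "c * C"])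
    fix i assume i: "i \<in> I"
    have "holder_bd k (\<beta> * \<gamma>) (U i) (c * (C * n i)) (\<lambda>x. g i (d i x))"
    proof (rule c(2)[rule_format, OF _ C(2)[OF i]])
      show "0 \<le> C * n i" using C(1) n[OF i] by simp
      show "holder_bd k (\<beta> * \<gamma>) (U i) D (\<lambda>x. d i x $ m)" for m by (rule D(2)[rule_format, OF i])
      show "d i ` U i \<subseteq> V i" using im[OF i] by blast
    qed (use lip(2)[OF i] in auto)
    then show "holder_bd k (\<beta> * \<gamma>) (U i) (c * C * n i) (\<lambda>x. g i (d i x))" by (simp add: mult.assoc)
  qed (use c C in simp)
qed

lemma unif_bd_powr:
  fixes s :: real
  assumes f: "unif_bd k \<alpha> U I (\<lambda>_. 1) f" and c: "0 < c" "\<And>i x. i \<in> I \<Longrightarrow> x \<in> U i \<Longrightarrow> c \<le> f i x"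
  shows "unif_bd k \<alpha> U I (\<lambda>_. 1) (\<lambda>i x. f i (x :: real ^ 'n::finite) powr s)"
proof -
  obtain C where C0: "0 \<le> C" "\<forall>i\<in>I. holder_bd k \<alpha> (U i) (C * 1) (f i)"
    by (rule unif_bdE[OF f])
  note C = C0(1) C0(2)[THEN bspec]
  obtain D where D: "D \<ge> 0" "\<forall>(U::(real^'n) set) f. holder_bd k \<alpha> U C f \<longrightarrow> (\<forall>x\<in>U. c \<le> f x) \<longrightarrow>
      holder_bd k \<alpha> U D (\<lambda>x. f x powr s)" using bd_powr[OF c(1) C(1), where k = k and \<alpha> = \<alpha> and s = s] by (elim exE conjE)
  show ?thesis using D C(2) c(2) by (intro unif_bdI[OF D(1)]) auto
qed

lemma unif_bd_norm:
  assumes "0 < c" "\<And>i x. i \<in> I \<Longrightarrow> x \<in> U i \<Longrightarrow> c \<le> norm x \<and> norm x \<le> D"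
  shows "unif_bd k 1 U I (\<lambda>_. 1) (\<lambda>i (x :: real ^ 'n::finite). norm x)"
proof -
  obtain C where C: "C \<ge> 0" "\<forall>U::(real^'n) set. (\<forall>x\<in>U. c \<le> norm x \<and> norm x \<le> D) \<longrightarrow> holder_bd k 1 U C norm"
    using bd_norm[OF assms(1), where k = k and D = D] by (elim exE conjE)
  show ?thesis using C assms(2) by (intro unif_bdI[OF C(1)]) auto
qed

lemma unif_bd_coord:
  assumes "\<And>i x. i \<in> I \<Longrightarrow> x \<in> U i \<Longrightarrow> norm x \<le> D"
  shows "unif_bd k 1 U I (\<lambda>_. 1) (\<lambda>i (x :: real ^ 'n::finite). x $ m)"
  by (rule unif_bdI[of "max 1 D"]) (use assms in \<open>auto intro!: bd_coord intro: le_max_iff_disj[THEN iffD2]\<close>)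

lemma unif_bd_partial:
  assumes "unif_bd (Suc k) \<alpha> U I m f" "\<And>i. i \<in> I \<Longrightarrow> open (U i)"
  shows "unif_bd k \<alpha> U I m (\<lambda>i. partials [l] (f i))"
proof -
  obtain C where C0: "0 \<le> C" "\<forall>i\<in>I. holder_bd (Suc k) \<alpha> (U i) (C * m i) (f i)"
    by (rule unif_bdE[OF assms(1)])
  note C = C0(1) C0(2)[THEN bspec]
  show ?thesis by (rule unif_bdI[OF C(1) bd_partial(1)[OF assms(2) C(2)]])
qed

lemma unif_bd_has_derivative:
  assumes "unif_bd (Suc k) \<alpha> U I m f" "i \<in> I" "open (U i)" "x \<in> U i"
  shows "(f i has_derivative lin_form (\<lambda>l. partials [l] (f i)) x) (at x)"
proof -
  obtain C where C0: "0 \<le> C" "\<forall>i\<in>I. holder_bd (Suc k) \<alpha> (U i) (C * m i) (f i)"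
    by (rule unif_bdE[OF assms(1)])
  note C = C0(1) C0(2)[THEN bspec]
  show ?thesis by (rule differentiable_lin_form[OF bd_partial(2)[OF assms(3) C(2)[OF assms(2)] assms(4)]])
qed

lemma unif_bd_SucI:
  fixes f :: "'i \<Rightarrow> real ^ 'n::finite \<Rightarrow> real"
  assumes U: "\<And>i. i \<in> I \<Longrightarrow> convex (U i)" "\<And>i x y. i \<in> I \<Longrightarrow> x \<in> U i \<Longrightarrow> y \<in> U i \<Longrightarrow> dist x y \<le> 1" and al: "\<alpha> \<le> 1"
    and der: "\<And>i x. i \<in> I \<Longrightarrow> x \<in> U i \<Longrightarrow> (f i has_derivative lin_form (f' i) x) (at x)"
    and bd: "\<And>i x. i \<in> I \<Longrightarrow> x \<in> U i \<Longrightarrow> \<bar>f i x\<bar> \<le> B * m i" "0 \<le> B"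
    and f': "\<And>l. unif_bd k \<alpha> U I m (\<lambda>i. f' i l)" and m: "\<And>i. i \<in> I \<Longrightarrow> 0 \<le> m i"
  shows "unif_bd (Suc k) \<alpha> U I m f"
proof -
  have "\<forall>l. \<exists>C\<ge>0. \<forall>i\<in>I. holder_bd k \<alpha> (U i) (C * m i) (f' i l)" using f' unfolding unif_bd_def by simp
  then obtain C where C: "\<And>l. 0 \<le> C l" "\<And>l i. i \<in> I \<Longrightarrow> holder_bd k \<alpha> (U i) (C l * m i) (f' i l)" by metis
  define D where "D = (\<Sum>l\<in>UNIV. C l)"
  have le: "C l \<le> D" for l unfolding D_def using C(1) by (intro member_le_sum) auto
  have D0: "0 \<le> D" unfolding D_def using C(1) by (intro sum_nonneg) auto
  show ?thesis
  proof (rule unif_bdI[of "B + real CARD('n) * D"])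
    show "0 \<le> B + real CARD('n) * D" using bd(2) D0 by simp
    fix i assume i: "i \<in> I"
    have "holder_bd (Suc k) \<alpha> (U i) (B * m i + real CARD('n) * (D * m i)) (f i)"
    proof (rule bd_SucI[OF U(1)[OF i] U(2)[OF i] al der[OF i] bd(1)[OF i]])
      show "holder_bd k \<alpha> (U i) (D * m i) (f' i l)" for l
        by (rule bd_mono[OF C(2)[OF i] mult_right_mono[OF le m[OF i]]])
    qed (use bd(2) D0 m[OF i] in auto)
    then show "holder_bd (Suc k) \<alpha> (U i) ((B + real CARD('n) * D) * m i) (f i)" by (simp add: algebra_simps)
  qed
qed

lemma unif_bd_bound:
  assumes "unif_bd k \<alpha> U I m f"
  shows "\<exists>C\<ge>0. \<forall>i\<in>I. \<forall>x\<in>U i. \<bar>f i x\<bar> \<le> C * m i"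
proof -
  obtain C where C0: "0 \<le> C" "\<forall>i\<in>I. holder_bd k \<alpha> (U i) (C * m i) (f i)"
    by (rule unif_bdE[OF assms(1)])
  note C = C0(1) C0(2)[THEN bspec]
  show ?thesis using bd_hold0[OF C(2)] C(1) unfolding hold0_def by blast
qed

lemma unif_bd_cont:
  assumes "unif_bd k \<alpha> U I m f" "i \<in> I"
  shows "continuous_on (U i) (f i)"
  using assms bd_hold0 unfolding hold0_def unif_bd_def by blast

section \<open>Lipschitz bounds, integrals and differences of composites\<close>

lemma dist_le_components:
  fixes x y :: "real ^ 'n::finite"
  assumes "\<And>m. \<bar>x $ m - y $ m\<bar> \<le> c"
  shows "dist x y \<le> real CARD('n) * c"
proof -
  have "dist x y \<le> (\<Sum>m\<in>UNIV. \<bar>(x - y) $ m\<bar>)" unfolding dist_norm by (rule norm_le_l1_cart)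
  also have "\<dots> \<le> (\<Sum>m\<in>(UNIV::'n set). c)" using assms by (intro sum_mono) simp
  finally show ?thesis by simp
qed

lemma unif_bd_vec_holder:
  fixes d :: "'i \<Rightarrow> real ^ 'n::finite \<Rightarrow> real ^ 'm::finite"
  assumes "\<And>m. unif_bd k \<gamma> U I (\<lambda>_. 1) (\<lambda>i x. d i x $ m)"
  shows "\<exists>L\<ge>0. \<forall>i\<in>I. \<forall>x\<in>U i. \<forall>y\<in>U i. dist (d i x) (d i y) \<le> L * dist x y powr \<gamma>"
proof -
  obtain C where C: "0 \<le> C" "\<forall>m. \<forall>i\<in>I. holder_bd k \<gamma> (U i) C (\<lambda>x. d i x $ m)" using unif_bd_common[where f = "\<lambda>m i x. d i x $ m", OF assms] by (elim exE conjE)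
  show ?thesis
  proof (intro exI[of _ "real CARD('m) * C"] conjI ballI)
    fix i x y assume i: "i \<in> I" "x \<in> U i" "y \<in> U i"
    have "\<bar>d i x $ m - d i y $ m\<bar> \<le> C * dist x y powr \<gamma>" for m
      using bd_hold0[OF C(2)[rule_format, OF i(1)]] i(2,3) unfolding hold0_def by blast
    from dist_le_components[OF this] show "dist (d i x) (d i y) \<le> real CARD('m) * C * dist x y powr \<gamma>" by (simp add: mult.assoc)
  qed (use C in simp)
qed

lemma unif_bd_Suc_lipschitz:
  fixes d :: "'i \<Rightarrow> real ^ 'n::finite \<Rightarrow> real ^ 'm::finite"
  assumes "\<And>m. unif_bd (Suc k) \<alpha> U I (\<lambda>_. 1) (\<lambda>i x. d i x $ m)" "\<And>i. i \<in> I \<Longrightarrow> convex (U i)"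
  shows "\<exists>L\<ge>0. \<forall>i\<in>I. \<forall>x\<in>U i. \<forall>y\<in>U i. dist (d i x) (d i y) \<le> L * dist x y powr 1"
proof -
  obtain C where C: "0 \<le> C" "\<forall>m. \<forall>i\<in>I. holder_bd (Suc k) \<alpha> (U i) C (\<lambda>x. d i x $ m)" using unif_bd_common[where f = "\<lambda>m i x. d i x $ m", OF assms(1)] by (elim exE conjE)
  show ?thesis
  proof (intro exI[of _ "real CARD('m) * (real CARD('n) * C)"] conjI ballI)
    fix i x y assume i: "i \<in> I" "x \<in> U i" "y \<in> U i"
    have "\<bar>d i x $ m - d i y $ m\<bar> \<le> real CARD('n) * C * dist x y" for m
      by (rule bd_lipschitz[OF assms(2)[OF i(1)] C(2)[rule_format, OF i(1)] i(2,3)])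
    from dist_le_components[OF this] show "dist (d i x) (d i y) \<le> real CARD('m) * (real CARD('n) * C) * dist x y powr 1" by (simp add: mult.assoc)
  qed (use C in simp)
qed

text \<open>With pairs (j, w) as indices the weight is the only trace of w in the bound, so its
  integral alone decides the bound for the integrated family.\<close>

lemma unif_bd_integral:
  fixes f :: "'j \<times> 'a \<Rightarrow> real ^ 'n::finite \<Rightarrow> real"
  assumes f: "unif_bd k \<alpha> (\<lambda>(j, w). U j) {(j, w). j \<in> J \<and> w \<in> space (\<nu> j)} m f"
    and U: "\<And>j. j \<in> J \<Longrightarrow> open (U j)"
    and meas: "\<And>j x. j \<in> J \<Longrightarrow> x \<in> U j \<Longrightarrow> (\<lambda>w. f (j, w) x) \<in> borel_measurable (\<nu> j)"
    and int: "\<And>j. j \<in> J \<Longrightarrow> integrable (\<nu> j) (\<lambda>w. m (j, w))" "\<And>j. j \<in> J \<Longrightarrow> (\<integral>w. m (j, w) \<partial>\<nu> j) \<le> M j"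
  shows "unif_bd k \<alpha> U J M (\<lambda>j x. \<integral>w. f (j, w) x \<partial>\<nu> j)"
proof -
  obtain C where C0: "0 \<le> C" "\<forall>i\<in>{(j, w). j \<in> J \<and> w \<in> space (\<nu> j)}. holder_bd k \<alpha> ((\<lambda>(j, w). U j) i) (C * m i) (f i)"
    by (rule unif_bdE[OF f])
  note C = C0(1) C0(2)[THEN bspec]
  show ?thesis
  proof (rule unif_bdI[OF C(1)])
    fix j assume j: "j \<in> J"
    have "holder_bd k \<alpha> (U j) (\<integral>w. C * m (j, w) \<partial>\<nu> j) (\<lambda>x. \<integral>w. f (j, w) x \<partial>\<nu> j)"
    proof (rule bd_integral[OF U[OF j]])
      show "integrable (\<nu> j) (\<lambda>w. C * m (j, w))" using int(1)[OF j] by simp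
      show "holder_bd k \<alpha> (U j) (C * m (j, w)) (f (j, w))" if "w \<in> space (\<nu> j)" for w using C(2)[of "(j, w)"] j that by simp
    qed (rule meas[OF j])
    moreover have "(\<integral>w. C * m (j, w) \<partial>\<nu> j) \<le> C * M j" using int(2)[OF j] C(1) by (simp add: mult_left_mono)
    ultimately show "holder_bd k \<alpha> (U j) (C * M j) (\<lambda>x. \<integral>w. f (j, w) x \<partial>\<nu> j)" by (rule bd_mono)
  qed
qed

text \<open>The mean value formula \<open>g(\<sigma>) - g(\<tau>) = \<integral>\<^sub>0\<^sup>1 \<nabla>g(\<tau> + t(\<sigma> - \<tau>)) \<bullet> (\<sigma> - \<tau>) dt\<close>
  gains the full factor \<open>\<sigma> - \<tau>\<close> at the price of one derivative of \<open>g\<close>.\<close>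

lemma unif_bd_compose_diff:
  fixes \<sigma> \<tau> :: "'i \<Rightarrow> real ^ 'n::finite \<Rightarrow> real ^ 'm::finite"
  assumes g: "unif_bd (Suc k) \<alpha> V I (\<lambda>_. 1) g"
    and \<tau>: "\<And>m. unif_bd k \<alpha> U I (\<lambda>_. 1) (\<lambda>i x. \<tau> i x $ m)"
    and \<sigma>\<tau>: "\<And>m. unif_bd k \<alpha> U I r (\<lambda>i x. \<sigma> i x $ m - \<tau> i x $ m)" and r: "\<And>i. i \<in> I \<Longrightarrow> 0 \<le> r i \<and> r i \<le> B" "0 \<le> B"
    and lip: "0 \<le> L" "\<And>i x y. i \<in> I \<Longrightarrow> x \<in> U i \<Longrightarrow> y \<in> U i \<Longrightarrow> dist (\<tau> i x) (\<tau> i y) \<le> L * dist x y"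
       "\<And>i x y. i \<in> I \<Longrightarrow> x \<in> U i \<Longrightarrow> y \<in> U i \<Longrightarrow> dist (\<sigma> i x) (\<sigma> i y) \<le> L * dist x y"
    and seg: "\<And>i x t. i \<in> I \<Longrightarrow> x \<in> U i \<Longrightarrow> 0 \<le> t \<Longrightarrow> t \<le> 1 \<Longrightarrow> \<tau> i x + t *\<^sub>R (\<sigma> i x - \<tau> i x) \<in> V i"
    and op: "\<And>i. i \<in> I \<Longrightarrow> open (V i)" "\<And>i. i \<in> I \<Longrightarrow> open (U i)" and al: "0 \<le> \<alpha>"
  shows "unif_bd k \<alpha> U I r (\<lambda>i x. g i (\<sigma> i x) - g i (\<tau> i x))"
proof -
  let ?T = "{0..1::real}"
  let ?\<nu> = "restrict_space lborel ?T"
  let ?J = "{(j, t). j \<in> I \<and> t \<in> space ?\<nu>}"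
  \<comment> \<open>The parameter t joins the index, so the segment from \<tau> to \<sigma> is one
    more uniformly bounded family and the integral over t falls under
    \<open>unif_bd_integral\<close>.\<close>
  define \<gamma> where "\<gamma> = (\<lambda>(i, t::real) x. \<tau> i x + t *\<^sub>R (\<sigma> i x - \<tau> i x))"
  define f where "f = (\<lambda>p x. \<Sum>l\<in>UNIV. partials [l] (g (fst p)) (\<gamma> p x) * (\<sigma> (fst p) x $ l - \<tau> (fst p) x $ l))"
  have sp: "space ?\<nu> = ?T" by (simp add: space_restrict_space)
  have lift: "unif_bd k \<alpha> (\<lambda>(j, t). W j) ?J (\<lambda>p. w (fst p)) (\<lambda>p. h (fst p))" if "unif_bd k \<alpha> W I w h"
    for W :: "'i \<Rightarrow> (real ^ 'k::finite) set" and w :: "'i \<Rightarrow> real" and h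
    using that unfolding unif_bd_def by fastforce
  have \<gamma>b: "unif_bd k \<alpha> (\<lambda>(j, t). U j) ?J (\<lambda>_. 1) (\<lambda>p x. \<gamma> p x $ m)" for m
  proof -
    have "unif_bd k \<alpha> (\<lambda>(j, t). U j) ?J (\<lambda>p. \<bar>snd p\<bar> * r (fst p)) (\<lambda>p x. snd p * (\<sigma> (fst p) x $ m - \<tau> (fst p) x $ m))"
      by (rule unif_bd_scale[OF lift[OF \<sigma>\<tau>]])
    then have "unif_bd k \<alpha> (\<lambda>(j, t). U j) ?J (\<lambda>_. 1) (\<lambda>p x. snd p * (\<sigma> (fst p) x $ m - \<tau> (fst p) x $ m))"
    proof (rule unif_bd_weight[OF _ r(2)])
      fix p assume "p \<in> ?J"
      then have "fst p \<in> I" "0 \<le> snd p" "snd p \<le> 1" unfolding sp by auto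
      then have "\<bar>snd p\<bar> * r (fst p) \<le> 1 * B" using r(1)[of "fst p"] by (intro mult_mono) auto
      then show "\<bar>snd p\<bar> * r (fst p) \<le> B * 1" by simp
    qed
    from unif_bd_add[OF lift[OF \<tau>, of m] this] show ?thesis by (simp add: \<gamma>_def case_prod_unfold)
  qed
  \<comment> \<open>Both coefficients of the convex combination are at most 1, hence 2 * L.\<close>
  have \<gamma>l: "dist (\<gamma> p x) (\<gamma> p y) \<le> (2 * L) * dist x y powr 1" if "p \<in> ?J" "x \<in> U (fst p)" "y \<in> U (fst p)" for p x y
  proof -
    have i: "fst p \<in> I" "0 \<le> snd p" "snd p \<le> 1" using that(1) unfolding sp by auto
    have "\<gamma> p x - \<gamma> p y = (1 - snd p) *\<^sub>R (\<tau> (fst p) x - \<tau> (fst p) y) + snd p *\<^sub>R (\<sigma> (fst p) x - \<sigma> (fst p) y)"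
      by (simp add: \<gamma>_def case_prod_unfold algebra_simps)
    then have "dist (\<gamma> p x) (\<gamma> p y) \<le> norm ((1 - snd p) *\<^sub>R (\<tau> (fst p) x - \<tau> (fst p) y)) + norm (snd p *\<^sub>R (\<sigma> (fst p) x - \<sigma> (fst p) y))"
      unfolding dist_norm by (metis norm_triangle_ineq)
    also have "\<dots> \<le> 1 * (L * dist x y) + 1 * (L * dist x y)"
      using i lip(2,3)[OF i(1) that(2,3)] lip(1) unfolding norm_scaleR dist_norm by (intro add_mono mult_mono) auto
    finally show ?thesis by simp
  qed
  have fb: "unif_bd k \<alpha> (\<lambda>(j, t). U j) ?J (\<lambda>p. 1 * r (fst p)) f"
    unfolding f_def
  proof (rule unif_bd_sum)
    fix l
    have "unif_bd k \<alpha> (\<lambda>(j, t). V j) ?J (\<lambda>_. 1) (\<lambda>p. partials [l] (g (fst p)))"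
      by (rule lift[OF unif_bd_partial[OF g op(1)]])
    from unif_bd_compose[OF this, where \<gamma> = 1 and d = \<gamma> and L = "2 * L" and U = "\<lambda>(j, t). U j"]
    have "unif_bd k \<alpha> (\<lambda>(j, t). U j) ?J (\<lambda>_. 1) (\<lambda>p x. partials [l] (g (fst p)) (\<gamma> p x))"
      using \<gamma>b \<gamma>l lip(1) al seg unfolding sp by (force simp: \<gamma>_def simp del: partials.simps)
    then show "unif_bd k \<alpha> (\<lambda>(j, t). U j) ?J (\<lambda>p. 1 * r (fst p))
       (\<lambda>p x. partials [l] (g (fst p)) (\<gamma> p x) * (\<sigma> (fst p) x $ l - \<tau> (fst p) x $ l))"
      by (rule unif_bd_mult[OF _ lift[OF \<sigma>\<tau>]]) (use r in auto)
  qed (use r in auto)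
  have cont: "continuous_on ?T (\<lambda>t. f (i, t) x)" if "i \<in> I" "x \<in> U i" for i x
  proof -
    have c: "continuous_on (V i) (partials [l] (g i))" for l by (rule unif_bd_cont[OF unif_bd_partial[OF g op(1)] that(1)])
    have "continuous_on ?T (\<lambda>t. partials [l] (g i) (\<tau> i x + t *\<^sub>R (\<sigma> i x - \<tau> i x)))" for l
      by (rule continuous_on_compose2[OF c]) (use seg[OF that] in \<open>auto intro!: continuous_intros\<close>)
    then show ?thesis unfolding f_def \<gamma>_def by (auto intro!: continuous_intros simp del: partials.simps)
  qed
  have I: "unif_bd k \<alpha> U I r (\<lambda>i x. \<integral>t. f (i, t) x \<partial>?\<nu>)"
  proof (rule unif_bd_integral[OF fb])
    show "(\<lambda>t. f (i, t) x) \<in> borel_measurable ?\<nu>" if "i \<in> I" "x \<in> U i" for i x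
      using borel_measurable_continuous_on_restrict[OF cont[OF that]]
      by (simp add: measurable_cong_sets[OF sets_restrict_space_cong[OF sets_lborel] refl])
    have fin: "emeasure ?\<nu> (space ?\<nu>) = 1" unfolding sp by (simp add: emeasure_restrict_space)
    interpret finite_measure ?\<nu> by (rule finite_measureI) (unfold fin, simp)
    show "integrable ?\<nu> (\<lambda>t. 1 * r (fst (i, t)))" for i by simp
    have "measure ?\<nu> (space ?\<nu>) = 1" using fin by (simp add: measure_def)
    then show "(\<integral>t. 1 * r (fst (i, t)) \<partial>?\<nu>) \<le> r i" for i by simp
  qed (rule op(2))
  show ?thesis
  proof (rule unif_bd_cong[OF I op(2)])
    fix i x assume i: "i \<in> I" "x \<in> U i"
    have "(\<integral>t. f (i, t) x \<partial>?\<nu>) = (\<integral>t. indicator ?T t *\<^sub>R f (i, t) x \<partial>lborel)"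
      by (subst integral_restrict_space) auto
    also have "\<dots> = g i (\<tau> i x + 1 *\<^sub>R (\<sigma> i x - \<tau> i x)) - g i (\<tau> i x + 0 *\<^sub>R (\<sigma> i x - \<tau> i x))"
    proof (rule integral_FTC_Icc)
      fix t :: real assume t: "0 \<le> t" "t \<le> 1"
      let ?y = "\<tau> i x + t *\<^sub>R (\<sigma> i x - \<tau> i x)"
      have D: "(g i has_derivative lin_form (\<lambda>l. partials [l] (g i)) ?y) (at ?y)"
        by (rule unif_bd_has_derivative[OF g i(1) op(1)[OF i(1)] seg[OF i t]])
      have 0: "((\<lambda>t. \<tau> i x + t *\<^sub>R (\<sigma> i x - \<tau> i x)) has_derivative (\<lambda>s. s *\<^sub>R (\<sigma> i x - \<tau> i x))) (at t)"
        by (auto intro!: derivative_eq_intros)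
      have "((\<lambda>t. g i (\<tau> i x + t *\<^sub>R (\<sigma> i x - \<tau> i x))) has_derivative
          (\<lambda>s. lin_form (\<lambda>l. partials [l] (g i)) ?y (s *\<^sub>R (\<sigma> i x - \<tau> i x)))) (at t)"
        by (rule has_derivative_compose[OF 0 D])
      moreover have "(\<lambda>s. lin_form (\<lambda>l. partials [l] (g i)) ?y (s *\<^sub>R (\<sigma> i x - \<tau> i x))) = (*) (f (i, t) x)"
        by (rule ext) (simp add: f_def \<gamma>_def sum_distrib_right sum_distrib_left mult_ac del: partials.simps)
      ultimately have "((\<lambda>t. g i (\<tau> i x + t *\<^sub>R (\<sigma> i x - \<tau> i x))) has_real_derivative f (i, t) x) (at t)"
        unfolding has_field_derivative_def by simp
      then show "((\<lambda>t. g i (\<tau> i x + t *\<^sub>R (\<sigma> i x - \<tau> i x))) has_vector_derivative f (i, t) x) (at t within ?T)"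
        unfolding has_real_derivative_iff_has_vector_derivative by (rule has_vector_derivative_at_within)
    qed (use cont[OF i] in auto)
    finally show "(\<integral>t. f (i, t) x \<partial>?\<nu>) = g i (\<sigma> i x) - g i (\<tau> i x)" by simp
  qed
qed

text \<open>In contrast to \<open>unif_bd_SucI\<close> the Hoelder bound of order 0 is supplied, so
  neither convexity nor a bound on the diameter of U is asked for.\<close>

lemma unif_bd_Suc_intro:
  fixes f :: "'i \<Rightarrow> real ^ 'n::finite \<Rightarrow> real"
  assumes f: "unif_bd 0 \<alpha> U I m f"
    and der: "\<And>i x. i \<in> I \<Longrightarrow> x \<in> U i \<Longrightarrow> (f i has_derivative lin_form (f' i) x) (at x)"
    and f': "\<And>l. unif_bd k \<alpha> U I m (\<lambda>i. f' i l)" and m: "\<And>i. i \<in> I \<Longrightarrow> 0 \<le> m i"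
  shows "unif_bd (Suc k) \<alpha> U I m f"
proof -
  have "\<forall>l. \<exists>C\<ge>0. \<forall>i\<in>I. holder_bd k \<alpha> (U i) (C * m i) (f' i l)" using f' unfolding unif_bd_def by simp
  then obtain C where C: "\<And>l. 0 \<le> C l" "\<And>l i. i \<in> I \<Longrightarrow> holder_bd k \<alpha> (U i) (C l * m i) (f' i l)" by metis
  obtain B where B: "0 \<le> B" "\<forall>i\<in>I. holder_bd 0 \<alpha> (U i) (B * m i) (f i)" by (rule unif_bdE[OF f])
  define D where "D = B + (\<Sum>l\<in>UNIV. C l)"
  have "C l \<le> (\<Sum>l\<in>UNIV. C l)" for l using C(1) by (intro member_le_sum) auto
  then have le: "C l \<le> D" for l unfolding D_def using B(1) by (simp add: add_increasing)
  have BD: "B \<le> D" unfolding D_def using C(1) by (simp add: sum_nonneg)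
  show ?thesis
  proof (rule unif_bdI[of D])
    show "0 \<le> D" using BD B(1) by simp
    fix i assume i: "i \<in> I"
    show "holder_bd (Suc k) \<alpha> (U i) (D * m i) (f i)"
    proof (rule bd_Suc_intro[OF _ der[OF i]])
      show "hold0 \<alpha> (U i) (D * m i) (f i)"
        by (rule hold0_mono[OF B(2)[THEN bspec, OF i, unfolded holder_bd.simps] mult_right_mono[OF BD m[OF i]]])
      show "holder_bd k \<alpha> (U i) (D * m i) (f' i l)" for l
        by (rule bd_mono[OF C(2)[OF i] mult_right_mono[OF le m[OF i]]])
    qed
  qed
qed

text \<open>A quantity below both p powr \<alpha> and q powr \<alpha> is below the smaller one,
  hence below every product of powers of p and q with exponents adding up to \<alpha>.\<close>

lemma min_powr_interp:
  fixes p q \<alpha> \<alpha>' t c :: real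
  assumes "0 \<le> p" "0 \<le> q" "0 \<le> \<alpha>'" "\<alpha>' \<le> \<alpha>" "t \<le> c * p powr \<alpha>" "t \<le> c * q powr \<alpha>" "0 \<le> c"
  shows "t \<le> c * (p powr (\<alpha> - \<alpha>') * q powr \<alpha>')"
proof (cases "p \<le> q")
  case True
  have "p powr \<alpha> = p powr (\<alpha> - \<alpha>') * p powr \<alpha>'" by (simp add: powr_add[symmetric])
  also have "\<dots> \<le> p powr (\<alpha> - \<alpha>') * q powr \<alpha>'" using True assms by (intro mult_left_mono powr_mono2) auto
  finally show ?thesis using assms by (meson mult_left_mono order_trans)
next
  case False
  have "q powr \<alpha> = q powr (\<alpha> - \<alpha>') * q powr \<alpha>'" by (simp add: powr_add[symmetric])
  also have "\<dots> \<le> p powr (\<alpha> - \<alpha>') * q powr \<alpha>'" using False assms by (intro mult_right_mono powr_mono2) auto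
  finally show ?thesis using assms by (meson mult_left_mono order_trans)
qed

lemma weight_powr_le:
  fixes r B \<theta> :: real
  assumes "0 \<le> r" "r \<le> B" "\<theta> \<le> 1"
  shows "r \<le> B powr (1 - \<theta>) * r powr \<theta>"
proof -
  have "r = r powr (1 - \<theta>) * r powr \<theta>" using assms by (simp add: powr_add[symmetric])
  also have "\<dots> \<le> B powr (1 - \<theta>) * r powr \<theta>" using assms by (intro mult_right_mono powr_mono2) auto
  finally show ?thesis .
qed

text \<open>Without a derivative to spare, \<open>g(\<sigma>) - g(\<tau>)\<close> is only \<open>O(r\<^sup>\<alpha>)\<close>; interpolating with
  the Hoelder bound trades decay in \<open>r\<close> for Hoelder regularity.\<close>

lemma unif_bd_compose_interp:
  fixes \<sigma> \<tau> :: "'i \<Rightarrow> real ^ 'n::finite \<Rightarrow> real ^ 'm::finite"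
  assumes g: "unif_bd k \<alpha> V I (\<lambda>_. 1) g" and al: "0 \<le> \<alpha>'" "\<alpha>' \<le> \<alpha>" "\<alpha> \<le> 1"
    and \<sigma>: "\<And>m. unif_bd k \<alpha>' U I (\<lambda>_. 1) (\<lambda>i x. \<sigma> i x $ m)"
    and \<tau>: "\<And>m. unif_bd k \<alpha> U I (\<lambda>_. 1) (\<lambda>i x. \<tau> i x $ m)"
    and \<sigma>\<tau>: "\<And>m. unif_bd k \<alpha>' U I r (\<lambda>i x. \<sigma> i x $ m - \<tau> i x $ m)" and r: "\<And>i. i \<in> I \<Longrightarrow> 0 \<le> r i \<and> r i \<le> B"
    and lip: "0 \<le> L" "\<And>i x y. i \<in> I \<Longrightarrow> x \<in> U i \<Longrightarrow> y \<in> U i \<Longrightarrow> dist (\<tau> i x) (\<tau> i y) \<le> L * dist x y"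
       "\<And>i x y. i \<in> I \<Longrightarrow> x \<in> U i \<Longrightarrow> y \<in> U i \<Longrightarrow> dist (\<sigma> i x) (\<sigma> i y) \<le> L * dist x y"
    and im: "\<And>i x. i \<in> I \<Longrightarrow> x \<in> U i \<Longrightarrow> \<sigma> i x \<in> V i" "\<And>i x. i \<in> I \<Longrightarrow> x \<in> U i \<Longrightarrow> \<tau> i x \<in> V i"
    and op: "\<And>i. i \<in> I \<Longrightarrow> open (V i)" "\<And>i. i \<in> I \<Longrightarrow> open (U i)"
    and diam: "\<And>i x y. i \<in> I \<Longrightarrow> x \<in> U i \<Longrightarrow> y \<in> U i \<Longrightarrow> dist x y \<le> 1"
  shows "unif_bd k \<alpha>' U I (\<lambda>i. r i powr (\<alpha> - \<alpha>')) (\<lambda>i x. g i (\<sigma> i x) - g i (\<tau> i x))"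
proof -
  \<comment> \<open>Stated for all k and g, because the induction below replaces g by its partial
    derivatives.\<close>
  have level0: "unif_bd 0 \<alpha>' U I (\<lambda>i. r i powr (\<alpha> - \<alpha>')) (\<lambda>i x. g i (\<sigma> i x) - g i (\<tau> i x))"
    if g: "unif_bd k \<alpha> V I (\<lambda>_. 1) g" and \<sigma>\<tau>: "\<And>m. unif_bd k \<alpha>' U I r (\<lambda>i x. \<sigma> i x $ m - \<tau> i x $ m)" for k g
  proof -
    obtain N where N: "0 \<le> N" "\<forall>i\<in>I. holder_bd k \<alpha> (V i) (N * 1) (g i)" by (rule unif_bdE[OF g])
    have gh: "\<bar>g i u - g i v\<bar> \<le> N * dist u v powr \<alpha>" if "i \<in> I" "u \<in> V i" "v \<in> V i" for i u v
      using bd_hold0[OF bspec[OF N(2) that(1)]] that(2,3) unfolding hold0_def by simp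
    have "\<forall>m. \<exists>C\<ge>0. \<forall>i\<in>I. \<forall>x\<in>U i. \<bar>\<sigma> i x $ m - \<tau> i x $ m\<bar> \<le> C * r i"
      using unif_bd_bound[OF \<sigma>\<tau>] by simp
    then obtain C where C: "\<And>m. 0 \<le> C m" "\<And>m i x. i \<in> I \<Longrightarrow> x \<in> U i \<Longrightarrow> \<bar>\<sigma> i x $ m - \<tau> i x $ m\<bar> \<le> C m * r i" by metis
    have le: "C m \<le> (\<Sum>m\<in>UNIV. C m)" for m using C(1) by (intro member_le_sum) auto
    define D where "D = real CARD('m) * (\<Sum>m\<in>UNIV. C m)"
    have D0: "0 \<le> D" unfolding D_def using C(1) by (simp add: sum_nonneg)
    have st: "dist (\<sigma> i x) (\<tau> i x) \<le> D * r i" if "i \<in> I" "x \<in> U i" for i x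
    proof -
      have "\<bar>\<sigma> i x $ m - \<tau> i x $ m\<bar> \<le> (\<Sum>m\<in>UNIV. C m) * r i" for m
        by (rule order_trans[OF C(2)[OF that] mult_right_mono[OF le]]) (use r that in auto)
      from dist_le_components[OF this] show ?thesis unfolding D_def by (simp add: mult.assoc)
    qed
    \<comment> \<open>The first summand is for the size, with the surplus r powr \<alpha>' absorbed
      by B; the second is for the Hoelder bound.\<close>
    let ?C = "N * D powr \<alpha> * B powr \<alpha>' + 2 * N * D powr (\<alpha> - \<alpha>') * L powr \<alpha>'"
    show ?thesis
    proof (rule unif_bdI[of ?C])
      show "0 \<le> ?C" using N(1) by simp
      fix i assume i: "i \<in> I"
      have r0: "0 \<le> r i" "r i \<le> B" using r i by auto
      have small: "\<bar>g i (\<sigma> i x) - g i (\<tau> i x)\<bar> \<le> N * (D * r i) powr \<alpha>" if "x \<in> U i" for x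
        by (rule order_trans[OF gh[OF i im(1)[OF i that] im(2)[OF i that]] mult_left_mono[OF powr_mono2[OF _ _ st[OF i that]]]])
          (use N al in auto)
      show "holder_bd 0 \<alpha>' (U i) (?C * r i powr (\<alpha> - \<alpha>')) (\<lambda>x. g i (\<sigma> i x) - g i (\<tau> i x))"
        unfolding holder_bd.simps hold0_def
      proof (intro conjI ballI)
        have cg: "continuous_on (V i) (g i)" using unif_bd_cont[OF g i] .
        have lc: "continuous_on (U i) h" if "\<And>x y. x \<in> U i \<Longrightarrow> y \<in> U i \<Longrightarrow> dist (h x) (h y) \<le> L * dist x y" for h :: "real^'n \<Rightarrow> real^'m"
          using that lip(1) by (intro lipschitz_on_continuous_on[of L]) (auto simp: lipschitz_on_def)
        show "continuous_on (U i) (\<lambda>x. g i (\<sigma> i x) - g i (\<tau> i x))"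
          by (intro continuous_on_diff continuous_on_compose2[OF cg] lc lip(2,3)[OF i])
            (use im[OF i] in auto)
        fix x assume x: "x \<in> U i"
        have "N * (D * r i) powr \<alpha> = N * D powr \<alpha> * (r i powr \<alpha>' * r i powr (\<alpha> - \<alpha>'))"
          using D0 r0 by (simp add: powr_mult powr_add[symmetric])
        also have "\<dots> \<le> N * D powr \<alpha> * (B powr \<alpha>' * r i powr (\<alpha> - \<alpha>'))"
          using N r0 al by (intro mult_left_mono mult_right_mono powr_mono2) auto
        also have "\<dots> \<le> ?C * r i powr (\<alpha> - \<alpha>')" using N(1) by (simp add: algebra_simps)
        finally show "\<bar>g i (\<sigma> i x) - g i (\<tau> i x)\<bar> \<le> ?C * r i powr (\<alpha> - \<alpha>')" using small[OF x] by linarith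
        fix y assume y: "y \<in> U i"
        \<comment> \<open>The increment is small for two reasons, because \<sigma> is close to
          \<tau> and because x is close to y; the two bounds are then interpolated.\<close>
        let ?t = "\<bar>(g i (\<sigma> i x) - g i (\<tau> i x)) - (g i (\<sigma> i y) - g i (\<tau> i y))\<bar>"
        have 1: "?t \<le> 2 * N * (D * r i) powr \<alpha>" using small[OF x] small[OF y] by linarith
        have "\<bar>g i (\<sigma> i x) - g i (\<sigma> i y)\<bar> \<le> N * (L * dist x y) powr \<alpha>"
          by (rule order_trans[OF gh[OF i im(1)[OF i x] im(1)[OF i y]] mult_left_mono[OF powr_mono2[OF _ _ lip(3)[OF i x y]]]])
            (use N al in auto)
        moreover have "\<bar>g i (\<tau> i x) - g i (\<tau> i y)\<bar> \<le> N * (L * dist x y) powr \<alpha>"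
          by (rule order_trans[OF gh[OF i im(2)[OF i x] im(2)[OF i y]] mult_left_mono[OF powr_mono2[OF _ _ lip(2)[OF i x y]]]])
            (use N al in auto)
        ultimately have 2: "?t \<le> 2 * N * (L * dist x y) powr \<alpha>" by linarith
        have "?t \<le> 2 * N * ((D * r i) powr (\<alpha> - \<alpha>') * (L * dist x y) powr \<alpha>')"
          by (rule min_powr_interp[OF _ _ al(1,2) 1 2]) (use D0 r0 lip N in auto)
        also have "\<dots> = 2 * N * D powr (\<alpha> - \<alpha>') * L powr \<alpha>' * r i powr (\<alpha> - \<alpha>') * dist x y powr \<alpha>'"
          using D0 r0 lip(1) by (simp add: powr_mult)
        also have "\<dots> \<le> ?C * r i powr (\<alpha> - \<alpha>') * dist x y powr \<alpha>'"
          using N(1) by (intro mult_right_mono) auto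
        finally show "?t \<le> ?C * r i powr (\<alpha> - \<alpha>') * dist x y powr \<alpha>'" .
      qed
    qed
  qed
  have w: "unif_bd k \<alpha>' U I (\<lambda>i. r i powr (\<alpha> - \<alpha>')) f" if "unif_bd k \<alpha>' U I r f" for k f
    by (rule unif_bd_weight[OF that, of "B powr (1 - (\<alpha> - \<alpha>'))"]) (use r al in \<open>auto intro!: weight_powr_le\<close>)
  show ?thesis using g \<sigma> \<tau> \<sigma>\<tau>
  proof (induction k arbitrary: g)
    case 0
    then show ?case by (intro level0)
  next
    case (Suc k)
    let ?\<kappa> = "\<lambda>l i x. \<sigma> i x $ l - \<tau> i x $ l"
    \<comment> \<open>The chain rule, telescoped as (\<nabla>g(\<sigma>) - \<nabla>g(\<tau>))
      \<partial>\<sigma> + \<nabla>g(\<tau>) \<partial>(\<sigma> - \<tau>). The first term is the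
      induction hypothesis for the partial derivatives of g; in the second the difference brings the
      full weight r.\<close>
    let ?f' = "\<lambda>i j x. \<Sum>l\<in>UNIV. (partials [l] (g i) (\<sigma> i x) - partials [l] (g i) (\<tau> i x)) * partials [j] (\<lambda>x. \<sigma> i x $ l) x
        + partials [l] (g i) (\<tau> i x) * partials [j] (?\<kappa> l i) x"
    have rp: "0 \<le> r i powr (\<alpha> - \<alpha>')" for i by simp
    show ?case
    proof (rule unif_bd_Suc_intro[OF level0[OF Suc.prems(1,4)], where f' = ?f'])
      fix i x assume i: "i \<in> I" "x \<in> U i"
      have ds: "((\<lambda>x. \<sigma> i x $ l) has_derivative lin_form (\<lambda>j. partials [j] (\<lambda>x. \<sigma> i x $ l)) x) (at x)" for l
        by (rule unif_bd_has_derivative[OF Suc.prems(2) i(1) op(2)[OF i(1)] i(2)])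
      have dk: "(?\<kappa> l i has_derivative lin_form (\<lambda>j. partials [j] (?\<kappa> l i)) x) (at x)" for l
        by (rule unif_bd_has_derivative[OF Suc.prems(4) i(1) op(2)[OF i(1)] i(2)])
      have dt: "((\<lambda>x. \<tau> i x $ l) has_derivative lin_form (\<lambda>j x. partials [j] (\<lambda>x. \<sigma> i x $ l) x - partials [j] (?\<kappa> l i) x) x) (at x)" for l
        using has_derivative_diff[OF ds[of l] dk[of l]] by (simp add: sum_subtractf[symmetric] left_diff_distrib del: partials.simps)
      have dg: "(g i has_derivative lin_form (\<lambda>j. partials [j] (g i)) y) (at y)" if "y \<in> V i" for y
        by (rule unif_bd_has_derivative[OF Suc.prems(1) i(1) op(1)[OF i(1)] that])
      have c1: "((\<lambda>x. g i (\<sigma> i x)) has_derivative lin_form (\<lambda>j x. \<Sum>l\<in>UNIV. partials [l] (g i) (\<sigma> i x) * partials [j] (\<lambda>x. \<sigma> i x $ l) x) x) (at x)"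
        by (rule compose_form[of "\<sigma> i" "\<lambda>l j. partials [j] (\<lambda>x. \<sigma> i x $ l)" x "g i" "\<lambda>j. partials [j] (g i)", OF ds dg[OF im(1)[OF i]]])
      have c2: "((\<lambda>x. g i (\<tau> i x)) has_derivative lin_form (\<lambda>j x. \<Sum>l\<in>UNIV. partials [l] (g i) (\<tau> i x) * (partials [j] (\<lambda>x. \<sigma> i x $ l) x - partials [j] (?\<kappa> l i) x)) x) (at x)"
        by (rule compose_form[of "\<tau> i" "\<lambda>l j x. partials [j] (\<lambda>x. \<sigma> i x $ l) x - partials [j] (?\<kappa> l i) x" x "g i" "\<lambda>j. partials [j] (g i)", OF dt dg[OF im(2)[OF i]]])
      have eq: "(\<Sum>l\<in>UNIV. partials [l] (g i) (\<sigma> i x) * partials [j] (\<lambda>x. \<sigma> i x $ l) x) -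
         (\<Sum>l\<in>UNIV. partials [l] (g i) (\<tau> i x) * (partials [j] (\<lambda>x. \<sigma> i x $ l) x - partials [j] (?\<kappa> l i) x)) = ?f' i j x" for j
        unfolding sum_subtractf[symmetric] by (rule sum.cong[OF refl]) (simp add: algebra_simps del: partials.simps)
      have "(\<lambda>h. lin_form (\<lambda>j x. \<Sum>l\<in>UNIV. partials [l] (g i) (\<sigma> i x) * partials [j] (\<lambda>x. \<sigma> i x $ l) x) x h -
          lin_form (\<lambda>j x. \<Sum>l\<in>UNIV. partials [l] (g i) (\<tau> i x) * (partials [j] (\<lambda>x. \<sigma> i x $ l) x - partials [j] (?\<kappa> l i) x)) x h) = lin_form (?f' i) x"
        by (rule ext, subst sum_subtractf[symmetric], rule sum.cong[OF refl])
          (subst left_diff_distrib[symmetric], subst eq, rule refl)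
      then show "((\<lambda>x. g i (\<sigma> i x) - g i (\<tau> i x)) has_derivative lin_form (?f' i) x) (at x)"
        using has_derivative_diff[OF c1 c2] by (simp only:)
    next
      fix j
      show "unif_bd k \<alpha>' U I (\<lambda>i. r i powr (\<alpha> - \<alpha>')) (\<lambda>i. ?f' i j)"
      proof (intro unif_bd_sum unif_bd_add rp)
        fix l
        have pg: "unif_bd k \<alpha> V I (\<lambda>_. 1) (\<lambda>i. partials [l] (g i))" by (rule unif_bd_partial[OF Suc.prems(1) op(1)])
        have s: "unif_bd k \<alpha>' U I (\<lambda>_. 1) (\<lambda>i x. \<sigma> i x $ m)" and t: "unif_bd k \<alpha> U I (\<lambda>_. 1) (\<lambda>i x. \<tau> i x $ m)"
          and st: "unif_bd k \<alpha>' U I r (\<lambda>i x. \<sigma> i x $ m - \<tau> i x $ m)" for m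
          using Suc.prems(2-4)[THEN unif_bd_le, of k] by auto
        have "unif_bd k \<alpha>' U I (\<lambda>i. r i powr (\<alpha> - \<alpha>')) (\<lambda>i x. partials [l] (g i) (\<sigma> i x) - partials [l] (g i) (\<tau> i x))"
          by (rule Suc.IH[OF pg s t st])
        from unif_bd_mult[OF this unif_bd_partial[OF Suc.prems(2)[of l] op(2), of j]]
        show "unif_bd k \<alpha>' U I (\<lambda>i. r i powr (\<alpha> - \<alpha>')) (\<lambda>i x. (partials [l] (g i) (\<sigma> i x) - partials [l] (g i) (\<tau> i x)) * partials [j] (\<lambda>x. \<sigma> i x $ l) x)"
          by simp
        have lip1: "dist (\<tau> i x) (\<tau> i y) \<le> L * dist x y powr 1" if "i \<in> I" "x \<in> U i" "y \<in> U i" for i x y using lip(2)[OF that] by simp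
        have "unif_bd k (\<alpha> * 1) U I (\<lambda>_. 1) (\<lambda>i x. partials [l] (g i) (\<tau> i x))"
          by (rule unif_bd_compose[OF pg _ lip(1) lip1 im(2)]) (use t al in auto)
        then have "unif_bd k \<alpha> U I (\<lambda>_. 1) (\<lambda>i x. partials [l] (g i) (\<tau> i x))" by (simp only: mult_1_right)
        then have "unif_bd k \<alpha>' U I (\<lambda>_. 1) (\<lambda>i x. partials [l] (g i) (\<tau> i x))"
          by (rule unif_bd_exp[OF _ al(2) diam]) auto
        from unif_bd_mult[OF this w[OF unif_bd_partial[OF Suc.prems(4)[of l] op(2), of j]]]
        show "unif_bd k \<alpha>' U I (\<lambda>i. r i powr (\<alpha> - \<alpha>')) (\<lambda>i x. partials [l] (g i) (\<tau> i x) * partials [j] (?\<kappa> l i) x)"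
          by simp
      qed auto
    qed simp
  qed
qed

section \<open>Rotations\<close>

text \<open>This is the half-turn about the line spanned by p, the bisector of e and x/|x|. Writing
  the inverse of p \<bullet> p as a power makes \<open>unif_bd_powr\<close> applicable, and for p =
  0 the formula becomes w \<mapsto> -w, so the map is a linear isometry for every x.\<close>

definition rot :: "'a::real_inner \<Rightarrow> 'a \<Rightarrow> 'a \<Rightarrow> 'a" where
  "rot e x w = (let p = x /\<^sub>R norm x + e in (2 * (p \<bullet> w) * (p \<bullet> p) powr - 1) *\<^sub>R p - w)"

lemma rot_linear: "linear (rot e x)"
proof -
  have "linear (\<lambda>w. (2 * (p \<bullet> w) * c) *\<^sub>R p - w)" for p :: 'a and c
    by (intro linearI) (simp_all add: inner_add_right algebra_simps)
  then show ?thesis unfolding rot_def Let_def .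
qed

lemma rot_norm: "norm (rot e x w) = norm w"
proof -
  define p where "p = x /\<^sub>R norm x + e"
  define c where "c = 2 * (p \<bullet> w) * (p \<bullet> p) powr - 1"
  have "c * (p \<bullet> p) = 2 * (p \<bullet> w)" if "p \<noteq> 0" using that unfolding c_def by (simp add: powr_minus powr_one)
  then have "c * c * (p \<bullet> p) = 2 * c * (p \<bullet> w)" by (cases "p = 0") auto
  then have "(c *\<^sub>R p - w) \<bullet> (c *\<^sub>R p - w) = w \<bullet> w"
    by (simp add: inner_diff_left inner_diff_right inner_commute algebra_simps)
  then show ?thesis unfolding rot_def Let_def p_def[symmetric] c_def[symmetric] by (simp only: norm_eq)
qed

lemma rot_surj: "surj (rot e (x :: 'a::euclidean_space))"
proof -
  have "inj (rot e x)"
    by (rule linear_injective_0[OF rot_linear, THEN iffD2]) (metis rot_norm norm_eq_zero)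
  then show ?thesis using linear_injective_imp_surjective[OF rot_linear] by blast
qed

lemma rot_diff: "rot e x v - rot e x w = rot e x (v - w)"
  using linear_diff[OF rot_linear] by metis

lemma ball_inner_pos:
  assumes "norm e = 1" "x \<in> ball e (1/2)"
  shows "1 / 2 < norm x" "norm x < 2" "0 < x \<bullet> e"
proof -
  have d: "norm (e - x) < 1/2" using assms by (simp add: dist_norm)
  show "1 / 2 < norm x" "norm x < 2" using d assms(1) norm_triangle_ineq2[of e "e - x"] norm_triangle_ineq2[of x e] norm_minus_commute[of x e] by auto
  have "(e - x) \<bullet> e \<le> norm (e - x) * norm e" by (rule norm_cauchy_schwarz)
  moreover have "e \<bullet> e = 1" using assms(1) by (simp add: norm_eq_1)
  ultimately show "0 < x \<bullet> e" using d assms(1) by (simp add: inner_diff_left)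
qed

text \<open>For unit vectors u and e, both p \<bullet> p and 2 (p \<bullet> e) equal 2 (1 + u
  \<bullet> e), so the coefficient of p is 1. The radius 1/2 keeps u \<bullet> e nonnegative and
  thereby p \<bullet> p away from 0.\<close>

lemma rot_base:
  assumes e: "norm e = 1" and x: "x \<in> ball e (1/2)"
  shows "rot e x e = x /\<^sub>R norm x" and "1 \<le> (x /\<^sub>R norm x + e) \<bullet> (x /\<^sub>R norm x + e)"
proof -
  have x0: "x \<noteq> 0" using ball_inner_pos[OF e x] by auto
  define u where "u = x /\<^sub>R norm x"
  have "norm u = 1" using x0 unfolding u_def by simp
  then have u: "u \<bullet> u = 1" "e \<bullet> e = 1" using e by (simp_all add: norm_eq_1)
  have ue: "0 \<le> u \<bullet> e" unfolding u_def using ball_inner_pos(3)[OF e x] by simp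
  have pp: "(u + e) \<bullet> (u + e) = 2 * (1 + u \<bullet> e)" "(u + e) \<bullet> e = 1 + u \<bullet> e"
    using u by (simp_all add: inner_add_left inner_add_right inner_commute)
  then show "1 \<le> (x /\<^sub>R norm x + e) \<bullet> (x /\<^sub>R norm x + e)" using ue unfolding u_def[symmetric] by simp
  have key: "2 * ((u + e) \<bullet> e) * ((u + e) \<bullet> (u + e)) powr - 1 = 1" unfolding pp using ue by (simp add: powr_minus)
  show "rot e x e = x /\<^sub>R norm x" unfolding rot_def Let_def u_def[symmetric] key by simp
qed

lemma ball_dist_le_1: "x \<in> ball e (1/2) \<Longrightarrow> y \<in> ball e (1/2) \<Longrightarrow> dist x y \<le> 1"
  by (metis dist_triangle_half_r dist_commute mem_ball less_imp_le)

text \<open>Linearity in v makes |v| a weight. Applied to v = w - e this says that the images of w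
  and e differ by O(|w - e|) together with all x-derivatives.\<close>

lemma unif_bd_rot:
  fixes e v :: "'i \<Rightarrow> real ^ 'n::finite"
  assumes e: "\<And>i. i \<in> I \<Longrightarrow> norm (e i) = 1"
  shows "unif_bd k 1 (\<lambda>i. ball (e i) (1/2)) I (\<lambda>i. norm (v i)) (\<lambda>i x. rot (e i) x (v i) $ m)"
proof -
  let ?U = "\<lambda>i. ball (e i) (1/2)"
  let ?p = "\<lambda>i x. x /\<^sub>R norm x + e i"
  have n: "1 / 2 \<le> norm x \<and> norm x \<le> 2" if "i \<in> I" "x \<in> ?U i" for i x
    using ball_inner_pos[OF e[OF that(1)] that(2)] by auto
  have nrm: "unif_bd k 1 ?U I (\<lambda>_. 1) (\<lambda>i x. norm x)" by (rule unif_bd_norm[of "1/2"]) (use n in auto)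
  have inv: "unif_bd k 1 ?U I (\<lambda>_. 1) (\<lambda>i x. norm x powr - 1)" by (rule unif_bd_powr[OF nrm, of "1/2"]) (use n in auto)
  have co: "unif_bd k 1 ?U I (\<lambda>_. 1) (\<lambda>i x. x $ m)" for m by (rule unif_bd_coord[of _ _ 2]) (use n in auto)
  have p: "unif_bd k 1 ?U I (\<lambda>_. 1) (\<lambda>i x. ?p i x $ m)" for m
  proof -
    have "unif_bd k 1 ?U I (\<lambda>_. 1) (\<lambda>i x. e i $ m)"
    proof (rule unif_bd_weight[OF unif_bd_const[of k 1 ?U I "\<lambda>i. e i $ m"], of 1])
      show "\<bar>e i $ m\<bar> \<le> 1 * 1" if "i \<in> I" for i using component_le_norm_cart[of "e i" m] e[OF that] by simp
    qed simp
    moreover have "unif_bd k 1 ?U I (\<lambda>_. 1) (\<lambda>i x. norm x powr - 1 * x $ m)" using unif_bd_mult[OF inv co[of m]] by simp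
    ultimately have "unif_bd k 1 ?U I (\<lambda>_. 1) (\<lambda>i x. norm x powr - 1 * x $ m + e i $ m)" by (intro unif_bd_add) auto
    then show ?thesis by (rule unif_bd_cong) (auto simp: powr_minus)
  qed
  have pv: "unif_bd k 1 ?U I (\<lambda>i. norm (v i)) (\<lambda>i x. ?p i x \<bullet> v i)"
  proof -
    have "unif_bd k 1 ?U I (\<lambda>i. norm (v i)) (\<lambda>i x. v i $ m * ?p i x $ m)" for m
      by (rule unif_bd_weight[OF unif_bd_scale[OF p], of 1]) (auto simp: component_le_norm_cart)
    from unif_bd_sum[OF finite_class.finite_UNIV this] show ?thesis by (simp add: inner_vec_def mult.commute)
  qed
  have "unif_bd k 1 ?U I (\<lambda>_. 1) (\<lambda>i x. ?p i x \<bullet> ?p i x)"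
    using unif_bd_sum[OF finite_class.finite_UNIV, of k 1 ?U I "\<lambda>_. 1" "\<lambda>m i x. ?p i x $ m * ?p i x $ m"] unif_bd_mult[OF p p]
    by (simp add: inner_vec_def)
  from unif_bd_powr[OF this, of 1 "-1"] have "unif_bd k 1 ?U I (\<lambda>_. 1) (\<lambda>i x. (?p i x \<bullet> ?p i x) powr - 1)"
    using rot_base(2)[OF e] by simp
  from unif_bd_mult[OF unif_bd_mult[OF unif_bd_scale[OF pv, of "\<lambda>_. 2"] this] p[of m]]
  have A: "unif_bd k 1 ?U I (\<lambda>i. 2 * norm (v i)) (\<lambda>i x. 2 * (?p i x \<bullet> v i) * (?p i x \<bullet> ?p i x) powr - 1 * ?p i x $ m)" by simp
  have A': "unif_bd k 1 ?U I (\<lambda>i. norm (v i)) (\<lambda>i x. 2 * (?p i x \<bullet> v i) * (?p i x \<bullet> ?p i x) powr - 1 * ?p i x $ m)"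
    by (rule unif_bd_weight[OF A, of 2]) auto
  have "unif_bd k 1 ?U I (\<lambda>i. norm (v i)) (\<lambda>i x. v i $ m)"
    by (rule unif_bd_weight[OF unif_bd_const, of 1]) (auto simp: component_le_norm_cart)
  from unif_bd_diff[OF A' this] show ?thesis by (simp add: rot_def Let_def)
qed

section \<open>The radial parametrisation\<close>

text \<open>The value 1 at the origin keeps the factor positive and invariant under dilations
  everywhere, as \<open>integral_radial_scaling\<close> demands.\<close>

definition rad :: "(real ^ 'n::finite) set \<Rightarrow> real ^ 'n \<Rightarrow> real" where
  "rad \<Omega> v = (if v = 0 then 1 else hom_ext (radial \<Omega>) v)"

definition polar_map :: "(real ^ 'n::finite) set \<Rightarrow> real ^ 'n \<Rightarrow> real ^ 'n" where
  "polar_map \<Omega> v = rad \<Omega> v *\<^sub>R v"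

abbreviation punctured_ball :: "(real ^ 'n::finite) set" where
  "punctured_ball \<equiv> ball 0 1 - {0}"

abbreviation ann :: "real \<Rightarrow> real \<Rightarrow> (real ^ 'n::finite) set" where
  "ann c D \<equiv> {x. c < norm x \<and> norm x < D}"

lemma open_ann: "open (ann c D)"
  by (intro open_Collect_conj open_Collect_less continuous_intros)

context
  fixes \<Omega> :: "(real ^ 'n::finite) set"
  assumes cb: "convex_body \<Omega>" and int0: "0 \<in> interior \<Omega>"
begin

lemma body: "compact \<Omega>" "convex \<Omega>" "0 \<in> \<Omega>" "closed \<Omega>"
  using cb int0 interior_subset compact_imp_closed unfolding convex_body_def by auto

lemma radial_facts:
  assumes u: "norm u = 1"
  shows "radial \<Omega> u *\<^sub>R u \<in> \<Omega>" and "0 \<le> radial \<Omega> u"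
    and "\<And>l. 0 \<le> l \<Longrightarrow> l *\<^sub>R u \<in> \<Omega> \<Longrightarrow> l \<le> radial \<Omega> u"
proof -
  let ?S = "{l. 0 \<le> l \<and> l *\<^sub>R u \<in> \<Omega>}"
  obtain D where D: "\<And>y. y \<in> \<Omega> \<Longrightarrow> norm y \<le> D" using compact_imp_bounded[OF body(1)] unfolding bounded_iff by blast
  have bdd: "bdd_above ?S" using D u by (intro bdd_aboveI[of _ D]) force
  have ne: "?S \<noteq> {}" using body(3) by (auto intro: exI[of _ 0])
  have "closed ((\<lambda>l. l *\<^sub>R u) -` \<Omega>)" by (intro closed_vimage body(4) continuous_intros)
  then have "closed ({0..} \<inter> (\<lambda>l. l *\<^sub>R u) -` \<Omega>)" by (intro closed_Int closed_atLeast)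
  moreover have "{0..} \<inter> (\<lambda>l. l *\<^sub>R u) -` \<Omega> = ?S" by auto
  ultimately have "closed ?S" by simp
  from closed_contains_Sup[OF ne bdd this] show "radial \<Omega> u *\<^sub>R u \<in> \<Omega>" "0 \<le> radial \<Omega> u" unfolding radial_def by auto
  show "\<And>l. 0 \<le> l \<Longrightarrow> l *\<^sub>R u \<in> \<Omega> \<Longrightarrow> l \<le> radial \<Omega> u" unfolding radial_def by (intro cSup_upper bdd) auto
qed

lemma radial_min_facts: "0 < radial_min \<Omega>" "norm u = 1 \<Longrightarrow> radial_min \<Omega> \<le> radial \<Omega> u"
proof -
  obtain r where r: "r > 0" "ball 0 r \<subseteq> interior \<Omega>" using int0 by (meson open_contains_ball open_interior)
  have low: "r / 2 \<le> radial \<Omega> u" if u: "norm u = 1" for u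
  proof -
    have "(r / 2) *\<^sub>R u \<in> ball 0 r" using r u by simp
    then have "(r / 2) *\<^sub>R u \<in> \<Omega>" using r(2) interior_subset by blast
    then show ?thesis using radial_facts(3)[OF u, of "r / 2"] r by simp
  qed
  obtain i :: 'n where True by simp
  have ne: "sphere (0::real^'n) 1 \<noteq> {}" using norm_axis_1[of i] by (metis empty_iff mem_sphere_0)
  have "r / 2 \<le> radial_min \<Omega>" unfolding radial_min_def by (rule cINF_greatest[OF ne]) (use low in auto)
  then show "0 < radial_min \<Omega>" using r by simp
  show "norm u = 1 \<Longrightarrow> radial_min \<Omega> \<le> radial \<Omega> u" unfolding radial_min_def
    by (rule cINF_lower) (use low in \<open>auto intro!: bdd_belowI2[of _ "r / 2"]\<close>)
qed

lemma rad_pos: "0 < rad \<Omega> v"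
proof (cases "v = 0")
  case False
  then have "norm (v /\<^sub>R norm v) = 1" by simp
  then show ?thesis using radial_min_facts(1) radial_min_facts(2) False unfolding rad_def hom_ext_def by (auto intro: less_le_trans)
qed (simp add: rad_def)

lemma rad_scale: "0 < t \<Longrightarrow> rad \<Omega> (t *\<^sub>R v) = rad \<Omega> v"
  unfolding rad_def using hom_ext_scale[of t "radial \<Omega>" v] by auto

text \<open>Points of norm below 1 go to points of the body shrunk towards the interior point 0,
  which are interior by convexity. Conversely an interior point can be pushed slightly outwards
  along its ray, and maximality of the radial function forces the norm below 1.\<close>

lemma polar_map_interior:
  assumes "v \<noteq> 0"
  shows "polar_map \<Omega> v \<in> interior \<Omega> \<longleftrightarrow> norm v < 1"
proof -
  define u where "u = v /\<^sub>R norm v"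
  define \<rho> where "\<rho> = radial \<Omega> u"
  have u: "norm u = 1" unfolding u_def using assms by simp
  have r0: "0 < \<rho>" using rad_pos[of v] assms unfolding rad_def hom_ext_def \<rho>_def u_def by simp
  have pm: "polar_map \<Omega> v = (\<rho> * norm v) *\<^sub>R u"
    unfolding polar_map_def rad_def hom_ext_def \<rho>_def u_def using assms by simp
  show ?thesis
  proof
    assume v: "norm v < 1"
    have "\<rho> *\<^sub>R u - (1 - norm v) *\<^sub>R (\<rho> *\<^sub>R u - 0) \<in> interior \<Omega>"
      by (rule mem_interior_convex_shrink[OF body(2) int0]) (use v assms radial_facts(1)[OF u] in \<open>auto simp: \<rho>_def\<close>)
    moreover have "\<rho> *\<^sub>R u - (1 - norm v) *\<^sub>R (\<rho> *\<^sub>R u - 0) = (\<rho> * norm v) *\<^sub>R u" by (simp add: algebra_simps)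
    ultimately show "polar_map \<Omega> v \<in> interior \<Omega>" unfolding pm by simp
  next
    assume "polar_map \<Omega> v \<in> interior \<Omega>"
    then obtain \<epsilon> where \<epsilon>: "\<epsilon> > 0" "ball (polar_map \<Omega> v) \<epsilon> \<subseteq> \<Omega>" by (meson mem_interior)
    have "(\<rho> * norm v + \<epsilon> / 2) *\<^sub>R u \<in> ball (polar_map \<Omega> v) \<epsilon>"
      unfolding pm using \<epsilon> u by (simp add: dist_norm scaleR_diff_left[symmetric])
    then have "\<rho> * norm v + \<epsilon> / 2 \<le> \<rho>" using \<epsilon> r0 unfolding \<rho>_def by (intro radial_facts(3)[OF u]) auto
    then have "\<rho> * norm v < \<rho> * 1" using \<epsilon> by simp
    then show "norm v < 1" using r0 by (simp only: mult_less_cancel_left_pos)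
  qed
qed

text \<open>The frontier of a convex set and the origin are null sets, so only the punctured
  interior counts, and it corresponds to the punctured ball. The Jacobian is just the n-th power of
  \<open>rad\<close>, since this is constant on rays; derivatives of the radial function do not
  enter.\<close>

lemma integral_body_polar:
  fixes F :: "real ^ 'n \<Rightarrow> real" and R :: "real ^ 'n \<Rightarrow> real ^ 'n"
  assumes q: "continuous_on (- {0}) (hom_ext (radial \<Omega>))"
    and R: "linear R" "surj R" "\<And>x. norm (R x) = norm x"
    and F: "continuous_on (interior \<Omega>) F" "(\<lambda>y. indicator \<Omega> y *\<^sub>R F y) \<in> borel_measurable borel"
  shows "(LINT y:\<Omega>|lborel. F y) = (\<integral>w. F (polar_map \<Omega> (R w)) * rad \<Omega> (R w) ^ CARD('n) \<partial>restrict_space lborel punctured_ball)"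
proof -
  let ?A = "interior \<Omega> - {0}"
  have Rm[measurable]: "R \<in> borel_measurable borel"
    using R(1) by (intro borel_measurable_continuous_onI linear_continuous_on) (simp add: linear_conv_bounded_linear)
  have R0: "R w = 0 \<longleftrightarrow> w = 0" for w using R(3)[of w] by (metis norm_eq_zero)
  have "(\<lambda>w. indicator (- {0}) w *\<^sub>R hom_ext (radial \<Omega>) w + indicator {0} w) \<in> borel_measurable borel"
    by (intro borel_measurable_add borel_measurable_continuous_on_indicator q borel_measurable_indicator) auto
  moreover have "(\<lambda>w. indicator (- {0}) w *\<^sub>R hom_ext (radial \<Omega>) w + indicator {0} w) = rad \<Omega>"
    by (rule ext) (auto simp: rad_def indicator_def)
  ultimately have [measurable]: "rad \<Omega> \<in> borel_measurable borel" by simp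
  have Gm: "(\<lambda>y. indicator ?A y *\<^sub>R F y) \<in> borel_measurable borel"
    by (rule borel_measurable_continuous_on_indicator) (auto intro: continuous_on_subset[OF F(1)])
  have "frontier \<Omega> \<in> null_sets lborel"
    using negligible_convex_frontier[OF body(2)] by (simp add: negligible_iff_null_sets null_sets_completion_iff)
  then have ae: "AE y in lborel. y \<notin> frontier \<Omega>" by (rule AE_not_in)
  have "(LINT y:\<Omega>|lborel. F y) = (\<integral>y. indicator ?A y *\<^sub>R F y \<partial>lborel)"
    unfolding set_lebesgue_integral_def
  proof (rule integral_cong_AE)
    show "AE y in lborel. indicat_real \<Omega> y *\<^sub>R F y = indicat_real ?A y *\<^sub>R F y"
      using ae AE_lborel_singleton[of 0]
      by eventually_elim (use body(4) in \<open>auto simp: indicator_def frontier_def closure_closed dest: interior_subset[THEN subsetD]\<close>)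
  qed (use F(2) Gm in auto)
  also have "\<dots> = (\<integral>w. indicator ?A (R (rad \<Omega> (R w) *\<^sub>R w)) *\<^sub>R F (R (rad \<Omega> (R w) *\<^sub>R w)) * rad \<Omega> (R w) ^ DIM(real ^ 'n) \<partial>lborel)"
  proof (rule integral_radial_scaling[where F = "\<lambda>y. indicator ?A y *\<^sub>R F y" and q = "\<lambda>w. rad \<Omega> (R w)" and R = R, symmetric])
    show "(\<lambda>w. rad \<Omega> (R w)) \<in> borel_measurable borel" by measurable
    show "0 < rad \<Omega> (R w)" for w by (rule rad_pos)
    show "rad \<Omega> (R (t *\<^sub>R w)) = rad \<Omega> (R w)" if "0 < t" for t w
      using rad_scale[OF that, of "R w"] linear_scale[OF R(1), of t w] by simp
  qed (rule Gm R)+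
  also have "\<dots> = (\<integral>w. indicator punctured_ball w *\<^sub>R (F (polar_map \<Omega> (R w)) * rad \<Omega> (R w) ^ CARD('n)) \<partial>lborel)"
  proof (rule Bochner_Integration.integral_cong[OF refl])
    fix w
    have e: "R (rad \<Omega> (R w) *\<^sub>R w) = polar_map \<Omega> (R w)" unfolding polar_map_def by (rule linear_scale[OF R(1)])
    have "polar_map \<Omega> (R w) \<in> ?A \<longleftrightarrow> w \<in> punctured_ball"
    proof (cases "w = 0")
      case False
      then have "R w \<noteq> 0" using R0 by simp
      then have "polar_map \<Omega> (R w) \<noteq> 0" unfolding polar_map_def using rad_pos[of "R w"] by simp
      then show ?thesis using polar_map_interior[OF \<open>R w \<noteq> 0\<close>] R(3) False by simp
    qed (use linear_0[OF R(1)] in \<open>simp add: polar_map_def\<close>)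
    then show "indicator ?A (R (rad \<Omega> (R w) *\<^sub>R w)) *\<^sub>R F (R (rad \<Omega> (R w) *\<^sub>R w)) * rad \<Omega> (R w) ^ DIM(real ^ 'n) =
      indicator punctured_ball w *\<^sub>R (F (polar_map \<Omega> (R w)) * rad \<Omega> (R w) ^ CARD('n))"
      unfolding e by (simp add: indicator_def)
  qed
  also have "\<dots> = (\<integral>w. F (polar_map \<Omega> (R w)) * rad \<Omega> (R w) ^ CARD('n) \<partial>restrict_space lborel punctured_ball)"
    by (rule integral_restrict_space[symmetric]) auto
  finally show ?thesis .
qed

end

section \<open>The argument of the kernel: size, regularity and lower bound\<close>

lemma unif_bd_unit_lipschitz:
  assumes q: "unif_bd (Suc k) \<alpha> (\<lambda>_. ann (1/4) 4) I (\<lambda>_. 1) (q :: 'i \<Rightarrow> real ^ 'n::finite \<Rightarrow> real)"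
  shows "\<exists>L\<ge>0. \<forall>i\<in>I. \<forall>x y. norm x = 1 \<longrightarrow> norm y = 1 \<longrightarrow> \<bar>q i x - q i y\<bar> \<le> L * dist x y"
proof -
  obtain C where C: "0 \<le> C" "\<forall>i\<in>I. holder_bd (Suc k) \<alpha> (ann (1/4) 4) (C * 1) (q i)" by (rule unif_bdE[OF q])
  have "\<bar>q i x - q i y\<bar> \<le> (real CARD('n) * C + 4 * C) * dist x y" if i: "i \<in> I" and xy: "norm x = 1" "norm y = 1" for i x y
  proof (cases "dist x y < 1/2")
    case True
    \<comment> \<open>The annulus is not convex, so the mean value inequality is applied on a ball
      inside it; more distant pairs are covered by the sup bound.\<close>
    have "ball x (1/2) \<subseteq> ann (1/4) 4"
    proof
      fix z assume "z \<in> ball x (1/2)"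
      then have "norm (x - z) < 1/2" by (simp add: dist_norm)
      then show "z \<in> ann (1/4) 4" using xy(1) norm_triangle_ineq2[of x "x - z"] norm_triangle_ineq2[of z x] norm_minus_commute[of x z] by auto
    qed
    from bd_lipschitz[OF convex_ball bd_subset[OF C(2)[THEN bspec, OF i] this]]
    have "\<bar>q i x - q i y\<bar> \<le> real CARD('n) * (C * 1) * dist x y" using True by simp
    also have "\<dots> \<le> (real CARD('n) * C + 4 * C) * dist x y" using C(1) by (intro mult_right_mono) auto
    finally show ?thesis .
  next
    case False
    have b: "\<bar>q i z\<bar> \<le> C" if "norm z = 1" for z
      using bd_hold0[OF C(2)[THEN bspec, OF i]] that unfolding hold0_def by auto
    have "\<bar>q i x - q i y\<bar> \<le> 4 * C * (1/2)" using b[OF xy(1)] b[OF xy(2)] by linarith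
    also have "\<dots> \<le> 4 * C * dist x y" using False C(1) by (intro mult_left_mono) auto
    also have "\<dots> \<le> (real CARD('n) * C + 4 * C) * dist x y" using C(1) by (intro mult_right_mono) auto
    finally show ?thesis .
  qed
  then show ?thesis using C(1) by (intro exI[of _ "real CARD('n) * C + 4 * C"]) auto
qed

text \<open>The role of q is that of the radial function extended to degree 0. The integration point
  w is part of the index, so uniformity over I includes uniformity in w, and the distance from w to
  e is what weights are measured in.\<close>

locale radial_family =
  fixes I :: "'i set" and q :: "'i \<Rightarrow> real ^ 'n::finite \<Rightarrow> real" and e w :: "'i \<Rightarrow> real ^ 'n"
    and k :: nat and \<alpha> c0 :: real
  assumes al: "0 \<le> \<alpha>" "\<alpha> \<le> 1"
    and qb: "unif_bd (Suc k) \<alpha> (\<lambda>_. ann (1/4) 4) I (\<lambda>_. 1) q"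
    and qh: "\<And>i t v. i \<in> I \<Longrightarrow> 0 < t \<Longrightarrow> q i (t *\<^sub>R v) = q i v"
    and c0: "0 < c0" and ql: "\<And>i v. i \<in> I \<Longrightarrow> v \<noteq> 0 \<Longrightarrow> c0 \<le> q i v"
    and e: "\<And>i. i \<in> I \<Longrightarrow> norm (e i) = 1"
    and w: "\<And>i. i \<in> I \<Longrightarrow> w i \<noteq> 0 \<and> norm (w i) < 1"
begin

abbreviation "U \<equiv> \<lambda>i. ball (e i) (1/2)"
abbreviation "T \<equiv> \<lambda>i x. rot (e i) x (w i)"
abbreviation "S \<equiv> \<lambda>i x. rot (e i) x (e i)"
definition "r i = norm (w i - e i)"
text \<open>Point of integration minus boundary point, after the rotation; this is \<delta> of the
  overview, and \<open>eta\<close> is its normalisation by |w - e|.\<close>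

definition "del i x = q i (T i x) *\<^sub>R T i x - q i (S i x) *\<^sub>R S i x"
definition "eta i x = del i x /\<^sub>R r i"

lemma opU: "open (U i)" and convU: "convex (U i)" and diamU: "x \<in> U i \<Longrightarrow> y \<in> U i \<Longrightarrow> dist x y \<le> 1"
  by (auto simp: ball_dist_le_1 simp del: mem_ball)

lemma r_bounds: "i \<in> I \<Longrightarrow> 0 < r i" "i \<in> I \<Longrightarrow> r i < 2"
proof -
  assume i: "i \<in> I"
  then show "0 < r i" using w e unfolding r_def by fastforce
  show "r i < 2" using norm_triangle_ineq4[of "w i" "e i"] w[OF i] e[OF i] unfolding r_def by linarith
qed

lemma rot_exp:
  assumes "\<alpha>' \<le> 1"
  shows "unif_bd j \<alpha>' U I (\<lambda>i. norm (v i)) (\<lambda>i x. rot (e i) x (v i) $ m)"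
  by (rule unif_bd_exp[OF unif_bd_rot[OF e] assms diamU]) auto

lemma rot_comp:
  assumes "\<alpha>' \<le> 1" "\<And>i. i \<in> I \<Longrightarrow> norm (v i) \<le> 1"
  shows "unif_bd j \<alpha>' U I (\<lambda>_. 1) (\<lambda>i x. rot (e i) x (v i) $ m)"
  by (rule unif_bd_weight[OF rot_exp[OF assms(1)], of 1]) (use assms(2) in auto)

lemma rot_lip:
  assumes "\<And>i. i \<in> I \<Longrightarrow> norm (v i) \<le> 1"
  shows "\<exists>L\<ge>0. \<forall>i\<in>I. \<forall>x\<in>U i. \<forall>y\<in>U i. dist (rot (e i) x (v i)) (rot (e i) y (v i)) \<le> L * dist x y powr 1"
  by (rule unif_bd_vec_holder[OF rot_comp[where j = 0 and v = v]]) (use assms in auto)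

lemma q_rot_unit:
  assumes v: "\<And>i. i \<in> I \<Longrightarrow> norm (v i) = 1"
  shows "unif_bd (Suc k) \<alpha> U I (\<lambda>_. 1) (\<lambda>i x. q i (rot (e i) x (v i)))"
proof -
  obtain L where L: "0 \<le> L" "\<forall>i\<in>I. \<forall>x\<in>U i. \<forall>y\<in>U i. dist (rot (e i) x (v i)) (rot (e i) y (v i)) \<le> L * dist x y powr 1"
    using rot_lip[of v] v by auto
  have "unif_bd (Suc k) (\<alpha> * 1) U I (\<lambda>_. 1) (\<lambda>i x. q i (rot (e i) x (v i)))"
  proof (rule unif_bd_compose[OF qb _ L(1)])
    show "unif_bd (Suc k) (\<alpha> * 1) U I (\<lambda>_. 1) (\<lambda>i x. rot (e i) x (v i) $ m)" for m
      by (rule rot_comp) (use al v in auto)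
    show "rot (e i) x (v i) \<in> ann (1/4) 4" if "i \<in> I" for i x using v[OF that] by (simp add: rot_norm)
  qed (use L(2) al in auto)
  then show ?thesis by simp
qed

lemma rot_nz: "v \<noteq> 0 \<Longrightarrow> rot a x v \<noteq> 0" for v a x :: "real ^ 'n"
  using rot_norm[of a x v] by (metis norm_eq_zero)

text \<open>Derivatives of q blow up at the origin, which w may approach. But q has degree 0 and the
  rotation is linear, so w may be replaced by w/|w|.\<close>

lemma q_T: "unif_bd (Suc k) \<alpha> U I (\<lambda>_. 1) (\<lambda>i x. q i (T i x))"
proof -
  have "unif_bd (Suc k) \<alpha> U I (\<lambda>_. 1) (\<lambda>i x. q i (rot (e i) x (w i /\<^sub>R norm (w i))))"
    by (rule q_rot_unit) (use w in auto)
  then show ?thesis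
  proof (rule unif_bd_cong)
    fix i x assume i: "i \<in> I"
    have "T i x = norm (w i) *\<^sub>R rot (e i) x (w i /\<^sub>R norm (w i))"
      using w[OF i] linear_scale[OF rot_linear, of "e i" x "norm (w i)" "w i /\<^sub>R norm (w i)"] by simp
    then show "q i (rot (e i) x (w i /\<^sub>R norm (w i))) = q i (T i x)" using qh[OF i, of "norm (w i)"] w[OF i] by simp
  qed simp
qed

lemma q_S: "unif_bd (Suc k) \<alpha> U I (\<lambda>_. 1) (\<lambda>i x. q i (S i x))"
  by (rule q_rot_unit[OF e])

lemma Psi_comp: "unif_bd (Suc k) \<alpha> U I (\<lambda>_. 1) (\<lambda>i x. (q i (T i x) *\<^sub>R T i x) $ m)"
proof -
  have "unif_bd (Suc k) \<alpha> U I (\<lambda>_. 1) (\<lambda>i x. T i x $ m)" by (rule rot_comp) (use w al in \<open>auto intro: less_imp_le\<close>)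
  from unif_bd_mult[OF q_T this] show ?thesis by simp
qed

lemma E_comp: "unif_bd (Suc k) \<alpha> U I (\<lambda>_. 1) (\<lambda>i x. (q i (S i x) *\<^sub>R S i x) $ m)"
proof -
  have "unif_bd (Suc k) \<alpha> U I (\<lambda>_. 1) (\<lambda>i x. S i x $ m)" by (rule rot_comp) (use e al in auto)
  from unif_bd_mult[OF q_S this] show ?thesis by simp
qed

lemma del_comp: "unif_bd (Suc k) \<alpha> U I (\<lambda>_. 1) (\<lambda>i x. del i x $ m)"
  using unif_bd_diff[OF Psi_comp E_comp, of m m] by (simp add: del_def)

lemma G_comp: "unif_bd (Suc k) \<alpha> (\<lambda>_. ann (1/4) 4) I (\<lambda>_. 1) (\<lambda>i v. q i v * v $ m)"
proof -
  have "unif_bd (Suc k) 1 (\<lambda>_. ann (1/4) 4) I (\<lambda>_. 1) (\<lambda>i v :: real^'n. v $ m)" by (rule unif_bd_coord[of _ _ 4]) auto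
  then have "unif_bd (Suc k) \<alpha> (\<lambda>_. ann (1/4) 4) I (\<lambda>_. 1) (\<lambda>i v :: real^'n. v $ m)"
  proof (rule unif_bd_exp[OF _ al(2), of _ _ _ _ _ 8])
    show "dist x y \<le> 8" if "x \<in> ann (1/4) 4" "y \<in> ann (1/4) 4" for x y :: "real^'n"
      using that norm_triangle_ineq4[of x y] by (simp add: dist_norm)
  qed auto
  from unif_bd_mult[OF qb this] show ?thesis by simp
qed

lemma near_facts:
  assumes "i \<in> I" "r i < 1/2"
  shows "1/2 < norm (T i x)" "norm (T i x) < 1" "norm (S i x) = 1" "norm (T i x - S i x) = r i"
proof -
  show "norm (T i x) < 1" "norm (S i x) = 1" using w e assms(1) by (auto simp: rot_norm)
  show "norm (T i x - S i x) = r i" unfolding rot_diff rot_norm r_def ..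
  show "1/2 < norm (T i x)" using norm_triangle_ineq2[of "e i" "e i - w i"] e[OF assms(1)] assms(2)
    unfolding rot_norm r_def by (simp add: norm_minus_commute)
qed

lemma near_data:
  fixes \<alpha>' :: real and j :: nat
  assumes "\<alpha>' \<le> 1"
  shows "\<And>m. unif_bd j \<alpha>' U {i\<in>I. r i < 1/2} (\<lambda>_. 1) (\<lambda>i x. T i x $ m)"
    and "\<And>m. unif_bd j \<alpha>' U {i\<in>I. r i < 1/2} (\<lambda>_. 1) (\<lambda>i x. S i x $ m)"
    and "\<And>m. unif_bd j \<alpha>' U {i\<in>I. r i < 1/2} r (\<lambda>i x. T i x $ m - S i x $ m)"
    and "\<exists>L\<ge>0. \<forall>i\<in>I. \<forall>x\<in>U i. \<forall>y\<in>U i. dist (T i x) (T i y) \<le> L * dist x y \<and> dist (S i x) (S i y) \<le> L * dist x y"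
proof -
  show "unif_bd j \<alpha>' U {i\<in>I. r i < 1/2} (\<lambda>_. 1) (\<lambda>i x. T i x $ m)" for m
    by (rule unif_bd_subset[OF rot_comp[OF assms]]) (use w in \<open>auto intro: less_imp_le\<close>)
  show "unif_bd j \<alpha>' U {i\<in>I. r i < 1/2} (\<lambda>_. 1) (\<lambda>i x. S i x $ m)" for m
    by (rule unif_bd_subset[OF rot_comp[OF assms]]) (use e in auto)
  have "unif_bd j \<alpha>' U I r (\<lambda>i x. rot (e i) x (w i - e i) $ m)" for m
    using rot_exp[OF assms, of j "\<lambda>i. w i - e i" m] unfolding r_def .
  then have "unif_bd j \<alpha>' U I r (\<lambda>i x. T i x $ m - S i x $ m)" for m
    unfolding rot_diff[symmetric] by simp
  then show "unif_bd j \<alpha>' U {i\<in>I. r i < 1/2} r (\<lambda>i x. T i x $ m - S i x $ m)" for m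
    by (rule unif_bd_subset) auto
  obtain L1 where L1: "0 \<le> L1" "\<forall>i\<in>I. \<forall>x\<in>U i. \<forall>y\<in>U i. dist (T i x) (T i y) \<le> L1 * dist x y powr 1"
    using rot_lip[of w] w by (auto intro: less_imp_le)
  obtain L2 where L2: "0 \<le> L2" "\<forall>i\<in>I. \<forall>x\<in>U i. \<forall>y\<in>U i. dist (S i x) (S i y) \<le> L2 * dist x y powr 1"
    using rot_lip[of e] e by auto
  show "\<exists>L\<ge>0. \<forall>i\<in>I. \<forall>x\<in>U i. \<forall>y\<in>U i. dist (T i x) (T i y) \<le> L * dist x y \<and> dist (S i x) (S i y) \<le> L * dist x y"
  proof (intro exI[of _ "L1 + L2"] conjI ballI)
    fix i x y assume i: "i \<in> I" "x \<in> U i" "y \<in> U i"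
    have "dist (T i x) (T i y) \<le> L1 * dist x y" "dist (S i x) (S i y) \<le> L2 * dist x y"
      using L1(2)[rule_format, OF i] L2(2)[rule_format, OF i] by simp_all
    moreover have "0 \<le> L1 * dist x y" "0 \<le> L2 * dist x y" using L1(1) L2(1) by simp_all
    ultimately show "dist (T i x) (T i y) \<le> (L1 + L2) * dist x y" "dist (S i x) (S i y) \<le> (L1 + L2) * dist x y"
      unfolding distrib_right by linarith+
  qed (use L1 L2 in simp)
qed

text \<open>Near the singularity \<delta> is a difference of two values of q(v) v along a segment
  inside the annulus, and \<open>unif_bd_compose_diff\<close> gains the factor r while the order
  drops from k + 1 to k. Away from it r \<ge> 1/2 and there is nothing to gain.\<close>

lemma del_weight: "unif_bd k \<alpha> U I r (\<lambda>i x. del i x $ m)"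
proof (rule unif_bd_split[where P = "\<lambda>i. r i < 1/2"])
  obtain L where L: "0 \<le> L" "\<forall>i\<in>I. \<forall>x\<in>U i. \<forall>y\<in>U i. dist (T i x) (T i y) \<le> L * dist x y \<and> dist (S i x) (S i y) \<le> L * dist x y"
    using near_data(4)[OF order_refl] by blast
  have "unif_bd k \<alpha> U {i\<in>I. r i < 1/2} r (\<lambda>i x. (\<lambda>v. q i v * v $ m) (T i x) - (\<lambda>v. q i v * v $ m) (S i x))"
  proof (rule unif_bd_compose_diff[where V = "\<lambda>_. ann (1/4) 4" and B = 2 and L = L])
    show "unif_bd (Suc k) \<alpha> (\<lambda>_. ann (1/4) 4) {i\<in>I. r i < 1/2} (\<lambda>_. 1) (\<lambda>i v. q i v * v $ m)"
      by (rule unif_bd_subset[OF G_comp]) auto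
    show "S i x + t *\<^sub>R (T i x - S i x) \<in> ann (1/4) 4"
      if "i \<in> {i\<in>I. r i < 1/2}" "0 \<le> t" "t \<le> 1" for i x t
    proof -
      have i: "i \<in> I" "r i < 1/2" using that(1) by auto
      note n = near_facts[OF i, of x]
      \<comment> \<open>One end of the segment lies on the unit sphere and its length is below 1/2,
        so its points have norms between 1/2 and 3/2.\<close>
      have "norm (t *\<^sub>R (T i x - S i x)) \<le> 1 * r i" unfolding norm_scaleR n(4) using that(2,3) r_bounds(1)[OF i(1)] by (intro mult_right_mono) auto
      then have "norm (t *\<^sub>R (T i x - S i x)) < 1/2" using i(2) by simp
      then show ?thesis using n(3) norm_triangle_ineq[of "S i x" "t *\<^sub>R (T i x - S i x)"] norm_diff_ineq[of "S i x" "t *\<^sub>R (T i x - S i x)"]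
        unfolding mem_Collect_eq by linarith
    qed
    show "open (ann (1/4) 4)" by (rule open_ann)
  qed (use near_data(2,3) al L r_bounds opU in \<open>auto simp: less_imp_le simp del: mem_ball\<close>)
  then show "unif_bd k \<alpha> U {i\<in>I. r i < 1/2} r (\<lambda>i x. del i x $ m)" by (simp add: del_def)
  have "unif_bd k \<alpha> U {i\<in>I. \<not> r i < 1/2} (\<lambda>_. 1) (\<lambda>i x. del i x $ m)"
    by (rule unif_bd_subset[OF unif_bd_le[OF del_comp]]) auto
  then show "unif_bd k \<alpha> U {i\<in>I. \<not> r i < 1/2} r (\<lambda>i x. del i x $ m)"
    by (rule unif_bd_weight[of _ _ _ _ _ _ 2]) auto
qed (use r_bounds in \<open>auto intro: less_imp_le\<close>)

lemma eta_comp: "unif_bd k \<alpha> U I (\<lambda>_. 1) (\<lambda>i x. eta i x $ m)"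
proof -
  have "unif_bd k \<alpha> U I (\<lambda>i. \<bar>inverse (r i)\<bar> * r i) (\<lambda>i x. inverse (r i) * del i x $ m)"
    by (rule unif_bd_scale[OF del_weight])
  then have "unif_bd k \<alpha> U I (\<lambda>i. \<bar>inverse (r i)\<bar> * r i) (\<lambda>i x. eta i x $ m)" by (simp add: eta_def)
  then show ?thesis
  proof (rule unif_bd_weight[of _ _ _ _ _ _ 1])
    show "\<bar>inverse (r i)\<bar> * r i \<le> 1 * 1" if "i \<in> I" for i using r_bounds(1)[OF that] by simp
  qed simp
qed

text \<open>At the full order k + 1 no derivative of q is left for the mean value formula, so only
  the power \<alpha> - \<alpha>' of r is gained, in exchange for lowering the exponent to
  \<alpha>'.\<close>

lemma del_interp:
  assumes "0 \<le> \<alpha>'" "\<alpha>' \<le> \<alpha>"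
  shows "unif_bd (Suc k) \<alpha>' U I (\<lambda>i. r i powr (\<alpha> - \<alpha>')) (\<lambda>i x. del i x $ m)"
proof (rule unif_bd_split[where P = "\<lambda>i. r i < 1/2"])
  obtain L where L: "0 \<le> L" "\<forall>i\<in>I. \<forall>x\<in>U i. \<forall>y\<in>U i. dist (T i x) (T i y) \<le> L * dist x y \<and> dist (S i x) (S i y) \<le> L * dist x y"
    using near_data(4)[OF order_refl] by blast
  have "unif_bd (Suc k) \<alpha>' U {i\<in>I. r i < 1/2} (\<lambda>i. r i powr (\<alpha> - \<alpha>')) (\<lambda>i x. (\<lambda>v. q i v * v $ m) (T i x) - (\<lambda>v. q i v * v $ m) (S i x))"
  proof (rule unif_bd_compose_interp[where V = "\<lambda>_. ann (1/4) 4" and B = 2 and L = L])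
    show "unif_bd (Suc k) \<alpha> (\<lambda>_. ann (1/4) 4) {i\<in>I. r i < 1/2} (\<lambda>_. 1) (\<lambda>i v. q i v * v $ m)"
      by (rule unif_bd_subset[OF G_comp]) auto
    show "T i x \<in> ann (1/4) 4" "S i x \<in> ann (1/4) 4" if "i \<in> {i\<in>I. r i < 1/2}" for i x
      using near_facts[of i x] that by auto
    show "dist x y \<le> 1" if "x \<in> U i" "y \<in> U i" for i x y using diamU that by blast
    show "open (ann (1/4) 4)" by (rule open_ann)
  qed (use near_data assms al L r_bounds opU in \<open>auto simp: less_imp_le simp del: mem_ball\<close>)
  then show "unif_bd (Suc k) \<alpha>' U {i\<in>I. r i < 1/2} (\<lambda>i. r i powr (\<alpha> - \<alpha>')) (\<lambda>i x. del i x $ m)" by (simp add: del_def)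
  have "unif_bd (Suc k) \<alpha>' U {i\<in>I. \<not> r i < 1/2} (\<lambda>_. 1) (\<lambda>i x. del i x $ m)"
    by (rule unif_bd_subset[OF unif_bd_exp[OF del_comp assms(2) diamU]]) auto
  then show "unif_bd (Suc k) \<alpha>' U {i\<in>I. \<not> r i < 1/2} (\<lambda>i. r i powr (\<alpha> - \<alpha>')) (\<lambda>i x. del i x $ m)"
  proof (rule unif_bd_weight[of _ _ _ _ _ _ "2 powr (\<alpha> - \<alpha>')"])
    fix i assume "i \<in> {i\<in>I. \<not> r i < 1/2}"
    then have "1 powr (\<alpha> - \<alpha>') \<le> (2 * r i) powr (\<alpha> - \<alpha>')" using assms by (intro powr_mono2) auto
    then show "1 \<le> 2 powr (\<alpha> - \<alpha>') * r i powr (\<alpha> - \<alpha>')"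
      using powr_mult[of 2 "r i" "\<alpha> - \<alpha>'"] \<open>i \<in> {i\<in>I. \<not> r i < 1/2}\<close> by simp
  qed simp
qed auto

text \<open>The lower bound says that v \<mapsto> q(v) v does not contract distances to the unit
  sphere by more than a fixed factor. The directions of the two images differ by at most 2 |a - b| /
  |a|, so q(v) - q(u) is controlled by |a - b|, and v - u is recovered from both.\<close>

lemma eta_bounds: "\<exists>c C. 0 < c \<and> (\<forall>i\<in>I. \<forall>x\<in>U i. c < norm (eta i x) \<and> norm (eta i x) < C)"
proof -
  have "\<forall>m. \<exists>C\<ge>0. \<forall>i\<in>I. \<forall>x\<in>U i. \<bar>eta i x $ m\<bar> \<le> C * 1" by (intro allI unif_bd_bound[OF eta_comp])
  then obtain C where C: "\<And>m. 0 \<le> C m" "\<And>m i x. i \<in> I \<Longrightarrow> x \<in> U i \<Longrightarrow> \<bar>eta i x $ m\<bar> \<le> C m" by (metis mult_1_right)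
  obtain L where L: "L \<ge> 0" "\<forall>i\<in>I. \<forall>x y. norm x = 1 \<longrightarrow> norm y = 1 \<longrightarrow> \<bar>q i x - q i y\<bar> \<le> L * dist x y"
    using unif_bd_unit_lipschitz[OF qb] by (elim exE conjE)
  \<comment> \<open>Obtained by solving the final inequality |v - u| \<le> |a - b| / c0 * (1 + 2 L /
    c0); half of it is used below to make the bound strict.\<close>
  define c where "c = c0 / (1 + 2 * L / c0)"
  have d0: "0 < 1 + 2 * L / c0" using L(1) c0 by (simp add: add_pos_nonneg)
  have c: "0 < c" unfolding c_def using d0 c0 by simp
  have low: "c / 2 < norm (eta i x)" if i: "i \<in> I" for i x
  proof -
    define v where "v = T i x" define u where "u = S i x"
    define a where "a = q i v *\<^sub>R v" define b where "b = q i u *\<^sub>R u"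
    have v0: "v \<noteq> 0" unfolding v_def using w[OF i] by (intro rot_nz) simp
    have nu: "norm u = 1" unfolding u_def using e[OF i] by (simp add: rot_norm)
    then have u0: "u \<noteq> 0" by auto
    have qv: "c0 \<le> q i v" "0 < q i v" using ql[OF i v0] c0 by auto
    have qu: "c0 \<le> q i u" "0 < q i u" using ql[OF i u0] c0 by auto
    have ab: "a \<noteq> 0" "b \<noteq> 0" unfolding a_def b_def using v0 u0 qv qu by auto
    have hat: "a /\<^sub>R norm a = v /\<^sub>R norm v" "b /\<^sub>R norm b = u"
      unfolding a_def b_def using qv qu nu v0 by auto
    have "dist (v /\<^sub>R norm v) u \<le> 2 / norm a * norm (a - b)"
      using unit_diff[OF ab] unfolding hat dist_norm .
    moreover have "\<bar>q i (v /\<^sub>R norm v) - q i u\<bar> \<le> L * dist (v /\<^sub>R norm v) u" using L(2) i nu v0 by simp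
    moreover have "q i (v /\<^sub>R norm v) = q i v" using qh[OF i] v0 by simp
    ultimately have qd: "\<bar>q i v - q i u\<bar> \<le> L * (2 / norm a * norm (a - b))"
      using L(1) by (smt (verit) mult_left_mono)
    have na: "norm a = q i v * norm v" unfolding a_def using qv by simp
    \<comment> \<open>The second coefficient multiplies v, and |v| cancels against |a| = q(v) |v|;
      so the estimate survives v close to 0.\<close>
    have "v - u = (a - b) /\<^sub>R q i u + ((q i u - q i v) / q i u) *\<^sub>R v"
    proof -
      have "(a - b) /\<^sub>R q i u = (q i v / q i u) *\<^sub>R v - u"
        unfolding a_def b_def using qu by (simp add: scaleR_diff_right divide_inverse mult.commute)
      moreover have "((q i u - q i v) / q i u) *\<^sub>R v = v - (q i v / q i u) *\<^sub>R v"
        using qu by (simp add: diff_divide_distrib scaleR_diff_left)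
      ultimately show ?thesis by simp
    qed
    then have "norm (v - u) \<le> norm (a - b) / q i u + \<bar>q i v - q i u\<bar> / q i u * norm v"
      using norm_triangle_ineq[of "(a - b) /\<^sub>R q i u" "((q i u - q i v) / q i u) *\<^sub>R v"] qu
      by (simp add: divide_inverse abs_mult abs_minus_commute mult_ac)
    also have "\<dots> \<le> norm (a - b) / q i u + L * (2 / norm a * norm (a - b)) / q i u * norm v"
      using qd qu by (intro add_left_mono mult_right_mono divide_right_mono) auto
    also have "\<dots> = norm (a - b) / q i u * (1 + 2 * L / q i v)"
      unfolding na using v0 qv qu by (simp add: field_simps)
    also have "\<dots> \<le> norm (a - b) / c0 * (1 + 2 * L / c0)"
      using qv qu c0 L(1) by (intro mult_mono add_left_mono divide_left_mono) auto
    also have "\<dots> = norm (a - b) / c" unfolding c_def using c0 d0 by (simp add: field_simps)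
    finally have "c * norm (v - u) \<le> norm (a - b)" using c by (simp add: field_simps)
    moreover have "norm (v - u) = r i" unfolding v_def u_def rot_diff rot_norm r_def ..
    moreover have "norm (eta i x) = norm (a - b) / r i"
      unfolding eta_def del_def a_def b_def v_def u_def using r_bounds(1)[OF i] by (simp add: divide_inverse mult.commute)
    ultimately have "c * r i \<le> norm (eta i x) * r i" using r_bounds(1)[OF i] by simp
    then have "c \<le> norm (eta i x)" using r_bounds(1)[OF i] by (rule mult_right_le_imp_le)
    then show ?thesis using c by linarith
  qed
  have "norm (eta i x) < (\<Sum>m\<in>UNIV. C m) + 1" if "i \<in> I" "x \<in> U i" for i x
    using order_trans[OF norm_le_l1_cart sum_mono[of UNIV "\<lambda>m. \<bar>eta i x $ m\<bar>" C]] C(2)[OF that] by fastforce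
  then show ?thesis using low c by (intro exI[of _ "c / 2"] exI[of _ "(\<Sum>m\<in>UNIV. C m) + 1"]) auto
qed

text \<open>The two hypotheses serve different orders. For k = 0 the map \<open>eta\<close> is only
  \<alpha>-Hoelder, and g has to be Lipschitz for the exponent to stay \<alpha>. For k > 0 the
  derivatives of \<open>eta\<close> make it Lipschitz, and the \<alpha>-Hoelder bounds of g
  suffice.\<close>

lemma kernel_eta:
  assumes K: "\<And>c C. 0 < c \<Longrightarrow> unif_bd k \<alpha> (\<lambda>_. ann c C) I (\<lambda>_. 1) g"
    and K1: "\<And>c C. 0 < c \<Longrightarrow> unif_bd 0 1 (\<lambda>_. ann c C) I (\<lambda>_. 1) g"
  shows "unif_bd k \<alpha> U I (\<lambda>_. 1) (\<lambda>i x. g i (eta i x))"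
proof -
  obtain c C where c: "0 < c" "\<forall>i\<in>I. \<forall>x\<in>U i. c < norm (eta i x) \<and> norm (eta i x) < C"
    using eta_bounds by (elim exE conjE)
  have im: "eta i x \<in> ann c C" if "i \<in> I" "x \<in> U i" for i x using c(2) that by blast
  show ?thesis
  proof (cases k)
    case 0
    have h: "unif_bd 0 (1 * \<alpha>) U I (\<lambda>_. 1) (\<lambda>i x. eta i x $ m)" for m using eta_comp[of m] unfolding 0 by simp
    obtain L where L: "0 \<le> L" "\<forall>i\<in>I. \<forall>x\<in>U i. \<forall>y\<in>U i. dist (eta i x) (eta i y) \<le> L * dist x y powr \<alpha>"
      using unif_bd_vec_holder[of 0 \<alpha> U I eta] h by auto
    have "unif_bd 0 (1 * \<alpha>) U I (\<lambda>_. 1) (\<lambda>i x. g i (eta i x))"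
      by (rule unif_bd_compose[OF K1[OF c(1), of C] h L(1)]) (use L(2) im in \<open>auto simp del: mem_ball\<close>)
    then show ?thesis unfolding 0 by simp
  next
    case (Suc k')
    have h: "unif_bd k (\<alpha> * 1) U I (\<lambda>_. 1) (\<lambda>i x. eta i x $ m)" for m using eta_comp[of m] by simp
    obtain L where L: "0 \<le> L" "\<forall>i\<in>I. \<forall>x\<in>U i. \<forall>y\<in>U i. dist (eta i x) (eta i y) \<le> L * dist x y powr 1"
      using unif_bd_Suc_lipschitz[of k' \<alpha> U I eta] h convU unfolding Suc by auto
    have "unif_bd k (\<alpha> * 1) U I (\<lambda>_. 1) (\<lambda>i x. g i (eta i x))"
      by (rule unif_bd_compose[OF K[OF c(1), of C] h L(1)]) (use L(2) im al in \<open>auto simp del: mem_ball\<close>)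
    then show ?thesis by simp
  qed
qed

end

section \<open>Auxiliary operations and the integrable weight\<close>

lemma unif_bd_reindex:
  assumes "unif_bd k \<alpha> U I m f" "\<And>j. j \<in> J \<Longrightarrow> h j \<in> I"
  shows "unif_bd k \<alpha> (\<lambda>j. U (h j)) J (\<lambda>j. m (h j)) (\<lambda>j. f (h j))"
  using assms unfolding unif_bd_def by blast

lemma unif_bd_power:
  assumes "unif_bd k \<alpha> U I (\<lambda>_. 1) f"
  shows "unif_bd k \<alpha> U I (\<lambda>_. 1) (\<lambda>i x. f i x ^ n)"
proof (induction n)
  case 0
  show ?case using unif_bd_const[of k \<alpha> U I "\<lambda>_. 1"] by simp
next
  case (Suc n)
  from unif_bd_mult[OF assms Suc.IH] show ?case by simp
qed

lemma integrable_shift: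
  fixes g :: "'a::euclidean_space \<Rightarrow> real"
  assumes "integrable lborel g"
  shows "integrable lborel (\<lambda>x. g (x - c))" and "(\<integral>x. g (x - c) \<partial>lborel) = (\<integral>x. g x \<partial>lborel)"
proof -
  have m: "g \<in> borel_measurable borel" using assms by auto
  have d: "distr lborel borel ((+) (- c)) = lborel" by (rule lborel_distr_plus)
  have "integrable (distr lborel borel ((+) (- c))) g" unfolding d by (rule assms)
  then show "integrable lborel (\<lambda>x. g (x - c))" by (subst (asm) integrable_distr_eq) (use m in auto)
  have "(\<integral>x. g x \<partial>lborel) = (\<integral>x. g x \<partial>distr lborel borel ((+) (- c)))" unfolding d ..
  also have "\<dots> = (\<integral>x. g (x - c) \<partial>lborel)" by (subst integral_distr) (use m in auto)
  finally show "(\<integral>x. g (x - c) \<partial>lborel) = (\<integral>x. g x \<partial>lborel)" ..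
qed

text \<open>Seen from a unit vector e, the unit ball lies in the ball of radius 2, so translation by
  e bounds the integral by one that does not depend on e.\<close>

lemma singular_weight:
  fixes b :: real
  assumes b: "0 < b"
  shows "\<exists>C. \<forall>e::real^'n::finite. norm e = 1 \<longrightarrow>
    integrable (restrict_space lborel punctured_ball) (\<lambda>w. norm (w - e) powr (b - real CARD('n))) \<and>
    (\<integral>w. norm (w - e) powr (b - real CARD('n)) \<partial>restrict_space lborel punctured_ball) \<le> C"
proof -
  define g where "g = (\<lambda>x::real^'n. indicator (ball 0 2) x * norm x powr (b - real CARD('n)))"
  have gi: "integrable lborel g" using integrable_norm_powr[OF b, where 'a = "real^'n" and D = 2] unfolding g_def by simp
  show ?thesis
  proof (intro exI[of _ "\<integral>x. g x \<partial>lborel"] allI impI conjI)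
    fix e :: "real^'n" assume e: "norm e = 1"
    let ?f = "\<lambda>w. norm (w - e) powr (b - real CARD('n))"
    let ?h = "\<lambda>w. indicator punctured_ball w *\<^sub>R ?f w"
    have hm: "?h \<in> borel_measurable borel"
      by (intro borel_measurable_scaleR borel_measurable_indicator powr_real_measurable borel_measurable_norm) auto
    have le: "\<bar>?h w\<bar> \<le> g (w - e)" for w
    proof (cases "w \<in> punctured_ball")
      case True
      then have "norm (w - e) < 2" using norm_triangle_ineq4[of w e] e by simp
      then show ?thesis unfolding g_def by (simp add: indicator_def)
    qed (simp add: g_def)
    have hi: "integrable lborel ?h"
    proof (rule Bochner_Integration.integrable_bound[OF integrable_shift(1)[OF gi, of e]])
      show "AE w in lborel. norm (?h w) \<le> norm (g (w - e))" using le by (intro AE_I2) (simp add: order_trans[OF _ abs_ge_self])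
    qed (use hm in simp)
    then show "integrable (restrict_space lborel punctured_ball) ?f" by (subst integrable_restrict_space) auto
    have "(\<integral>w. ?f w \<partial>restrict_space lborel punctured_ball) = (\<integral>w. ?h w \<partial>lborel)" by (rule integral_restrict_space) auto
    also have "\<dots> \<le> (\<integral>w. g (w - e) \<partial>lborel)"
      by (rule Bochner_Integration.integral_mono[OF hi integrable_shift(1)[OF gi]]) (use le abs_le_D1 in blast)
    finally show "(\<integral>w. ?f w \<partial>restrict_space lborel punctured_ball) \<le> (\<integral>x. g x \<partial>lborel)"
      unfolding integrable_shift(2)[OF gi] .
  qed
qed

section \<open>Homogeneous kernels\<close>

text \<open>For s = a - n the last condition reads a > 1 and says that the gradient, of degree s -
  1, is locally integrable. The bound on an annulus with exponent 0 is the C^1 bound from which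
  homogeneity recovers K and its gradient everywhere off the origin.\<close>

locale homogeneous_kernel =
  fixes K :: "real ^ 'n::finite \<Rightarrow> real" and s A :: real
  assumes hom: "\<And>t x. 0 < t \<Longrightarrow> x \<noteq> 0 \<Longrightarrow> K (t *\<^sub>R x) = t powr s * K x"
    and K0: "K 0 = 0"
    and bd: "holder_bd 1 0 (ann (1/8) 4) A K"
    and pos: "0 < s - 1 + real CARD('n)"
begin

abbreviation "dK \<equiv> \<lambda>m. partials [m] K"

lemma A0: "0 \<le> A"
proof -
  obtain i :: 'n where True by simp
  have "axis i 1 \<in> (ann (1/8) 4 :: (real^'n) set)" by simp
  then show ?thesis using bd_nonneg[OF bd] by blast
qed

lemma diff_K:
  assumes "x \<noteq> 0"
  shows "K differentiable (at x)" and "0 < t \<Longrightarrow> dK m (t *\<^sub>R x) = t powr (s - 1) * dK m x"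
proof -
  have d1: "K differentiable (at y)" if "norm y = 1" for y
    using bd_partial(2)[OF open_ann, of 0 0 "1/8" 4 A K y] bd that by simp
  have d: "K differentiable (at y)" if "y \<noteq> 0" for y
  proof -
    have "K differentiable (at (norm y *\<^sub>R (y /\<^sub>R norm y)))"
      by (rule homogeneous_derivative(1)[where a = "norm y powr s", OF _ d1]) (use hom that in auto)
    then show ?thesis using that by simp
  qed
  then show "K differentiable (at x)" using assms .
  assume t: "0 < t"
  have "dK m (t *\<^sub>R x) = t powr s / t * dK m x"
    by (rule homogeneous_derivative(2)[OF _ d[OF assms] assms t]) (use hom t in auto)
  then show "dK m (t *\<^sub>R x) = t powr (s - 1) * dK m x" using t by (simp add: powr_diff)
qed

lemma K_der: "x \<noteq> 0 \<Longrightarrow> (K has_derivative lin_form dK x) (at x)"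
  by (rule differentiable_lin_form[OF diff_K(1)])

lemma K_bound: "\<bar>K x\<bar> \<le> A * norm x powr s"
proof (cases "x = 0")
  case False
  have "\<bar>K (x /\<^sub>R norm x)\<bar> \<le> A" using bd_hold0[OF bd] False unfolding hold0_def by auto
  then have "norm x powr s * \<bar>K (x /\<^sub>R norm x)\<bar> \<le> norm x powr s * A" by (rule mult_left_mono) simp
  moreover have "K x = norm x powr s * K (x /\<^sub>R norm x)" using hom[of "norm x" "x /\<^sub>R norm x"] False by simp
  then have "\<bar>K x\<bar> = norm x powr s * \<bar>K (x /\<^sub>R norm x)\<bar>" by (simp only: abs_mult abs_of_nonneg[OF powr_ge_zero])
  ultimately show ?thesis by (simp only: mult.commute)
qed (simp add: K0)

lemma dK_bd: "holder_bd 0 0 (ann (1/8) 4) A (dK m)"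
  using bd_partial(1)[OF open_ann, of 0 0 "1/8" 4 A K m] bd by simp

lemma dK_bound: "x \<noteq> 0 \<Longrightarrow> \<bar>dK m x\<bar> \<le> A * norm x powr (s - 1)"
proof -
  assume x: "x \<noteq> 0"
  have "\<bar>dK m (x /\<^sub>R norm x)\<bar> \<le> A" using bd_hold0[OF dK_bd, of m] x unfolding hold0_def by (simp del: partials.simps)
  then have "norm x powr (s - 1) * \<bar>dK m (x /\<^sub>R norm x)\<bar> \<le> norm x powr (s - 1) * A" by (rule mult_left_mono) simp
  moreover have "dK m x = norm x powr (s - 1) * dK m (x /\<^sub>R norm x)" using diff_K(2)[of "x /\<^sub>R norm x" "norm x"] x by (simp del: partials.simps)
  then have "\<bar>dK m x\<bar> = norm x powr (s - 1) * \<bar>dK m (x /\<^sub>R norm x)\<bar>" by (simp only: abs_mult abs_of_nonneg[OF powr_ge_zero])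
  ultimately show ?thesis by (simp only: mult.commute)
qed

lemma dK_cont: "continuous_on (- {0}) (dK m)"
proof -
  have "isCont (dK m) x" if x: "x \<noteq> 0" for x
  proof -
    have "continuous_on (ann (1/8) 4) (dK m)" using bd_hold0[OF dK_bd] unfolding hold0_def by blast
    then have "\<forall>y\<in>ann (1/8) 4. isCont (dK m) y" by (simp only: continuous_on_eq_continuous_at[OF open_ann])
    moreover have "x /\<^sub>R norm x \<in> ann (1/8) 4" using x by simp
    ultimately have "isCont (dK m) (x /\<^sub>R norm x)" by (rule bspec)
    then have "isCont (\<lambda>y. norm x powr (s - 1) * dK m (y /\<^sub>R norm x)) x"
      using x by (intro continuous_intros isCont_o2[of x "\<lambda>y. y /\<^sub>R norm x" "dK m"]) auto
    moreover have "\<forall>\<^sub>F y in nhds x. norm x powr (s - 1) * dK m (y /\<^sub>R norm x) = dK m y"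
    proof -
      have "\<forall>\<^sub>F y in nhds x. y \<in> - {0}" using x by (intro eventually_nhds_in_open) auto
      then show ?thesis
      proof (rule eventually_mono)
        fix y :: "real ^ 'n" assume "y \<in> - {0}"
        then have "dK m (norm x *\<^sub>R (y /\<^sub>R norm x)) = norm x powr (s - 1) * dK m (y /\<^sub>R norm x)" using x by (intro diff_K(2)) auto
        then show "norm x powr (s - 1) * dK m (y /\<^sub>R norm x) = dK m y" using x by (simp del: partials.simps)
      qed
    qed
    ultimately show ?thesis using isCont_cong by fastforce
  qed
  then show ?thesis by (intro continuous_at_imp_continuous_on) auto
qed

lemma K_cont: "continuous_on (- {0}) K"
  by (intro continuous_at_imp_continuous_on ballI has_derivative_continuous[OF K_der]) auto

lemma borel_off_zero:
  fixes f :: "real ^ 'n \<Rightarrow> real"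
  assumes "continuous_on (- {0}) f"
  shows "f \<in> borel_measurable borel"
proof -
  have "(\<lambda>x. indicator (- {0}) x *\<^sub>R f x + f 0 * indicator {0} x) \<in> borel_measurable borel"
    by (intro borel_measurable_add borel_measurable_times borel_measurable_continuous_on_indicator assms borel_measurable_indicator) auto
  moreover have "(\<lambda>x. indicator (- {0}) x *\<^sub>R f x + f 0 * indicator {0} x) = f" by (rule ext) (auto simp: indicator_def)
  ultimately show ?thesis by simp
qed

lemma K_meas[measurable]: "K \<in> borel_measurable borel" and dK_meas[measurable]: "dK m \<in> borel_measurable borel"
  by (rule borel_off_zero[OF K_cont]) (rule borel_off_zero[OF dK_cont])

text \<open>The Frechet remainder of z \<mapsto> K(y - z) for the increment h, written at x = y - z;
  this explains the signs.\<close>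

definition quot :: "real ^ 'n \<Rightarrow> real ^ 'n \<Rightarrow> real" where
  "quot h x = (K (x - h) - K x + lin_form dK x h) / norm h"

text \<open>After scaling x to the unit sphere, x - h stays away from the origin and the Lipschitz
  bound of K applies; scaling back gives a bound independent of h.\<close>

lemma quot_far:
  assumes x: "x \<noteq> 0" and h: "h \<noteq> 0" "2 * norm h \<le> norm x"
  shows "\<bar>quot h x\<bar> \<le> 2 * real CARD('n) * A * norm x powr (s - 1)"
proof -
  define y where "y = x /\<^sub>R norm x"
  define h' where "h' = h /\<^sub>R norm x"
  have ny: "norm y = 1" using x unfolding y_def by simp
  have nh: "norm h' \<le> 1/2" using h x unfolding h'_def by (simp add: field_simps)
  \<comment> \<open>Radius 3/4 leaves room for y - h', since |h'| \<le> 1/2, and still avoids the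
    inner ball of radius 1/8.\<close>
  have sub: "ball y (3/4) \<subseteq> ann (1/8) 4"
  proof
    fix z assume "z \<in> ball y (3/4)"
    then have "norm (y - z) < 3/4" by (simp add: dist_norm)
    then show "z \<in> ann (1/8) 4" using ny norm_triangle_ineq2[of y "y - z"] norm_triangle_ineq2[of z y] norm_minus_commute[of y z] by auto
  qed
  have "holder_bd (Suc 0) 0 (ball y (3/4)) A K" using bd_subset[OF bd sub] by simp
  from bd_lipschitz[OF convex_ball this, of "y - h'" y] nh
  have "\<bar>K (y - h') - K y\<bar> \<le> real CARD('n) * A * norm h'" by (simp add: dist_norm)
  moreover have "K (x - h) - K x = norm x powr s * (K (y - h') - K y)"
  proof -
    have "y - h' \<noteq> 0" using ny nh by auto
    moreover have "x - h = norm x *\<^sub>R (y - h')" "x = norm x *\<^sub>R y" using x unfolding y_def h'_def by (auto simp: scaleR_diff_right)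
    moreover have "y \<noteq> 0" using ny by auto
    ultimately show ?thesis using hom[of "norm x" "y - h'"] hom[of "norm x" y] x by (simp add: right_diff_distrib)
  qed
  ultimately have "\<bar>K (x - h) - K x\<bar> \<le> norm x powr s * (real CARD('n) * A * norm h')"
    by (simp add: abs_mult mult_left_mono)
  also have "\<dots> = real CARD('n) * A * norm x powr (s - 1) * norm h"
    using x unfolding h'_def by (simp add: powr_diff divide_inverse mult_ac)
  finally have 1: "\<bar>K (x - h) - K x\<bar> \<le> real CARD('n) * A * norm x powr (s - 1) * norm h" .
  have 2: "\<bar>lin_form dK x h\<bar> \<le> real CARD('n) * (A * norm x powr (s - 1)) * norm h"
    by (rule lin_form_bound[of dK x, OF dK_bound[OF x]])
  have "\<bar>K (x - h) - K x + lin_form dK x h\<bar> \<le> 2 * real CARD('n) * A * norm x powr (s - 1) * norm h"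
    using 1 2 by (simp add: mult_ac del: partials.simps)
  then show ?thesis unfolding quot_def using h(1) by (simp add: abs_divide divide_le_eq del: partials.simps)
qed

text \<open>No cancellation is available so close to the singularity. Instead |x| and |x - h| are at
  most multiples of |h|, which lets one factor of each power |.|^s be traded for the |h| in the
  denominator.\<close>

lemma quot_near:
  assumes x: "x \<noteq> 0" and h: "h \<noteq> 0" "norm x < 2 * norm h"
  shows "\<bar>quot h x\<bar> \<le> (2 + real CARD('n)) * A * norm x powr (s - 1) + 3 * A * norm (x - h) powr (s - 1)"
proof -
  have p: "norm v powr s \<le> c * norm h * norm v powr (s - 1)" if "norm v \<le> c * norm h" for v :: "real^'n" and c
  proof (cases "v = 0")
    case False
    then have "norm v powr s = norm v * norm v powr (s - 1)" by (simp add: powr_diff)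
    also have "\<dots> \<le> c * norm h * norm v powr (s - 1)" using that by (intro mult_right_mono) auto
    finally show ?thesis .
  qed simp
  have xh: "norm (x - h) \<le> 3 * norm h" using norm_triangle_ineq4[of x h] h by simp
  have "\<bar>K (x - h)\<bar> \<le> A * (3 * norm h * norm (x - h) powr (s - 1))"
    by (rule order_trans[OF K_bound mult_left_mono[OF p[OF xh] A0]])
  moreover have "\<bar>K x\<bar> \<le> A * (2 * norm h * norm x powr (s - 1))"
    by (rule order_trans[OF K_bound mult_left_mono[OF p A0]]) (use h in simp)
  moreover have "\<bar>lin_form dK x h\<bar> \<le> real CARD('n) * (A * norm x powr (s - 1)) * norm h"
    by (rule lin_form_bound[of dK x, OF dK_bound[OF x]])
  ultimately have "\<bar>K (x - h) - K x + lin_form dK x h\<bar> \<le>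
      ((2 + real CARD('n)) * A * norm x powr (s - 1) + 3 * A * norm (x - h) powr (s - 1)) * norm h"
    by (simp add: algebra_simps del: partials.simps)
  then show ?thesis unfolding quot_def using h(1) by (simp add: abs_divide divide_le_eq del: partials.simps)
qed

lemma sing_integrable: "integrable lborel (\<lambda>x::real^'n. indicator (ball 0 D) x * norm x powr (s - 1))"
  using integrable_norm_powr[OF pos, where 'a = "real^'n" and D = D] by (simp add: algebra_simps)

lemma sing_small:
  assumes "\<rho> \<longlonglongrightarrow> 0"
  shows "(\<lambda>n. \<integral>(x::real^'n). indicator (ball 0 (\<rho> n)) x * norm x powr (s - 1) \<partial>lborel) \<longlonglongrightarrow> 0"
proof -
  have "\<exists>B>0. \<forall>n. norm (\<rho> n) \<le> B" using convergent_imp_Bseq[OF convergentI[OF assms]] by (simp only: Bseq_def)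
  then obtain B where B0: "\<forall>n. norm (\<rho> n) \<le> B" by blast
  have B: "\<rho> n \<le> B" for n using B0[THEN spec, of n] by simp
  have "(\<lambda>n. \<integral>(x::real^'n). indicator (ball 0 (\<rho> n)) x * norm x powr (s - 1) \<partial>lborel) \<longlonglongrightarrow> (\<integral>(x::real^'n). 0 \<partial>lborel)"
  proof (rule integral_dominated_convergence[OF _ _ sing_integrable[of B]])
    show "(\<lambda>x::real^'n. indicator (ball 0 (\<rho> n)) x * norm x powr (s - 1)) \<in> borel_measurable lborel" for n
      using sing_integrable[of "\<rho> n"] by auto
    show "AE (x::real^'n) in lborel. (\<lambda>n. indicator (ball 0 (\<rho> n)) x * norm x powr (s - 1)) \<longlonglongrightarrow> 0"
      using AE_lborel_singleton[of 0]
    proof (rule eventually_mono)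
      fix x :: "real^'n" assume "x \<noteq> 0"
      then have "\<forall>\<^sub>F n in sequentially. \<rho> n < norm x" using order_tendstoD(2)[OF assms, of "norm x"] by simp
      then have "\<forall>\<^sub>F n in sequentially. indicator (ball 0 (\<rho> n)) x * norm x powr (s - 1) = 0" by (rule eventually_mono) (simp add: indicator_def)
      then show "(\<lambda>n. indicator (ball 0 (\<rho> n)) x * norm x powr (s - 1)) \<longlonglongrightarrow> 0" by (rule tendsto_eventually)
    qed
    show "AE (x::real^'n) in lborel. norm (indicator (ball 0 (\<rho> n)) x * norm x powr (s - 1)) \<le> indicator (ball 0 B) x * norm x powr (s - 1)" for n
      using B[of n] by (intro AE_I2) (auto simp: indicator_def)
  qed auto
  then show ?thesis by simp
qed

text \<open>The singularity at x = h moves with h, so dominated convergence does not apply to the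
  whole quotient. It does on |x| \<ge> 2 |h|; the rest is bounded by integrable singularities over
  balls shrinking to a point.\<close>

lemma quot_integral:
  assumes X: "X \<longlonglongrightarrow> 0" "\<And>n. X n \<noteq> (0 :: real^'n)"
  shows "(\<lambda>n. \<integral>x. indicator (ball 0 D) x * \<bar>quot (X n) x\<bar> \<partial>lborel) \<longlonglongrightarrow> 0"
    and "integrable lborel (\<lambda>x. indicator (ball 0 D) x * \<bar>quot (X n) x\<bar>)"
proof -
  define g :: "real \<Rightarrow> real^'n \<Rightarrow> real" where "g = (\<lambda>\<rho> x. indicator (ball 0 \<rho>) x * norm x powr (s - 1))"
  define u where "u n x = indicator {x. 2 * norm (X n) \<le> norm x} x * (indicator (ball 0 D) x * \<bar>quot (X n) x\<bar>)" for n x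
  \<comment> \<open>The radii 2 |h| and 3 |h| fit the region |x| < 2 |h|, where also |x - h| < 3
    |h|.\<close>
  define v where "v n x = (2 + real CARD('n)) * A * g (2 * norm (X n)) x + 3 * A * g (3 * norm (X n)) (x - X n)" for n x
  have [measurable]: "indicator (ball (0::real^'n) r) \<in> borel_measurable borel" for r :: real
    by (intro borel_measurable_indicator) auto
  have [measurable]: "indicator {x::real^'n. c \<le> norm x} \<in> borel_measurable borel" for c :: real
    by (intro borel_measurable_indicator) measurable
  have qm[measurable]: "quot h \<in> borel_measurable borel" for h
    unfolding quot_def by (intro borel_measurable_divide borel_measurable_add borel_measurable_diff borel_measurable_sum borel_measurable_times
      measurable_compose[OF _ K_meas] K_meas dK_meas) auto
  have gi: "integrable lborel (g \<rho>)" for \<rho> unfolding g_def by (rule sing_integrable)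
  have um: "u n \<in> borel_measurable borel" for n unfolding u_def by measurable
  have ub: "AE x in lborel. norm (u n x) \<le> 2 * real CARD('n) * A * g D x" for n
    using AE_lborel_singleton[of 0]
  proof (rule eventually_mono)
    fix x :: "real^'n" assume "x \<noteq> 0"
    then show "norm (u n x) \<le> 2 * real CARD('n) * A * g D x"
      using quot_far[of x "X n"] X(2)[of n] A0 unfolding u_def g_def by (auto simp: indicator_def)
  qed
  have ui: "integrable lborel (u n)" for n
    by (rule Bochner_Integration.integrable_bound[of _ "\<lambda>x. 2 * real CARD('n) * A * g D x"])
      (use gi um ub[of n] in \<open>auto elim!: eventually_mono\<close>)
  have ulim: "(\<lambda>n. \<integral>x. u n x \<partial>lborel) \<longlonglongrightarrow> (\<integral>(x::real^'n). 0 \<partial>lborel)"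
  proof (rule integral_dominated_convergence[where w = "\<lambda>x. 2 * real CARD('n) * A * g D x"])
    show "AE x in lborel. (\<lambda>n. u n x) \<longlonglongrightarrow> 0"
      using AE_lborel_singleton[of 0]
    proof (rule eventually_mono)
      fix x :: "real^'n" assume x: "x \<noteq> 0"
      have "((\<lambda>h. norm (K (x + h) - K x - lin_form dK x h) / norm h) \<longlongrightarrow> 0) (at 0)"
        using K_der[OF x] unfolding has_derivative_at by (elim conjE)
      moreover have "(\<lambda>n. - X n) \<longlonglongrightarrow> 0" using tendsto_minus[OF X(1)] by simp
      ultimately have "(\<lambda>n. norm (K (x + - X n) - K x - lin_form dK x (- X n)) / norm (- X n)) \<longlonglongrightarrow> 0"
        using X(2) unfolding tendsto_at_iff_sequentially comp_def by (elim allE[of _ "\<lambda>n. - X n"]) (simp del: partials.simps)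
      moreover have "norm (K (x + - X n) - K x - lin_form dK x (- X n)) / norm (- X n) = \<bar>quot (X n) x\<bar>" for n
        unfolding quot_def by (simp add: abs_divide sum_negf del: partials.simps)
      ultimately have q0: "(\<lambda>n. \<bar>quot (X n) x\<bar>) \<longlonglongrightarrow> 0" by simp
      show "(\<lambda>n. u n x) \<longlonglongrightarrow> 0"
        by (rule tendsto_sandwich[OF _ _ tendsto_const q0]) (auto simp: u_def indicator_def)
    qed
  qed (use gi um ub in auto)
  have vi: "integrable lborel (v n)" for n unfolding v_def by (intro Bochner_Integration.integrable_add integrable_mult_right gi integrable_shift)
  have vlim: "(\<lambda>n. \<integral>x. v n x \<partial>lborel) \<longlonglongrightarrow> 0"
  proof -
    have "(\<integral>x. v n x \<partial>lborel) = (2 + real CARD('n)) * A * (\<integral>x. g (2 * norm (X n)) x \<partial>lborel) + 3 * A * (\<integral>x. g (3 * norm (X n)) x \<partial>lborel)" for n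
      unfolding v_def using gi integrable_shift[OF gi] by simp
    moreover have nX: "(\<lambda>n. c * norm (X n)) \<longlonglongrightarrow> 0" for c using tendsto_mult_right_zero[OF tendsto_norm_zero[OF X(1)]] .
    have "(\<lambda>n. \<integral>x. g (c * norm (X n)) x \<partial>lborel) \<longlonglongrightarrow> 0" for c unfolding g_def by (rule sing_small[OF nX])
    then have "(\<lambda>n. (2 + real CARD('n)) * A * (\<integral>x. g (2 * norm (X n)) x \<partial>lborel) + 3 * A * (\<integral>x. g (3 * norm (X n)) x \<partial>lborel)) \<longlonglongrightarrow> 0"
      by (intro tendsto_add_zero tendsto_mult_right_zero)
    ultimately show ?thesis by simp
  qed
  have le: "AE x in lborel. indicator (ball 0 D) x * \<bar>quot (X n) x\<bar> \<le> u n x + v n x" for n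
    using AE_lborel_singleton[of 0]
  proof (rule eventually_mono)
    fix x :: "real^'n" assume x: "x \<noteq> 0"
    have v0: "0 \<le> v n x" unfolding v_def g_def using A0 by (intro add_nonneg_nonneg mult_nonneg_nonneg) auto
    show "indicator (ball 0 D) x * \<bar>quot (X n) x\<bar> \<le> u n x + v n x"
    proof (cases "2 * norm (X n) \<le> norm x")
      case True
      then show ?thesis using v0 unfolding u_def by simp
    next
      case False
      then have "norm (x - X n) < 3 * norm (X n)" using norm_triangle_ineq4[of x "X n"] by linarith
      then have "v n x = (2 + real CARD('n)) * A * norm x powr (s - 1) + 3 * A * norm (x - X n) powr (s - 1)"
        using False unfolding v_def g_def by simp
      then have "\<bar>quot (X n) x\<bar> \<le> v n x" using quot_near[OF x X(2)[of n]] False by simp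
      then show ?thesis using v0 unfolding u_def using False by (auto simp: indicator_def)
    qed
  qed
  have main: "integrable lborel (\<lambda>x. indicator (ball 0 D) x * \<bar>quot (X n) x\<bar>)" for n
  proof (rule Bochner_Integration.integrable_bound[OF Bochner_Integration.integrable_add[OF ui vi]])
    show "AE x in lborel. norm (indicat_real (ball 0 D) x * \<bar>quot (X n) x\<bar>) \<le> norm (u n x + v n x)"
      using le[of n] by (rule eventually_mono) (auto simp: abs_mult indicator_def)
  qed measurable
  then show "integrable lborel (\<lambda>x. indicator (ball 0 D) x * \<bar>quot (X n) x\<bar>)" .
  have "(\<integral>x. indicator (ball 0 D) x * \<bar>quot (X n) x\<bar> \<partial>lborel) \<le> (\<integral>x. u n x \<partial>lborel) + (\<integral>x. v n x \<partial>lborel)" for n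
    using integral_mono_AE[OF main Bochner_Integration.integrable_add[OF ui vi] le] Bochner_Integration.integral_add[OF ui vi] by simp
  then have up: "\<forall>\<^sub>F n in sequentially. (\<integral>x. indicator (ball 0 D) x * \<bar>quot (X n) x\<bar> \<partial>lborel) \<le> (\<integral>x. u n x \<partial>lborel) + (\<integral>x. v n x \<partial>lborel)"
    by simp
  have lo: "\<forall>\<^sub>F n in sequentially. 0 \<le> (\<integral>x. indicator (ball 0 D) x * \<bar>quot (X n) x\<bar> \<partial>lborel)"
    by (intro always_eventually allI Bochner_Integration.integral_nonneg) (auto simp: indicator_def)
  have "(\<lambda>n. (\<integral>x. u n x \<partial>lborel) + (\<integral>x. v n x \<partial>lborel)) \<longlonglongrightarrow> 0"
    using tendsto_add[OF ulim vlim] by simp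
  from tendsto_sandwich[OF lo up tendsto_const this]
  show "(\<lambda>n. \<integral>x. indicator (ball 0 D) x * \<bar>quot (X n) x\<bar> \<partial>lborel) \<longlonglongrightarrow> 0" .
qed

text \<open>With \<phi> bounded, the remainder of the potential is at most sup |\<phi>| times the
  integral of |\<open>quot\<close>|, which tends to 0. Smoothness of \<phi> is not involved, and z
  may lie anywhere, in particular on the boundary of \<Omega>.\<close>

lemma potential_has_derivative:
  fixes \<Omega> :: "(real ^ 'n) set" and \<phi> :: "real ^ 'n \<Rightarrow> real"
  assumes \<Omega>: "bounded \<Omega>" and \<phi>m: "(\<lambda>y. indicator \<Omega> y * \<phi> y) \<in> borel_measurable borel"
    and \<phi>b: "\<And>y. y \<in> \<Omega> \<Longrightarrow> \<bar>\<phi> y\<bar> \<le> B"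
  shows "((\<lambda>z. LINT y:\<Omega>|lborel. K (y - z) * \<phi> y) has_derivative
    lin_form (\<lambda>m z. - (LINT y:\<Omega>|lborel. dK m (y - z) * \<phi> y)) z) (at z)"
proof -
  let ?\<psi> = "\<lambda>y. indicator \<Omega> y * \<phi> y"
  have \<psi>b: "\<bar>?\<psi> y\<bar> \<le> max B 0" for y using \<phi>b[of y] by (auto simp: indicator_def)
  have \<psi>int: "integrable lborel (\<lambda>y. f (y - z) * ?\<psi> y)"
    if f: "f \<in> borel_measurable borel" "\<And>x. x \<noteq> 0 \<Longrightarrow> \<bar>f x\<bar> \<le> C * norm x powr p" "0 < p + real CARD('n)" for f C p z
  proof -
    obtain D where D: "\<And>y. y \<in> \<Omega> \<Longrightarrow> norm y < D" using \<Omega> unfolding bounded_pos_less by blast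
    let ?g = "\<lambda>x::real^'n. indicator (ball 0 (D + norm z)) x * norm x powr p"
    have gi: "integrable lborel ?g" using integrable_norm_powr[OF f(3), where 'a = "real^'n" and D = "D + norm z"] by simp
    show ?thesis
    proof (rule Bochner_Integration.integrable_bound[OF integrable_mult_right[OF integrable_shift(1)[OF gi, of z], of "C * max B 0"]])
      show "(\<lambda>y. f (y - z) * ?\<psi> y) \<in> borel_measurable lborel"
        using measurable_compose[OF _ f(1), of "\<lambda>y. y - z" borel] \<phi>m by simp
      show "AE y in lborel. norm (f (y - z) * ?\<psi> y) \<le> norm (C * max B 0 * ?g (y - z))"
        using AE_lborel_singleton[of z]
      proof (rule eventually_mono)
        fix y assume y: "y \<noteq> z"
        show "norm (f (y - z) * ?\<psi> y) \<le> norm (C * max B 0 * ?g (y - z))"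
        proof (cases "y \<in> \<Omega>")
          case True
          then have "norm (y - z) < D + norm z" using D[OF True] norm_triangle_ineq4[of y z] by linarith
          then have "?g (y - z) = norm (y - z) powr p" by (simp add: indicator_def)
          moreover have "\<bar>f (y - z)\<bar> * \<bar>?\<psi> y\<bar> \<le> (C * norm (y - z) powr p) * max B 0"
            using f(2)[of "y - z"] y \<psi>b[of y] by (intro mult_mono) (auto intro: order_trans[OF abs_ge_zero])
          moreover have "(C * norm (y - z) powr p) * max B 0 \<le> \<bar>C * max B 0 * norm (y - z) powr p\<bar>"
            using abs_ge_self[of "C * max B 0 * norm (y - z) powr p"] by (simp only: mult_ac)
          ultimately show ?thesis by (simp only: real_norm_def abs_mult[of "f (y - z)"])
        qed simp
      qed
    qed
  qed
  let ?n = "\<lambda>z. \<integral>y. K (y - z) * ?\<psi> y \<partial>lborel"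
  let ?P = "\<lambda>m z. - (\<integral>y. dK m (y - z) * ?\<psi> y \<partial>lborel)"
  have Ki: "integrable lborel (\<lambda>y. K (y - z) * ?\<psi> y)" for z
    by (rule \<psi>int[OF K_meas, of A s]) (use K_bound pos in auto)
  have dKi: "integrable lborel (\<lambda>y. dK m (y - z) * ?\<psi> y)" for z m
    by (rule \<psi>int[OF dK_meas dK_bound]) (use pos in auto)
  obtain D where D: "\<And>y. y \<in> \<Omega> \<Longrightarrow> norm y < D" using \<Omega> unfolding bounded_pos_less by blast
  have "((\<lambda>h. norm (?n (z + h) - ?n z - lin_form ?P z h) / norm h) \<longlongrightarrow> 0) (at 0)"
    unfolding tendsto_at_iff_sequentially comp_def
  proof (intro allI impI)
    fix X :: "nat \<Rightarrow> real ^ 'n" assume X0: "\<forall>n. X n \<in> UNIV - {0}" "X \<longlonglongrightarrow> 0"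
    then have X: "X \<longlonglongrightarrow> 0" "\<And>n. X n \<noteq> 0" by auto
    let ?D = "D + norm z"
    let ?q = "\<lambda>n x. indicator (ball 0 ?D) x * \<bar>quot (X n) x\<bar>"
    have eq: "(?n (z + h) - ?n z - lin_form ?P z h) / norm h = (\<integral>y. quot h (y - z) * ?\<psi> y \<partial>lborel)" for h
    proof -
      have "(\<integral>y. quot h (y - z) * ?\<psi> y \<partial>lborel) = (\<integral>y. (K (y - (z + h)) * ?\<psi> y - K (y - z) * ?\<psi> y +
          (\<Sum>m\<in>UNIV. dK m (y - z) * ?\<psi> y * h $ m)) / norm h \<partial>lborel)"
        unfolding quot_def
        by (intro Bochner_Integration.integral_cong refl)
          (simp add: algebra_simps sum_distrib_left sum_distrib_right diff_divide_distrib add_divide_distrib del: partials.simps)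
      also have "\<dots> = ((?n (z + h) - ?n z) + (\<Sum>m\<in>UNIV. (\<integral>y. dK m (y - z) * ?\<psi> y \<partial>lborel) * h $ m)) / norm h"
        using Ki dKi by (simp del: partials.simps)
      finally show ?thesis by (simp add: sum_negf del: partials.simps)
    qed
    have le: "norm (?n (z + X n) - ?n z - lin_form ?P z (X n)) / norm (X n) \<le> max B 0 * (\<integral>x. ?q n x \<partial>lborel)" for n
    proof -
      have qi: "integrable lborel (\<lambda>y. max B 0 * ?q n (y - z))" by (intro integrable_mult_right integrable_shift quot_integral(2)[OF X])
      have pt: "\<bar>quot (X n) (y - z) * ?\<psi> y\<bar> \<le> max B 0 * ?q n (y - z)" for y
      proof (cases "y \<in> \<Omega>")
        case True
        then have "norm (y - z) < ?D" using D[OF True] norm_triangle_ineq4[of y z] by linarith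
        then have "?q n (y - z) = \<bar>quot (X n) (y - z)\<bar>" by (simp add: indicator_def)
        then show ?thesis using \<psi>b[of y] unfolding abs_mult by (metis abs_ge_zero mult.commute mult_left_mono)
      qed (simp add: indicator_def)
      have "norm (?n (z + X n) - ?n z - lin_form ?P z (X n)) / norm (X n) = \<bar>\<integral>y. quot (X n) (y - z) * ?\<psi> y \<partial>lborel\<bar>"
        unfolding eq[symmetric] by (simp add: abs_divide)
      also have "\<dots> \<le> (\<integral>y. \<bar>quot (X n) (y - z) * ?\<psi> y\<bar> \<partial>lborel)" by (rule integral_abs_bound)
      also have "\<dots> \<le> (\<integral>y. max B 0 * ?q n (y - z) \<partial>lborel)"
        by (rule integral_mono'[OF qi]) (use pt in auto)
      also have "\<dots> = max B 0 * (\<integral>x. ?q n x \<partial>lborel)"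
        using integrable_shift(2)[OF quot_integral(2)[OF X], of D] integrable_shift(2)[OF quot_integral(2)[OF X, of ?D n], of z] by simp
      finally show ?thesis .
    qed
    have "(\<lambda>n. max B 0 * (\<integral>x. ?q n x \<partial>lborel)) \<longlonglongrightarrow> 0"
      by (rule tendsto_mult_right_zero[OF quot_integral(1)[OF X]])
    from tendsto_sandwich[OF _ _ tendsto_const this]
    show "(\<lambda>n. norm (?n (z + X n) - ?n z - lin_form ?P z (X n)) / norm (X n)) \<longlonglongrightarrow> 0"
      using le by (simp del: partials.simps)
  qed
  then have "(?n has_derivative lin_form ?P z) (at z)" unfolding has_derivative_at by (intro conjI bounded_linear_lin_form)
  moreover have "(LINT y:\<Omega>|lborel. f (y - z) * \<phi> y) = (\<integral>y. f (y - z) * ?\<psi> y \<partial>lborel)" for f :: "real^'n \<Rightarrow> real" and z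
    unfolding set_lebesgue_integral_def by (intro Bochner_Integration.integral_cong refl) (simp add: mult_ac)
  ultimately show ?thesis by (simp only:)
qed

end

section \<open>The potential near a boundary point\<close>

text \<open>The base vector e of the local estimate belongs to the data, so bounds uniform over the
  data are also uniform over the sphere. A single M dominates all five quantities on which the
  constant may depend.\<close>

definition admissible :: "nat \<Rightarrow> nat \<Rightarrow> real \<Rightarrow> real \<Rightarrow>
    ((real ^ 'n::finite) set \<times> (real ^ 'n \<Rightarrow> real) \<times> (real ^ 'n \<Rightarrow> real) \<times> (real ^ 'n)) set" where
  "admissible k l \<alpha> M = {(\<Omega>, \<omega>, \<phi>, e). convex_body \<Omega> \<and> 0 \<in> interior \<Omega> \<and>
     radial \<Omega> \<in> holder_space_sphere k \<alpha> \<and> holder_norm_sphere k \<alpha> (radial \<Omega>) \<le> M \<and> 1 / radial_min \<Omega> \<le> M \<and>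
     \<omega> \<in> holder_space_sphere k \<alpha> \<and> holder_norm_sphere k \<alpha> \<omega> \<le> M \<and>
     \<omega> \<in> holder_space_sphere 1 1 \<and> holder_norm_sphere 1 1 \<omega> \<le> M \<and>
     \<phi> \<in> holder_space_body l \<alpha> \<Omega> \<and> holder_norm_body l \<alpha> \<Omega> \<phi> \<le> M \<and> norm e = 1}"

text \<open>The order of the theorem is \<open>Suc k\<close> here, since k is what remains after one
  derivative. The order l of \<phi> will be k for a > 1 and \<open>Suc k\<close> for a \<le>
  1.\<close>

locale potential_data =
  fixes J :: "((real ^ 'n::finite) set \<times> (real ^ 'n \<Rightarrow> real) \<times> (real ^ 'n \<Rightarrow> real) \<times> (real ^ 'n)) set"
    and k l :: nat and \<alpha> M a :: real
  assumes J_def: "J = admissible (Suc k) l \<alpha> M"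
    and al: "0 \<le> \<alpha>" "\<alpha> \<le> 1" and M1: "1 \<le> M" and lk: "l \<le> Suc k" and a0: "0 < a"
begin

abbreviation "body \<equiv> \<lambda>j :: (real ^ 'n) set \<times> (real ^ 'n \<Rightarrow> real) \<times> (real ^ 'n \<Rightarrow> real) \<times> (real ^ 'n). fst j"
abbreviation "om \<equiv> \<lambda>j :: (real ^ 'n) set \<times> (real ^ 'n \<Rightarrow> real) \<times> (real ^ 'n \<Rightarrow> real) \<times> (real ^ 'n). fst (snd j)"
abbreviation "ph \<equiv> \<lambda>j :: (real ^ 'n) set \<times> (real ^ 'n \<Rightarrow> real) \<times> (real ^ 'n \<Rightarrow> real) \<times> (real ^ 'n). fst (snd (snd j))"
abbreviation "ba \<equiv> \<lambda>j :: (real ^ 'n) set \<times> (real ^ 'n \<Rightarrow> real) \<times> (real ^ 'n \<Rightarrow> real) \<times> (real ^ 'n). snd (snd (snd j))"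

definition "\<nu> = restrict_space lborel (punctured_ball :: (real ^ 'n) set)"
definition "I = {(j, w). j \<in> J \<and> w \<in> space \<nu>}"
definition "s = a - real CARD('n)"
text \<open>The kernel of the potential, positively homogeneous of degree a - n. It vanishes at 0
  because \<open>0 powr s = 0\<close>.\<close>

definition "K j x = hom_ext (om j) x * norm x powr s" for j and x :: "real ^ 'n"

abbreviation "UJ \<equiv> \<lambda>j. ball (ba j) (1/2)"

lemma space_\<nu>: "space \<nu> = punctured_ball"
  unfolding \<nu>_def by (simp add: space_restrict_space)

lemma J_facts:
  assumes "j \<in> J"
  shows "convex_body (body j)" "0 \<in> interior (body j)" "radial (body j) \<in> holder_space_sphere (Suc k) \<alpha>"
    "holder_norm_sphere (Suc k) \<alpha> (radial (body j)) \<le> M" "1 / radial_min (body j) \<le> M"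
    "om j \<in> holder_space_sphere (Suc k) \<alpha>" "holder_norm_sphere (Suc k) \<alpha> (om j) \<le> M"
    "om j \<in> holder_space_sphere 1 1" "holder_norm_sphere 1 1 (om j) \<le> M"
    "ph j \<in> holder_space_body l \<alpha> (body j)" "holder_norm_body l \<alpha> (body j) (ph j) \<le> M" "norm (ba j) = 1"
  using assms unfolding J_def admissible_def by auto

lemma I_facts: "i \<in> I \<Longrightarrow> fst i \<in> J" "i \<in> I \<Longrightarrow> snd i \<noteq> 0 \<and> norm (snd i) < 1"
  unfolding I_def space_\<nu> by auto

lemma radial_fam:
  assumes "0 < c"
  shows "unif_bd (Suc k) \<alpha> (\<lambda>_. ann c C) J (\<lambda>_. 1) (\<lambda>j. hom_ext (radial (body j)))"
proof -
  obtain B where B: "B \<ge> 0" "\<forall>(g :: real ^ 'n \<Rightarrow> real) M. 0 \<le> M \<longrightarrow> g \<in> holder_space_sphere (Suc k) \<alpha> \<longrightarrow>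
    holder_norm_sphere (Suc k) \<alpha> g \<le> M \<longrightarrow> holder_bd (Suc k) \<alpha> (ann c C) (B * M) (hom_ext g)"
    using sphere_in[OF assms al, where k = "Suc k" and D = C] by (elim exE conjE)
  show ?thesis
  proof (rule unif_bdI[of "B * M"])
    show "holder_bd (Suc k) \<alpha> (ann c C) (B * M * 1) (hom_ext (radial (body j)))" if "j \<in> J" for j
      using B(2)[rule_format, OF _ J_facts(3,4)[OF that]] M1 by simp
  qed (use B(1) M1 in simp)
qed

lemma rad_ge: "j \<in> J \<Longrightarrow> v \<noteq> 0 \<Longrightarrow> 1 / M \<le> rad (body j) v"
proof -
  assume j: "j \<in> J" and v: "v \<noteq> 0"
  note c = J_facts(1,2)[OF j]
  have "0 < radial_min (body j)" by (rule radial_min_facts(1)[OF c])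
  then have "1 / M \<le> radial_min (body j)" using J_facts(5)[OF j] M1 by (simp add: field_simps)
  also have "\<dots> \<le> radial (body j) (v /\<^sub>R norm v)" by (rule radial_min_facts(2)[OF c]) (use v in simp)
  finally show ?thesis using v unfolding rad_def hom_ext_def by simp
qed

lemma rad_fam:
  assumes "0 < c"
  shows "unif_bd (Suc k) \<alpha> (\<lambda>_. ann c C) J (\<lambda>_. 1) (\<lambda>j. rad (body j))"
  by (rule unif_bd_cong[OF radial_fam[OF assms, of C] open_ann]) (use assms in \<open>auto simp: rad_def\<close>)

text \<open>Here the dependence on 1/\<rho>_min enters: the bound 1/\<rho>_min \<le> M makes 1/M a
  lower bound of the radial function.\<close>

sublocale rf: radial_family I "\<lambda>i. rad (body (fst i))" "\<lambda>i. ba (fst i)" snd k \<alpha> "1 / M"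
proof
  show "unif_bd (Suc k) \<alpha> (\<lambda>_. ann (1/4) 4) I (\<lambda>_. 1) (\<lambda>i. rad (body (fst i)))"
    using unif_bd_reindex[OF rad_fam[of "1/4" 4], of I fst] I_facts(1) by simp
  show "rad (body (fst i)) (t *\<^sub>R v) = rad (body (fst i)) v" if "i \<in> I" "0 < t" for i t v
    by (rule rad_scale[OF J_facts(1,2)[OF I_facts(1)[OF that(1)]] that(2)])
  show "1 / M \<le> rad (body (fst i)) v" if "i \<in> I" "v \<noteq> 0" for i v by (rule rad_ge[OF I_facts(1)[OF that(1)] that(2)])
qed (use al M1 I_facts J_facts(12) in auto)

lemma r_eq: "rf.r (j, w) = norm (w - ba j)" unfolding rf.r_def by simp

text \<open>Order and exponent are free because \<omega> is used twice, with order
  \<open>Suc k\<close> and exponent \<alpha>, and as a C^{1,1} function.\<close>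

lemma om_fam:
  assumes c: "0 < c" and b: "0 \<le> \<beta>" "\<beta> \<le> 1" and om: "\<And>j. j \<in> J \<Longrightarrow> om j \<in> holder_space_sphere m \<beta>" "\<And>j. j \<in> J \<Longrightarrow> holder_norm_sphere m \<beta> (om j) \<le> M"
  shows "unif_bd m \<beta> (\<lambda>_. ann c C) J (\<lambda>_. 1) K"
proof -
  obtain B where B: "B \<ge> 0" "\<forall>(g :: real ^ 'n \<Rightarrow> real) M. 0 \<le> M \<longrightarrow> g \<in> holder_space_sphere m \<beta> \<longrightarrow>
    holder_norm_sphere m \<beta> g \<le> M \<longrightarrow> holder_bd m \<beta> (ann c C) (B * M) (hom_ext g)"
    using sphere_in[OF c b, where k = m and D = C] by (elim exE conjE)
  have 1: "unif_bd m \<beta> (\<lambda>_. ann c C) J (\<lambda>_. 1) (\<lambda>j. hom_ext (om j))"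
  proof (rule unif_bdI[of "B * M"])
    show "holder_bd m \<beta> (ann c C) (B * M * 1) (hom_ext (om j))" if "j \<in> J" for j
      using B(2)[rule_format, OF _ om[OF that]] M1 by simp
  qed (use B(1) M1 in simp)
  have "unif_bd m 1 (\<lambda>_. ann c C) J (\<lambda>_. 1) (\<lambda>j (x::real^'n). norm x)" by (rule unif_bd_norm[OF c, of _ _ C]) auto
  then have "unif_bd m 1 (\<lambda>_. ann c C) J (\<lambda>_. 1) (\<lambda>j (x::real^'n). norm x powr s)" by (rule unif_bd_powr[OF _ c]) auto
  then have "unif_bd m \<beta> (\<lambda>_. ann c C) J (\<lambda>_. 1) (\<lambda>j (x::real^'n). norm x powr s)"
  proof (rule unif_bd_exp[OF _ b(2), of _ _ _ _ _ "max 1 (2 * C)"])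
    show "dist x y \<le> max 1 (2 * C)" if "x \<in> ann c C" "y \<in> ann c C" for x y :: "real^'n"
      using that norm_triangle_ineq4[of x y] unfolding dist_norm mem_Collect_eq le_max_iff_disj by linarith
  qed auto
  from unif_bd_mult[OF 1 this] show ?thesis unfolding K_def by simp
qed

lemma K_fam: "0 < c \<Longrightarrow> unif_bd (Suc k) \<alpha> (\<lambda>_. ann c C) J (\<lambda>_. 1) K"
  by (rule om_fam[OF _ al J_facts(6,7)])

lemma K_fam1: "0 < c \<Longrightarrow> unif_bd 1 1 (\<lambda>_. ann c C) J (\<lambda>_. 1) K"
  by (rule om_fam[OF _ _ _ J_facts(8,9)]) auto

lemma K_hom: "0 < t \<Longrightarrow> K j (t *\<^sub>R x) = t powr s * K j x"
  unfolding K_def using hom_ext_scale[of t "om j" x] by (simp add: powr_mult)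

lemma K_zero: "K j 0 = 0" unfolding K_def by simp

lemma K_der:
  assumes "j \<in> J" "y \<noteq> 0"
  shows "(K j has_derivative lin_form (\<lambda>m. partials [m] (K j)) y) (at y)"
  by (rule unif_bd_has_derivative[OF K_fam[of "norm y / 2" "2 * norm y"] assms(1) open_ann]) (use assms(2) in auto)

lemma K_kernel:
  assumes "j \<in> J" "0 < s - 1 + real CARD('n)"
  shows "\<exists>A. homogeneous_kernel (K j) s A"
proof -
  obtain A where A: "0 \<le> A" "\<forall>j\<in>J. holder_bd 1 1 (ann (1/8) 4) (A * 1) (K j)" by (rule unif_bdE[OF K_fam1[of "1/8" 4]]) auto
  have "holder_bd 1 0 (ann (1/8) 4) (8 powr (1 - 0) * (A * 1)) (K j)"
  proof (rule bd_exp[OF _ _ _ _ A(2)[THEN bspec, OF assms(1)]])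
    show "dist x y \<le> 8" if "x \<in> ann (1/8) 4" "y \<in> ann (1/8) 4" for x y :: "real^'n"
      using that norm_triangle_ineq4[of x y] by (simp add: dist_norm)
  qed (use A(1) in auto)
  then show ?thesis using K_hom K_zero assms(2) by (intro exI[of _ "8 powr (1 - 0) * (A * 1)"] homogeneous_kernel.intro) auto
qed

text \<open>The radial function bounds the body, and its norm is at most M, so the radius required
  by \<open>body_in\<close> is common to all data.\<close>

lemma body_bounded: "\<exists>D. \<forall>j\<in>J. body j \<subseteq> cball 0 D"
proof -
  obtain C where C: "C \<ge> 0" "\<forall>j\<in>J. \<forall>x\<in>ann (1/4) 4. \<bar>hom_ext (radial (body j)) x\<bar> \<le> C * 1"
    using unif_bd_bound[OF radial_fam[of "1/4" 4]] by auto
  have "norm y \<le> C" if j: "j \<in> J" and y: "y \<in> body j" for j y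
  proof (cases "y = 0")
    case False
    define u where "u = y /\<^sub>R norm y"
    have u: "norm u = 1" unfolding u_def using False by simp
    have "norm y *\<^sub>R u \<in> body j" unfolding u_def using False y by simp
    then have "norm y \<le> radial (body j) u" by (intro radial_facts(3)[OF J_facts(1,2)[OF j] u]) auto
    also have "radial (body j) u = hom_ext (radial (body j)) u" unfolding hom_ext_def using u by simp
    also have "\<dots> \<le> C" using C(2)[THEN bspec, OF j, THEN bspec, of u] u by simp
    finally show ?thesis .
  qed (use C in simp)
  then show ?thesis by (intro exI[of _ C]) auto
qed

lemma ph_fam: "unif_bd l \<alpha> (\<lambda>j. interior (body j)) J (\<lambda>_. 1) ph"
proof -
  obtain D where D: "\<forall>j\<in>J. body j \<subseteq> cball 0 D" using body_bounded by blast
  obtain B where B: "B \<ge> 0" "\<forall>(\<Omega> :: (real ^ 'n) set) \<phi> M. convex_body \<Omega> \<longrightarrow> \<Omega> \<subseteq> cball 0 D \<longrightarrow> 0 \<le> M \<longrightarrow> \<phi> \<in> holder_space_body l \<alpha> \<Omega> \<longrightarrow>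
    holder_norm_body l \<alpha> \<Omega> \<phi> \<le> M \<longrightarrow> holder_bd l \<alpha> (interior \<Omega>) (B * M) \<phi>"
    using body_in[OF al, where D = D and k = l] by (elim exE conjE)
  show ?thesis
  proof (rule unif_bdI[of "B * M"])
    show "holder_bd l \<alpha> (interior (body j)) (B * M * 1) (ph j)" if "j \<in> J" for j
      using B(2)[rule_format, OF J_facts(1)[OF that] D[rule_format, OF that] _ J_facts(10,11)[OF that]] M1 by simp
  qed (use B(1) M1 in simp)
qed

section \<open>The potential as an integral over the fixed ball\<close>

abbreviation "Psi \<equiv> \<lambda>i x. polar_map (body (fst i)) (rot (ba (fst i)) x (snd i))"
abbreviation "bdry \<equiv> \<lambda>j x. polar_map (body j) (rot (ba j) x (ba j))"

lemma Psi_interior: "i \<in> I \<Longrightarrow> Psi i x \<in> interior (body (fst i))"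
proof -
  assume i: "i \<in> I"
  note j = J_facts(1,2)[OF I_facts(1)[OF i]]
  show ?thesis using polar_map_interior[OF j, of "rot (ba (fst i)) x (snd i)"] I_facts(2)[OF i] rf.rot_nz by (simp add: rot_norm)
qed

lemma bdry_not_interior: "j \<in> J \<Longrightarrow> bdry j x \<notin> interior (body j)"
proof -
  assume j: "j \<in> J"
  have "ba j \<noteq> 0" using J_facts(12)[OF j] by auto
  then show ?thesis using polar_map_interior[OF J_facts(1,2)[OF j], of "rot (ba j) x (ba j)"] J_facts(12)[OF j] rf.rot_nz
    by (simp add: rot_norm)
qed

lemma del_eq: "rf.del i x = Psi i x - bdry (fst i) x"
  unfolding rf.del_def polar_map_def ..

text \<open>Density of the body at the point of integration together with the Jacobian of the radial
  substitution; all factors except the kernel.\<close>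

definition "dens i x = ph (fst i) (Psi i x) * rad (body (fst i)) (rot (ba (fst i)) x (snd i)) ^ CARD('n)"

lemma dens_fam: "unif_bd l \<alpha> rf.U I (\<lambda>_. 1) dens"
proof -
  have P: "unif_bd (Suc k) \<alpha> rf.U I (\<lambda>_. 1) (\<lambda>i x. Psi i x $ m)" for m
    using rf.Psi_comp[of m] unfolding polar_map_def .
  obtain L where L: "0 \<le> L" "\<forall>i\<in>I. \<forall>x\<in>rf.U i. \<forall>y\<in>rf.U i. dist (Psi i x) (Psi i y) \<le> L * dist x y powr 1"
    using unif_bd_Suc_lipschitz[of k \<alpha> rf.U I Psi, OF P rf.convU] by (elim exE conjE)
  have "unif_bd l (\<alpha> * 1) rf.U I (\<lambda>_. 1) (\<lambda>i x. ph (fst i) (Psi i x))"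
  proof (rule unif_bd_compose[where V = "\<lambda>i. interior (body (fst i))", OF _ _ L(1)])
    show "unif_bd l \<alpha> (\<lambda>i. interior (body (fst i))) I (\<lambda>_. 1) (\<lambda>i. ph (fst i))"
      by (rule unif_bd_reindex[OF ph_fam I_facts(1)])
    show "unif_bd l (\<alpha> * 1) rf.U I (\<lambda>_. 1) (\<lambda>i x. Psi i x $ m)" for m using unif_bd_le[OF P lk] by simp
  qed (use L(2) al Psi_interior in auto)
  then have 1: "unif_bd l \<alpha> rf.U I (\<lambda>_. 1) (\<lambda>i x. ph (fst i) (Psi i x))" by (simp only: mult_1_right)
  from unif_bd_mult[OF 1 unif_bd_power[OF unif_bd_le[OF rf.q_T lk], of "CARD('n)"]]
  show ?thesis unfolding dens_def by simp
qed

lemma rad_cont: "j \<in> J \<Longrightarrow> continuous_on (- {0}) (rad (body j))"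
proof -
  assume j: "j \<in> J"
  have "continuous_on (- {0}) (hom_ext (radial (body j)))"
    using J_facts(3)[OF j] unfolding holder_space_sphere_def Ck_on_def by (auto dest: spec[of _ "[]"])
  then show ?thesis by (rule continuous_on_eq) (simp add: rad_def)
qed

lemma ph_meas: "j \<in> J \<Longrightarrow> (\<lambda>y. indicator (body j) y * ph j y) \<in> borel_measurable borel"
  and ph_bound: "j \<in> J \<Longrightarrow> \<exists>B. \<forall>y\<in>body j. \<bar>ph j y\<bar> \<le> B"
  and ph_cont: "j \<in> J \<Longrightarrow> continuous_on (interior (body j)) (ph j)"
proof -
  assume j: "j \<in> J"
  have c: "continuous_on (body j) (ph j)" using J_facts(10)[OF j] unfolding holder_space_body_def by auto
  have "compact (body j)" using J_facts(1)[OF j] unfolding convex_body_def by auto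
  then have "bounded (ph j ` body j)" using c by (intro compact_imp_bounded compact_continuous_image)
  then show "\<exists>B. \<forall>y\<in>body j. \<bar>ph j y\<bar> \<le> B" unfolding bounded_iff by auto
  have "(\<lambda>y. indicator (body j) y *\<^sub>R ph j y) \<in> borel_measurable borel"
    by (rule borel_measurable_continuous_on_indicator[OF _ c]) (use \<open>compact (body j)\<close> in \<open>auto intro: borel_closed compact_imp_closed\<close>)
  then show "(\<lambda>y. indicator (body j) y * ph j y) \<in> borel_measurable borel" by simp
  show "continuous_on (interior (body j)) (ph j)" by (rule continuous_on_subset[OF c interior_subset])
qed

text \<open>Stated for a general f because it is applied to the kernel and to its partial
  derivatives. Measurability in w comes from continuity: on the punctured ball the point of
  integration is interior and the boundary point is not, so f is never evaluated at 0.\<close>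

lemma transform_potential:
  assumes j: "j \<in> J" and f: "continuous_on (- {0}) f" "f \<in> borel_measurable borel"
  shows "(LINT y:body j|lborel. f (y - bdry j x) * ph j y) = (\<integral>w. f (rf.del (j, w) x) * dens (j, w) x \<partial>\<nu>)"
    and "(\<lambda>w. f (rf.del (j, w) x) * dens (j, w) x) \<in> borel_measurable \<nu>"
proof -
  let ?F = "\<lambda>y. f (y - bdry j x) * ph j y" and ?R = "rot (ba j) x"
  have "continuous_on (- {0}) (hom_ext (radial (body j)))"
    using J_facts(3)[OF j] unfolding holder_space_sphere_def Ck_on_def by (auto dest: spec[of _ "[]"])
  moreover have fc: "continuous_on (interior (body j)) (\<lambda>y. f (y - bdry j x))"
    by (rule continuous_on_compose2[OF f(1)]) (use bdry_not_interior[OF j, of x] in \<open>auto intro!: continuous_intros\<close>)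
  moreover have "(\<lambda>y. indicator (body j) y *\<^sub>R ?F y) \<in> borel_measurable borel"
  proof -
    have "(\<lambda>y. f (y - bdry j x) * (indicator (body j) y * ph j y)) \<in> borel_measurable borel"
      using measurable_compose[OF _ f(2), of "\<lambda>y. y - bdry j x" borel] ph_meas[OF j] by simp
    then show ?thesis by (simp add: mult_ac)
  qed
  ultimately have "(LINT y:body j|lborel. ?F y) = (\<integral>w. ?F (polar_map (body j) (?R w)) * rad (body j) (?R w) ^ CARD('n) \<partial>\<nu>)"
    unfolding \<nu>_def by (intro integral_body_polar[OF J_facts(1,2)[OF j] _ rot_linear rot_surj rot_norm] continuous_on_mult ph_cont[OF j])
  then show "(LINT y:body j|lborel. ?F y) = (\<integral>w. f (rf.del (j, w) x) * dens (j, w) x \<partial>\<nu>)"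
    unfolding del_eq dens_def by (simp add: mult.assoc)
  have Rc: "continuous_on punctured_ball ?R"
    by (intro linear_continuous_on) (simp add: rot_linear linear_conv_bounded_linear[symmetric])
  have nz: "?R ` punctured_ball \<subseteq> - {0}"
  proof
    fix y assume "y \<in> ?R ` punctured_ball"
    then obtain w where "y = ?R w" "w \<noteq> 0" by auto
    then show "y \<in> - {0}" using rf.rot_nz[of w "ba j" x] by simp
  qed
  have qc: "continuous_on punctured_ball (\<lambda>w. rad (body j) (?R w))" by (rule continuous_on_compose2[OF rad_cont[OF j] Rc nz])
  have Pc: "continuous_on punctured_ball (\<lambda>w. polar_map (body j) (?R w))"
    unfolding polar_map_def by (intro continuous_on_scaleR qc Rc)
  have Pi: "(\<lambda>w. polar_map (body j) (?R w)) ` punctured_ball \<subseteq> interior (body j)"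
  proof
    fix y assume "y \<in> (\<lambda>w. polar_map (body j) (?R w)) ` punctured_ball"
    then obtain w where w: "w \<in> punctured_ball" "y = polar_map (body j) (?R w)" by blast
    then have "(j, w) \<in> I" using j unfolding I_def space_\<nu> by simp
    from Psi_interior[OF this, of x] show "y \<in> interior (body j)" using w(2) by simp
  qed
  have "continuous_on punctured_ball (\<lambda>w. f (rf.del (j, w) x) * dens (j, w) x)"
    unfolding del_eq dens_def fst_conv snd_conv
    by (intro continuous_on_mult continuous_on_power qc continuous_on_compose2[OF ph_cont[OF j] Pc Pi]
      continuous_on_compose2[OF fc Pc Pi])
  from borel_measurable_continuous_on_restrict[OF this]
  show "(\<lambda>w. f (rf.del (j, w) x) * dens (j, w) x) \<in> borel_measurable \<nu>"
    unfolding \<nu>_def by (simp add: measurable_cong_sets[OF sets_restrict_space_cong[OF sets_lborel] refl])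
qed

definition "pot j z = (LINT y:body j|lborel. K j (y - z) * ph j y)"

lemma N_op_eq: "N_op (body j) (om j) (ph j) a z = pot j z"
  unfolding N_op_def pot_def K_def hom_ext_def s_def set_lebesgue_integral_def
proof (intro Bochner_Integration.integral_cong refl arg_cong2[of _ _ _ _ "(*\<^sub>R)"])
  fix y
  have "norm (y - z) powr (a - real CARD('n)) = inverse (norm (y - z) powr (real CARD('n) - a))"
    using powr_minus[of "norm (y - z)" "real CARD('n) - a"] by simp
  then show "om j ((y - z) /\<^sub>R norm (y - z)) * (ph j y / norm (y - z) powr (real CARD('n) - a)) =
    om j ((y - z) /\<^sub>R norm (y - z)) * norm (y - z) powr (a - real CARD('n)) * ph j y"
    by (simp add: divide_inverse mult_ac)
qed

text \<open>In the ball around e the rotation sends e to x/|x|, so \<open>bdry j x\<close> is the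
  boundary point in direction x, and the extension of degree 0 becomes a function of x given by one
  formula.\<close>

lemma target_eq:
  assumes j: "j \<in> J" and x: "x \<in> UJ j"
  shows "hom_ext (on_sphere (body j) (N_op (body j) (om j) (ph j) a)) x = pot j (bdry j x)"
proof -
  have x0: "x \<noteq> 0" using ball_inner_pos[OF J_facts(12)[OF j] x] by auto
  have "bdry j x = radial (body j) (x /\<^sub>R norm x) *\<^sub>R (x /\<^sub>R norm x)"
    unfolding rot_base(1)[OF J_facts(12)[OF j] x] polar_map_def rad_def hom_ext_def using x0 by simp
  then show ?thesis unfolding hom_ext_def on_sphere_def N_op_eq by simp
qed

lemma K_cont: "j \<in> J \<Longrightarrow> continuous_on (- {0}) (K j)"
  by (intro continuous_at_imp_continuous_on ballI has_derivative_continuous[OF K_der]) auto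

lemma K_meas: "j \<in> J \<Longrightarrow> K j \<in> borel_measurable borel"
proof -
  assume j: "j \<in> J"
  have "(\<lambda>x. indicator (- {0}) x *\<^sub>R K j x) \<in> borel_measurable borel"
    by (rule borel_measurable_continuous_on_indicator[OF _ K_cont[OF j]]) auto
  moreover have "(\<lambda>x. indicator (- {0}) x *\<^sub>R K j x) = K j" by (rule ext) (auto simp: indicator_def K_zero)
  ultimately show ?thesis by simp
qed

section \<open>Regularity of the transformed integrand\<close>

lemma del_r: "i \<in> I \<Longrightarrow> rf.del i x = rf.r i *\<^sub>R rf.eta i x"
  unfolding rf.eta_def using rf.r_bounds(1) by (simp add: less_imp_neq[symmetric])

lemma K_del: "i \<in> I \<Longrightarrow> K (fst i) (rf.del i x) = rf.r i powr s * K (fst i) (rf.eta i x)"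
  unfolding del_r by (rule K_hom[OF rf.r_bounds(1)])

lemma eta_nz: "i \<in> I \<Longrightarrow> x \<in> rf.U i \<Longrightarrow> rf.eta i x \<noteq> 0"
proof -
  assume i: "i \<in> I" "x \<in> rf.U i"
  obtain c C where c: "0 < c" "\<forall>i\<in>I. \<forall>x\<in>rf.U i. c < norm (rf.eta i x) \<and> norm (rf.eta i x) < C"
    using rf.eta_bounds by (elim exE conjE)
  have "0 < norm (rf.eta i x)" using c(1) c(2)[THEN bspec, OF i(1), THEN bspec, OF i(2)] by linarith
  then show ?thesis by simp
qed

lemma K_eta: "unif_bd k \<alpha> rf.U I (\<lambda>_. 1) (\<lambda>i x. K (fst i) (rf.eta i x))"
proof (rule rf.kernel_eta)
  fix c C :: real assume c: "0 < c"
  show "unif_bd k \<alpha> (\<lambda>_. ann c C) I (\<lambda>_. 1) (\<lambda>i. K (fst i))"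
    by (rule unif_bd_reindex[OF unif_bd_le[OF K_fam[OF c]] I_facts(1)]) auto
  show "unif_bd 0 1 (\<lambda>_. ann c C) I (\<lambda>_. 1) (\<lambda>i. K (fst i))"
    by (rule unif_bd_reindex[OF unif_bd_le[OF K_fam1[OF c]] I_facts(1)]) auto
qed

text \<open>Differentiating the kernel costs one order, which matches the order k available for
  \<open>eta\<close>. The Lipschitz bound asked for by \<open>kernel_eta\<close> is the C^{1,1}
  hypothesis on \<omega>.\<close>

lemma dK_eta: "unif_bd k \<alpha> rf.U I (\<lambda>_. 1) (\<lambda>i x. partials [m] (K (fst i)) (rf.eta i x))"
proof (rule rf.kernel_eta)
  fix c C :: real assume c: "0 < c"
  show "unif_bd k \<alpha> (\<lambda>_. ann c C) I (\<lambda>_. 1) (\<lambda>i. partials [m] (K (fst i)))"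
    by (rule unif_bd_reindex[OF unif_bd_partial[OF K_fam[OF c] open_ann] I_facts(1)])
  show "unif_bd 0 1 (\<lambda>_. ann c C) I (\<lambda>_. 1) (\<lambda>i. partials [m] (K (fst i)))"
    by (rule unif_bd_reindex[OF unif_bd_partial[OF K_fam1[OF c, unfolded One_nat_def] open_ann] I_facts(1)])
qed

text \<open>The only test of convergence in what follows: a weight |w - e| powr (b - n) may be
  integrated for b > 0, with a bound common to all base vectors.\<close>

lemma integrate_family:
  assumes f: "unif_bd m \<beta> rf.U I (\<lambda>i. rf.r i powr (b - real CARD('n))) f" and b: "0 < b"
    and meas: "\<And>j x. j \<in> J \<Longrightarrow> x \<in> UJ j \<Longrightarrow> (\<lambda>w. f (j, w) x) \<in> borel_measurable \<nu>"
  shows "unif_bd m \<beta> UJ J (\<lambda>_. 1) (\<lambda>j x. \<integral>w. f (j, w) x \<partial>\<nu>)"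
proof -
  obtain C where C: "\<forall>e::real^'n. norm e = 1 \<longrightarrow> integrable \<nu> (\<lambda>w. norm (w - e) powr (b - real CARD('n))) \<and>
    (\<integral>w. norm (w - e) powr (b - real CARD('n)) \<partial>\<nu>) \<le> C" using singular_weight[OF b] unfolding \<nu>_def by (elim exE)
  have "(\<lambda>(j, w). UJ j) = rf.U" by (rule ext) (simp add: case_prod_unfold)
  then have "unif_bd m \<beta> (\<lambda>(j, w). UJ j) {(j, w). j \<in> J \<and> w \<in> space \<nu>} (\<lambda>i. rf.r i powr (b - real CARD('n))) f"
    using f unfolding I_def by simp
  then have "unif_bd m \<beta> UJ J (\<lambda>_. C) (\<lambda>j x. \<integral>w. f (j, w) x \<partial>\<nu>)"
  proof (rule unif_bd_integral)
    show "integrable \<nu> (\<lambda>w. rf.r (j, w) powr (b - real CARD('n)))" "(\<integral>w. rf.r (j, w) powr (b - real CARD('n)) \<partial>\<nu>) \<le> C" if "j \<in> J" for j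
      unfolding r_eq using C J_facts(12)[OF that] by auto
  qed (use meas in auto)
  then show ?thesis by (rule unif_bd_weight[of _ _ _ _ _ _ "max C 0"]) auto
qed

text \<open>One x-derivative is computed by the chain rule and the other k are left to the calculus
  of families: the gradient of K at \<open>eta\<close> is bounded to order k, and so are the first
  derivatives of \<delta>, by \<open>del_interp\<close>.\<close>

lemma small_exponent:
  assumes l: "l = Suc k" and a: "a \<le> 1" and al': "0 < \<alpha>'" "\<alpha>' < \<alpha> + a - 1"
  shows "unif_bd (Suc k) \<alpha>' UJ J (\<lambda>_. 1) (\<lambda>j. hom_ext (on_sphere (body j) (N_op (body j) (om j) (ph j) a)))"
proof -
  \<comment> \<open>The derivative carries the powers s from the kernel, -1 from normalising
    \<delta>, and \<alpha> - \<alpha>' from \<open>del_interp\<close>. They add up to b - n, so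
    integrability means b > 0.\<close>
  define b where "b = \<alpha> + a - 1 - \<alpha>'"
  have b0: "0 < b" and ba: "b \<le> a" and aa: "\<alpha>' \<le> \<alpha>" using al' al a unfolding b_def by auto
  let ?wt = "\<lambda>i. rf.r i powr (b - real CARD('n))"
  let ?pd = "\<lambda>i p m. partials [p] (\<lambda>x. rf.del i x $ m)"
  let ?f' = "\<lambda>i p x. rf.r i powr s * (\<Sum>m\<in>UNIV. partials [m] (K (fst i)) (rf.eta i x) * (inverse (rf.r i) * ?pd i p m x))"
  have Kd: "unif_bd (Suc k) \<alpha>' rf.U I ?wt (\<lambda>i x. K (fst i) (rf.del i x))"
  proof -
    obtain C where C: "C \<ge> 0" "\<forall>i\<in>I. \<forall>x\<in>rf.U i. \<bar>K (fst i) (rf.eta i x)\<bar> \<le> C * 1"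
      using unif_bd_bound[OF K_eta] by (elim exE conjE)
    \<comment> \<open>The bound B rests on
      \<open>r powr s = r powr (a - b) * r powr (b - n)\<close>, with r < 2 and b \<le> a.\<close>
    show ?thesis
    proof (rule unif_bd_SucI[where f' = ?f' and B = "C * 2 powr (a - b)"])
      show "\<alpha>' \<le> 1" using aa al by simp
      show "dist x y \<le> 1" if "x \<in> rf.U i" "y \<in> rf.U i" for i x y using rf.diamU[OF that] .
      show "convex (rf.U i)" for i by (rule rf.convU)
      fix i x assume i: "i \<in> I" and x: "x \<in> rf.U i"
      have r: "0 < rf.r i" "rf.r i < 2" using rf.r_bounds[OF i] by auto
      have d: "((\<lambda>x. rf.eta i x $ m) has_derivative lin_form (\<lambda>p x. inverse (rf.r i) * ?pd i p m x) x) (at x)" for m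
        using has_derivative_mult_right[OF unif_bd_has_derivative[OF rf.del_comp[of m] i rf.opU x], of "inverse (rf.r i)"]
        unfolding rf.eta_def by (simp add: sum_distrib_left mult.assoc del: partials.simps)
      have "rf.eta i x \<noteq> 0" by (rule eta_nz[OF i x])
      let ?g = "\<lambda>p x. \<Sum>m\<in>UNIV. partials [m] (K (fst i)) (rf.eta i x) * (inverse (rf.r i) * ?pd i p m x)"
      have "((\<lambda>x. K (fst i) (rf.eta i x)) has_derivative lin_form ?g x) (at x)"
        by (rule compose_form[of "rf.eta i" "\<lambda>m p x. inverse (rf.r i) * ?pd i p m x" x "K (fst i)" "\<lambda>m. partials [m] (K (fst i))",
          OF d K_der[OF I_facts(1)[OF i] \<open>rf.eta i x \<noteq> 0\<close>]])
      then have "((\<lambda>x. rf.r i powr s * K (fst i) (rf.eta i x)) has_derivative (\<lambda>h. rf.r i powr s * lin_form ?g x h)) (at x)"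
        by (rule has_derivative_mult_right)
      moreover have "(\<lambda>h. rf.r i powr s * lin_form ?g x h) = lin_form (?f' i) x"
        by (rule ext) (subst sum_distrib_left, simp only: mult.assoc)
      ultimately have "((\<lambda>x. rf.r i powr s * K (fst i) (rf.eta i x)) has_derivative lin_form (?f' i) x) (at x)" by (simp only:)
      then show "((\<lambda>x. K (fst i) (rf.del i x)) has_derivative lin_form (?f' i) x) (at x)" unfolding K_del[OF i] .
      have "rf.r i powr s = rf.r i powr (a - b) * ?wt i" unfolding s_def by (simp add: powr_add[symmetric])
      also have "\<dots> \<le> 2 powr (a - b) * ?wt i" using r ba by (intro mult_right_mono powr_mono2) auto
      finally have "rf.r i powr s \<le> 2 powr (a - b) * ?wt i" .
      then have "rf.r i powr s * \<bar>K (fst i) (rf.eta i x)\<bar> \<le> (2 powr (a - b) * ?wt i) * (C * 1)"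
        using C(2)[THEN bspec, OF i, THEN bspec, OF x] by (intro mult_mono) auto
      then show "\<bar>K (fst i) (rf.del i x)\<bar> \<le> C * 2 powr (a - b) * ?wt i"
        unfolding K_del[OF i] by (simp add: abs_mult mult_ac)
    next
      fix p
      have 1: "unif_bd k \<alpha>' rf.U I (\<lambda>_. 1) (\<lambda>i x. partials [m] (K (fst i)) (rf.eta i x))" for m
        by (rule unif_bd_exp[OF dK_eta aa rf.diamU]) auto
      have 2: "unif_bd k \<alpha>' rf.U I (\<lambda>i. rf.r i powr (\<alpha> - \<alpha>')) (\<lambda>i. ?pd i p m)" for m
        by (rule unif_bd_partial[OF rf.del_interp rf.opU]) (use al' aa in auto)
      have 3: "unif_bd k \<alpha>' rf.U I (\<lambda>i. \<bar>inverse (rf.r i)\<bar> * rf.r i powr (\<alpha> - \<alpha>')) (\<lambda>i x. inverse (rf.r i) * ?pd i p m x)" for m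
        by (rule unif_bd_scale[OF 2])
      have "unif_bd k \<alpha>' rf.U I (\<lambda>i. \<bar>inverse (rf.r i)\<bar> * rf.r i powr (\<alpha> - \<alpha>'))
         (\<lambda>i x. partials [m] (K (fst i)) (rf.eta i x) * (inverse (rf.r i) * ?pd i p m x))" for m
        using unif_bd_mult[OF 1[of m] 3[of m]] by (simp del: partials.simps)
      from unif_bd_scale[OF unif_bd_sum[OF finite_class.finite_UNIV this], of "\<lambda>i. rf.r i powr s"]
      have "unif_bd k \<alpha>' rf.U I (\<lambda>i. \<bar>rf.r i powr s\<bar> * (\<bar>inverse (rf.r i)\<bar> * rf.r i powr (\<alpha> - \<alpha>'))) (\<lambda>i. ?f' i p)"
        by (simp del: partials.simps)
      then show "unif_bd k \<alpha>' rf.U I ?wt (\<lambda>i. ?f' i p)"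
      proof (rule unif_bd_weight[of _ _ _ _ _ _ 1])
        fix i assume i: "i \<in> I"
        have r: "0 < rf.r i" using rf.r_bounds[OF i] by auto
        have "\<bar>rf.r i powr s\<bar> * (\<bar>inverse (rf.r i)\<bar> * rf.r i powr (\<alpha> - \<alpha>')) = rf.r i powr s * (rf.r i powr (-1) * rf.r i powr (\<alpha> - \<alpha>'))"
          using r by (simp add: powr_minus)
        also have "\<dots> = ?wt i" unfolding powr_add[symmetric] s_def b_def by (simp add: algebra_simps)
        finally show "\<bar>rf.r i powr s\<bar> * (\<bar>inverse (rf.r i)\<bar> * rf.r i powr (\<alpha> - \<alpha>')) \<le> 1 * ?wt i" by simp
      qed simp
    qed (use C in auto)
  qed
  have "unif_bd (Suc k) \<alpha>' rf.U I (\<lambda>_. 1) dens"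
    by (rule unif_bd_exp[OF dens_fam[unfolded l] aa rf.diamU]) auto
  from unif_bd_mult[OF Kd this]
  have "unif_bd (Suc k) \<alpha>' rf.U I ?wt (\<lambda>i x. K (fst i) (rf.del i x) * dens i x)" by simp
  from integrate_family[OF this b0]
  have "unif_bd (Suc k) \<alpha>' UJ J (\<lambda>_. 1) (\<lambda>j x. \<integral>w. K j (rf.del (j, w) x) * dens (j, w) x \<partial>\<nu>)"
    using transform_potential(2)[OF _ K_cont K_meas] by simp
  then show ?thesis
    by (rule unif_bd_cong) (simp_all add: target_eq pot_def transform_potential(1)[OF _ K_cont K_meas] del: mem_ball)
qed

text \<open>The target is the potential composed with the boundary point. Its gradient at that point
  is again an integral over the ball, with weight r powr (a - 1 - n), and is needed only to order k.
  The remaining factor, the derivative of the boundary point, has order k and exponent \<alpha> as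
  well, so nothing is lost.\<close>

lemma large_exponent:
  assumes l: "l = k" and a: "1 < a"
  shows "unif_bd (Suc k) \<alpha> UJ J (\<lambda>_. 1) (\<lambda>j. hom_ext (on_sphere (body j) (N_op (body j) (om j) (ph j) a)))"
proof -
  have s1: "0 < s - 1 + real CARD('n)" unfolding s_def using a by simp
  define P where "P m j z = - (LINT y:body j|lborel. partials [m] (K j) (y - z) * ph j y)" for m j z
  have dKc: "continuous_on (- {0}) (partials [m] (K j))" and dKm: "partials [m] (K j) \<in> borel_measurable borel"
    and dKh: "y \<noteq> 0 \<Longrightarrow> 0 < t \<Longrightarrow> partials [m] (K j) (t *\<^sub>R y) = t powr (s - 1) * partials [m] (K j) y"
    and pot_der: "(pot j has_derivative lin_form (\<lambda>m. P m j) z) (at z)" if j: "j \<in> J" for j m y t z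
  proof -
    obtain A where "homogeneous_kernel (K j) s A" using K_kernel[OF j s1] by blast
    then interpret hk: homogeneous_kernel "K j" s A .
    show "continuous_on (- {0}) (partials [m] (K j))" by (rule hk.dK_cont)
    show "partials [m] (K j) \<in> borel_measurable borel" by (rule hk.dK_meas)
    show "y \<noteq> 0 \<Longrightarrow> 0 < t \<Longrightarrow> partials [m] (K j) (t *\<^sub>R y) = t powr (s - 1) * partials [m] (K j) y" by (rule hk.diff_K(2))
    obtain B where B: "\<forall>y\<in>body j. \<bar>ph j y\<bar> \<le> B" using ph_bound[OF j] by blast
    have "bounded (body j)" using J_facts(1)[OF j] unfolding convex_body_def by (auto intro: compact_imp_bounded)
    from hk.potential_has_derivative[OF this ph_meas[OF j] B[rule_format]]
    show "(pot j has_derivative lin_form (\<lambda>m. P m j) z) (at z)" unfolding pot_def P_def by simp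
  qed
  have Pfam: "unif_bd k \<alpha> UJ J (\<lambda>_. 1) (\<lambda>j x. P m j (bdry j x))" for m
  proof -
    have 1: "unif_bd k \<alpha> rf.U I (\<lambda>i. \<bar>rf.r i powr (s - 1)\<bar> * (1 * 1)) (\<lambda>i x. rf.r i powr (s - 1) * (partials [m] (K (fst i)) (rf.eta i x) * dens i x))"
    proof -
      have "unif_bd k \<alpha> rf.U I (\<lambda>i. 1 * 1) (\<lambda>i x. partials [m] (K (fst i)) (rf.eta i x) * dens i x)"
        by (rule unif_bd_mult[OF dK_eta dens_fam[unfolded l]]) auto
      then show ?thesis by (rule unif_bd_scale[where c = "\<lambda>i. rf.r i powr (s - 1)"])
    qed
    have "unif_bd k \<alpha> rf.U I (\<lambda>i. rf.r i powr ((a - 1) - real CARD('n))) (\<lambda>i x. partials [m] (K (fst i)) (rf.del i x) * dens i x)"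
    proof (rule unif_bd_cong)
      show "unif_bd k \<alpha> rf.U I (\<lambda>i. rf.r i powr ((a - 1) - real CARD('n))) (\<lambda>i x. rf.r i powr (s - 1) * (partials [m] (K (fst i)) (rf.eta i x) * dens i x))"
        using 1 unfolding s_def by (simp add: algebra_simps del: partials.simps)
      fix i x assume i: "i \<in> I" "x \<in> rf.U i"
      have "rf.eta i x \<noteq> 0" by (rule eta_nz[OF i])
      then show "rf.r i powr (s - 1) * (partials [m] (K (fst i)) (rf.eta i x) * dens i x) = partials [m] (K (fst i)) (rf.del i x) * dens i x"
        unfolding del_r[OF i(1)] using dKh[OF I_facts(1)[OF i(1)] _ rf.r_bounds(1)[OF i(1)]] by (simp add: mult.assoc del: partials.simps)
    qed (rule rf.opU)
    from integrate_family[OF this]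
    have "unif_bd k \<alpha> UJ J (\<lambda>_. 1) (\<lambda>j x. \<integral>w. partials [m] (K j) (rf.del (j, w) x) * dens (j, w) x \<partial>\<nu>)"
      using transform_potential(2)[OF _ dKc dKm] a by (simp del: partials.simps)
    from unif_bd_scale[OF this, of "\<lambda>_. -1"]
    have "unif_bd k \<alpha> UJ J (\<lambda>_. 1) (\<lambda>j x. - 1 * (\<integral>w. partials [m] (K j) (rf.del (j, w) x) * dens (j, w) x \<partial>\<nu>))" by (simp del: partials.simps)
    then show ?thesis
      by (rule unif_bd_cong) (simp_all add: P_def transform_potential(1)[OF _ dKc dKm] del: mem_ball partials.simps)
  qed
  have bd0: "\<exists>C\<ge>0. \<forall>j\<in>J. \<forall>x\<in>UJ j. \<bar>pot j (bdry j x)\<bar> \<le> C * 1"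
  proof -
    have "unif_bd k \<alpha> rf.U I (\<lambda>i. \<bar>rf.r i powr s\<bar> * (1 * 1)) (\<lambda>i x. rf.r i powr s * (K (fst i) (rf.eta i x) * dens i x))"
    proof -
      have "unif_bd k \<alpha> rf.U I (\<lambda>i. 1 * 1) (\<lambda>i x. K (fst i) (rf.eta i x) * dens i x)"
        by (rule unif_bd_mult[OF K_eta dens_fam[unfolded l]]) auto
      then show ?thesis by (rule unif_bd_scale[where c = "\<lambda>i. rf.r i powr s"])
    qed
    then have "unif_bd k \<alpha> rf.U I (\<lambda>i. rf.r i powr (a - real CARD('n))) (\<lambda>i x. rf.r i powr s * (K (fst i) (rf.eta i x) * dens i x))"
      unfolding s_def by simp
    then have "unif_bd k \<alpha> rf.U I (\<lambda>i. rf.r i powr (a - real CARD('n))) (\<lambda>i x. K (fst i) (rf.del i x) * dens i x)"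
      by (rule unif_bd_cong) (simp_all add: K_del mult.assoc)
    from integrate_family[OF this a0]
    have "unif_bd k \<alpha> UJ J (\<lambda>_. 1) (\<lambda>j x. \<integral>w. K j (rf.del (j, w) x) * dens (j, w) x \<partial>\<nu>)"
      using transform_potential(2)[OF _ K_cont K_meas] by simp
    from unif_bd_bound[OF this] show ?thesis
      unfolding pot_def by (simp add: transform_potential(1)[OF _ K_cont K_meas] del: mem_ball)
  qed
  have E: "unif_bd (Suc k) \<alpha> UJ J (\<lambda>_. 1) (\<lambda>j x. bdry j x $ m)" for m
  proof -
    \<comment> \<open>The boundary point does not involve w, but \<open>rf.E_comp\<close> is indexed
      by pairs; half the base vector is a convenient point of the punctured ball.\<close>
    have "(j, (1/2) *\<^sub>R ba j) \<in> I" if "j \<in> J" for j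
      using J_facts(12)[OF that] that unfolding I_def space_\<nu> by auto
    from unif_bd_reindex[OF rf.E_comp this, of J "\<lambda>j. j" m] show ?thesis unfolding polar_map_def by simp
  qed
  obtain C where C: "C \<ge> 0" "\<forall>j\<in>J. \<forall>x\<in>UJ j. \<bar>pot j (bdry j x)\<bar> \<le> C * 1" using bd0 by (elim exE conjE)
  let ?f' = "\<lambda>j p x. \<Sum>m\<in>UNIV. P m j (bdry j x) * partials [p] (\<lambda>x. bdry j x $ m) x"
  have "unif_bd (Suc k) \<alpha> UJ J (\<lambda>_. 1) (\<lambda>j x. pot j (bdry j x))"
  proof (rule unif_bd_SucI[where f' = ?f' and B = C])
    show "\<bar>pot j (bdry j x)\<bar> \<le> C * 1" if "j \<in> J" "x \<in> UJ j" for j x using C(2) that by blast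
    show "dist x y \<le> 1" if "x \<in> UJ j" "y \<in> UJ j" for j x y using ball_dist_le_1[OF that] .
    show "((\<lambda>x. pot j (bdry j x)) has_derivative lin_form (?f' j) x) (at x)" if "j \<in> J" "x \<in> UJ j" for j x
      by (rule compose_form[of "bdry j" "\<lambda>m p. partials [p] (\<lambda>x. bdry j x $ m)" x "pot j" "\<lambda>m. P m j",
          OF unif_bd_has_derivative[OF E that(1) open_ball that(2)] pot_der[OF that(1)]])
    show "unif_bd k \<alpha> UJ J (\<lambda>_. 1) (\<lambda>j. ?f' j p)" for p
      using unif_bd_sum[OF finite_class.finite_UNIV, of k \<alpha> UJ J "\<lambda>_. 1" "\<lambda>m j x. P m j (bdry j x) * partials [p] (\<lambda>x. bdry j x $ m) x"]
        unif_bd_mult[OF Pfam unif_bd_partial[OF E open_ball, of p]] by (simp del: partials.simps)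
  qed (use al C in auto)
  then show ?thesis by (rule unif_bd_cong) (simp_all add: target_eq del: mem_ball)
qed

lemma uniform_estimate:
  assumes f: "unif_bd (Suc k) \<beta> UJ J (\<lambda>_. 1) (\<lambda>j. hom_ext (on_sphere (body j) (N_op (body j) (om j) (ph j) a)))"
    and b: "0 \<le> \<beta>" "\<beta> \<le> 1"
  shows "\<exists>C>0. \<forall>\<Omega> \<omega> \<phi>. (\<forall>e. norm e = 1 \<longrightarrow> (\<Omega>, \<omega>, \<phi>, e) \<in> J) \<longrightarrow>
    on_sphere \<Omega> (N_op \<Omega> \<omega> \<phi> a) \<in> holder_space_sphere (Suc k) \<beta> \<and>
    holder_norm_sphere (Suc k) \<beta> (on_sphere \<Omega> (N_op \<Omega> \<omega> \<phi> a)) \<le> C"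
proof -
  obtain C where C: "0 \<le> C" "\<forall>j\<in>J. holder_bd (Suc k) \<beta> (UJ j) (C * 1) (hom_ext (on_sphere (body j) (N_op (body j) (om j) (ph j) a)))"
    by (rule unif_bdE[OF f])
  show ?thesis
  \<comment> \<open>The constant is that of \<open>sphere_out\<close>; the added 1 makes it positive
    even if C = 0.\<close>
  proof (intro exI[of _ "(real (Suc k) + 5) * C + 1"] conjI allI impI)
    show "0 < (real (Suc k) + 5) * C + 1" using C(1) by (simp add: add_nonneg_pos)
    fix \<Omega> \<omega> \<phi> assume J: "\<forall>e. norm e = 1 \<longrightarrow> (\<Omega>, \<omega>, \<phi>, e) \<in> J"
    have bd: "holder_bd (Suc k) \<beta> (ball e (1/2)) C (hom_ext (on_sphere \<Omega> (N_op \<Omega> \<omega> \<phi> a)))" if "norm e = 1" for e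
      using C(2)[THEN bspec, OF J[rule_format, OF that]] by simp
    show "on_sphere \<Omega> (N_op \<Omega> \<omega> \<phi> a) \<in> holder_space_sphere (Suc k) \<beta>" by (rule sphere_out(1)[OF bd b C(1)])
    show "holder_norm_sphere (Suc k) \<beta> (on_sphere \<Omega> (N_op \<Omega> \<omega> \<phi> a)) \<le> (real (Suc k) + 5) * C + 1"
      using sphere_out(2)[OF bd b C(1)] by simp
  qed
qed

end


section \<open>Dependence of the constants, and conclusion\<close>

lemma choose_constants:
  fixes H G :: "'x \<Rightarrow> bool" and N p\<^sub>1 p\<^sub>2 p\<^sub>3 p\<^sub>4 p\<^sub>5 :: "'x \<Rightarrow> real"
  assumes "\<And>M. 1 \<le> M \<Longrightarrow> \<exists>C>0. \<forall>x. H x \<and> p\<^sub>1 x \<le> M \<and> p\<^sub>2 x \<le> M \<and> p\<^sub>3 x \<le> M \<and> p\<^sub>4 x \<le> M \<and> p\<^sub>5 x \<le> M \<longrightarrow>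
    G x \<and> N x \<le> C"
  shows "\<exists>C. (\<forall>p q r s t. (0::real) < C p q r s t) \<and> (\<forall>x. H x \<longrightarrow> G x \<and> N x \<le> C (p\<^sub>1 x) (p\<^sub>2 x) (p\<^sub>3 x) (p\<^sub>4 x) (p\<^sub>5 x))"
proof -
  have "\<forall>M. \<exists>C. 1 \<le> M \<longrightarrow> 0 < C \<and> (\<forall>x. H x \<and> p\<^sub>1 x \<le> M \<and> p\<^sub>2 x \<le> M \<and> p\<^sub>3 x \<le> M \<and> p\<^sub>4 x \<le> M \<and> p\<^sub>5 x \<le> M \<longrightarrow>
    G x \<and> N x \<le> C)" using assms by blast
  from choice[OF this] obtain F where F: "\<forall>M. 1 \<le> M \<longrightarrow> 0 < F M \<and> (\<forall>x. H x \<and> p\<^sub>1 x \<le> M \<and> p\<^sub>2 x \<le> M \<and> p\<^sub>3 x \<le> M \<and> p\<^sub>4 x \<le> M \<and> p\<^sub>5 x \<le> M \<longrightarrow>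
    G x \<and> N x \<le> F M)" by blast
  \<comment> \<open>A constant for each common bound M becomes a function of the five quantities by
    letting M be their maximum, raised to at least 1.\<close>
  let ?m = "\<lambda>p q r s t :: real. max 1 (max p (max q (max r (max s t))))"
  show ?thesis
  proof (intro exI[of _ "\<lambda>p q r s t. F (?m p q r s t)"] conjI allI impI)
    show "0 < F (?m p q r s t)" for p q r s t using F by simp
    fix x assume "H x"
    then have "H x \<and> p\<^sub>1 x \<le> ?m (p\<^sub>1 x) (p\<^sub>2 x) (p\<^sub>3 x) (p\<^sub>4 x) (p\<^sub>5 x) \<and> p\<^sub>2 x \<le> ?m (p\<^sub>1 x) (p\<^sub>2 x) (p\<^sub>3 x) (p\<^sub>4 x) (p\<^sub>5 x) \<and>
      p\<^sub>3 x \<le> ?m (p\<^sub>1 x) (p\<^sub>2 x) (p\<^sub>3 x) (p\<^sub>4 x) (p\<^sub>5 x) \<and> p\<^sub>4 x \<le> ?m (p\<^sub>1 x) (p\<^sub>2 x) (p\<^sub>3 x) (p\<^sub>4 x) (p\<^sub>5 x) \<and>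
      p\<^sub>5 x \<le> ?m (p\<^sub>1 x) (p\<^sub>2 x) (p\<^sub>3 x) (p\<^sub>4 x) (p\<^sub>5 x)" by (simp add: le_max_iff_disj)
    moreover have "1 \<le> ?m (p\<^sub>1 x) (p\<^sub>2 x) (p\<^sub>3 x) (p\<^sub>4 x) (p\<^sub>5 x)" by simp
    ultimately show "G x" "N x \<le> F (?m (p\<^sub>1 x) (p\<^sub>2 x) (p\<^sub>3 x) (p\<^sub>4 x) (p\<^sub>5 x))" using F by blast+
  qed
qed

text \<open>The two parts differ only in the order l required of \<phi> and in the resulting
  exponent \<beta>. The constant is chosen after a, \<alpha>, \<beta> and k, with the dimension
  fixed by the type, and before the data.\<close>

lemma potential_estimate:
  fixes a \<alpha> \<beta> :: real and k l :: nat
  assumes al: "0 \<le> \<alpha>" "\<alpha> \<le> 1" and a: "0 < a" and k: "1 \<le> k"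
    and cases: "1 < a \<and> l = k - 1 \<and> \<beta> = \<alpha> \<or> a \<le> 1 \<and> l = k \<and> 0 < \<beta> \<and> \<beta> < \<alpha> + a - 1"
  shows "\<exists>C :: real \<Rightarrow> real \<Rightarrow> real \<Rightarrow> real \<Rightarrow> real \<Rightarrow> real.
          (\<forall>p q r s t. 0 < C p q r s t) \<and>
          (\<forall>(\<Omega> :: (real ^ 'n::finite) set) (\<omega> :: real ^ 'n \<Rightarrow> real) (\<phi> :: real ^ 'n \<Rightarrow> real).
             convex_body \<Omega> \<and> 0 \<in> interior \<Omega> \<and>
             radial \<Omega> \<in> holder_space_sphere k \<alpha> \<and>
             \<omega> \<in> holder_space_sphere k \<alpha> \<inter> holder_space_sphere 1 1 \<and>
             \<phi> \<in> holder_space_body l \<alpha> \<Omega> \<longrightarrow>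
             on_sphere \<Omega> (N_op \<Omega> \<omega> \<phi> a) \<in> holder_space_sphere k \<beta> \<and>
             holder_norm_sphere k \<beta> (on_sphere \<Omega> (N_op \<Omega> \<omega> \<phi> a)) \<le>
               C (holder_norm_sphere k \<alpha> \<omega>) (holder_norm_sphere 1 1 \<omega>)
                 (holder_norm_body l \<alpha> \<Omega> \<phi>)
                 (holder_norm_sphere k \<alpha> (radial \<Omega>)) (1 / radial_min \<Omega>))"
proof -
  obtain k' where k': "k = Suc k'" using k by (cases k) auto
  let ?H = "\<lambda>(\<Omega> :: (real ^ 'n) set, \<omega> :: real ^ 'n \<Rightarrow> real, \<phi>). convex_body \<Omega> \<and> 0 \<in> interior \<Omega> \<and>
             radial \<Omega> \<in> holder_space_sphere k \<alpha> \<and> \<omega> \<in> holder_space_sphere k \<alpha> \<inter> holder_space_sphere 1 1 \<and>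
             \<phi> \<in> holder_space_body l \<alpha> \<Omega>"
  have "\<exists>C>0. \<forall>x. ?H x \<and> (\<lambda>(\<Omega>, \<omega>, \<phi>). holder_norm_sphere k \<alpha> \<omega>) x \<le> M \<and> (\<lambda>(\<Omega>, \<omega>, \<phi>). holder_norm_sphere 1 1 \<omega>) x \<le> M \<and>
      (\<lambda>(\<Omega>, \<omega>, \<phi>). holder_norm_body l \<alpha> \<Omega> \<phi>) x \<le> M \<and> (\<lambda>(\<Omega>, \<omega>, \<phi>). holder_norm_sphere k \<alpha> (radial \<Omega>)) x \<le> M \<and>
      (\<lambda>(\<Omega>, \<omega>, \<phi>). 1 / radial_min \<Omega>) x \<le> M \<longrightarrow>
      (\<lambda>(\<Omega>, \<omega>, \<phi>). on_sphere \<Omega> (N_op \<Omega> \<omega> \<phi> a) \<in> holder_space_sphere k \<beta>) x \<and>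
      (\<lambda>(\<Omega>, \<omega>, \<phi>). holder_norm_sphere k \<beta> (on_sphere \<Omega> (N_op \<Omega> \<omega> \<phi> a))) x \<le> C" if M: "1 \<le> M" for M
  proof -
    let ?J = "admissible (Suc k') l \<alpha> M :: ((real ^ 'n) set \<times> (real ^ 'n \<Rightarrow> real) \<times> (real ^ 'n \<Rightarrow> real) \<times> (real ^ 'n)) set"
    interpret potential_data ?J k' l \<alpha> M a
      by unfold_locales (use al a M cases k' in auto)
    have "unif_bd (Suc k') \<beta> UJ ?J (\<lambda>_. 1) (\<lambda>j. hom_ext (on_sphere (body j) (N_op (body j) (om j) (ph j) a)))"
    proof (cases "1 < a")
      case True
      then have "l = k'" "\<beta> = \<alpha>" using cases k' by auto
      then show ?thesis using large_exponent True by simp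
    next
      case False
      then have "l = Suc k'" "a \<le> 1" "0 < \<beta>" "\<beta> < \<alpha> + a - 1" using cases k' by auto
      then show ?thesis by (rule small_exponent)
    qed
    from uniform_estimate[OF this] have "\<exists>C>0. \<forall>\<Omega> \<omega> \<phi>. (\<forall>e. norm e = 1 \<longrightarrow> (\<Omega>, \<omega>, \<phi>, e) \<in> ?J) \<longrightarrow>
      on_sphere \<Omega> (N_op \<Omega> \<omega> \<phi> a) \<in> holder_space_sphere (Suc k') \<beta> \<and>
      holder_norm_sphere (Suc k') \<beta> (on_sphere \<Omega> (N_op \<Omega> \<omega> \<phi> a)) \<le> C" using cases al by auto
    then obtain C where C: "C > 0" "\<forall>\<Omega> \<omega> \<phi>. (\<forall>e. norm e = 1 \<longrightarrow> (\<Omega>, \<omega>, \<phi>, e) \<in> ?J) \<longrightarrow>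
      on_sphere \<Omega> (N_op \<Omega> \<omega> \<phi> a) \<in> holder_space_sphere (Suc k') \<beta> \<and>
      holder_norm_sphere (Suc k') \<beta> (on_sphere \<Omega> (N_op \<Omega> \<omega> \<phi> a)) \<le> C"
      by (elim exE conjE)
    show ?thesis using C unfolding k' admissible_def by (intro exI[of _ C]) auto
  qed
  from choose_constants[of ?H "\<lambda>(\<Omega>, \<omega>, \<phi>). holder_norm_sphere k \<alpha> \<omega>" "\<lambda>(\<Omega>, \<omega>, \<phi>). holder_norm_sphere 1 1 \<omega>"
      "\<lambda>(\<Omega>, \<omega>, \<phi>). holder_norm_body l \<alpha> \<Omega> \<phi>" "\<lambda>(\<Omega>, \<omega>, \<phi>). holder_norm_sphere k \<alpha> (radial \<Omega>)" "\<lambda>(\<Omega>, \<omega>, \<phi>). 1 / radial_min \<Omega>"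
      "\<lambda>(\<Omega>, \<omega>, \<phi>). on_sphere \<Omega> (N_op \<Omega> \<omega> \<phi> a) \<in> holder_space_sphere k \<beta>"
      "\<lambda>(\<Omega>, \<omega>, \<phi>). holder_norm_sphere k \<beta> (on_sphere \<Omega> (N_op \<Omega> \<omega> \<phi> a))", OF this]
  show ?thesis unfolding split_paired_All case_prod_conv .
qed

theorem theorem1p5:
  shows
    "(\<forall>(a::real) (k::nat) (\<alpha>::real). 1 < a \<and> 1 \<le> k \<and> 0 \<le> \<alpha> \<and> \<alpha> \<le> 1 \<longrightarrow>
       (\<exists>C :: real \<Rightarrow> real \<Rightarrow> real \<Rightarrow> real \<Rightarrow> real \<Rightarrow> real.
          (\<forall>p q r s t. 0 < C p q r s t) \<and>
          (\<forall>(\<Omega> :: (real ^ 'n::finite) set) (\<omega> :: real ^ 'n \<Rightarrow> real) (\<phi> :: real ^ 'n \<Rightarrow> real).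
             convex_body \<Omega> \<and> 0 \<in> interior \<Omega> \<and>
             radial \<Omega> \<in> holder_space_sphere k \<alpha> \<and>
             \<omega> \<in> holder_space_sphere k \<alpha> \<inter> holder_space_sphere 1 1 \<and>
             \<phi> \<in> holder_space_body (k - 1) \<alpha> \<Omega> \<longrightarrow>
             on_sphere \<Omega> (N_op \<Omega> \<omega> \<phi> a) \<in> holder_space_sphere k \<alpha> \<and>
             holder_norm_sphere k \<alpha> (on_sphere \<Omega> (N_op \<Omega> \<omega> \<phi> a)) \<le>
               C (holder_norm_sphere k \<alpha> \<omega>) (holder_norm_sphere 1 1 \<omega>)
                 (holder_norm_body (k - 1) \<alpha> \<Omega> \<phi>)
                 (holder_norm_sphere k \<alpha> (radial \<Omega>)) (1 / radial_min \<Omega>))))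
     \<and>
     (\<forall>(a::real) (k::nat) (\<alpha>::real) (\<alpha>'::real).
       0 < a \<and> a \<le> 1 \<and> 1 \<le> k \<and> 1 - a < \<alpha> \<and> \<alpha> \<le> 1 \<and> 0 < \<alpha>' \<and> \<alpha>' < \<alpha> + a - 1 \<longrightarrow>
       (\<exists>C :: real \<Rightarrow> real \<Rightarrow> real \<Rightarrow> real \<Rightarrow> real \<Rightarrow> real.
          (\<forall>p q r s t. 0 < C p q r s t) \<and>
          (\<forall>(\<Omega> :: (real ^ 'n::finite) set) (\<omega> :: real ^ 'n \<Rightarrow> real) (\<phi> :: real ^ 'n \<Rightarrow> real).
             convex_body \<Omega> \<and> 0 \<in> interior \<Omega> \<and>
             radial \<Omega> \<in> holder_space_sphere k \<alpha> \<and>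
             \<omega> \<in> holder_space_sphere k \<alpha> \<inter> holder_space_sphere 1 1 \<and>
             \<phi> \<in> holder_space_body k \<alpha> \<Omega> \<longrightarrow>
             on_sphere \<Omega> (N_op \<Omega> \<omega> \<phi> a) \<in> holder_space_sphere k \<alpha>' \<and>
             holder_norm_sphere k \<alpha>' (on_sphere \<Omega> (N_op \<Omega> \<omega> \<phi> a)) \<le>
               C (holder_norm_sphere k \<alpha> \<omega>) (holder_norm_sphere 1 1 \<omega>)
                 (holder_norm_body k \<alpha> \<Omega> \<phi>)
                 (holder_norm_sphere k \<alpha> (radial \<Omega>)) (1 / radial_min \<Omega>))))"
proof (intro conjI allI impI, goal_cases)
  case (1 a k \<alpha>)
  then show ?case by (intro potential_estimate) auto
next
  case (2 a k \<alpha> \<alpha>')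
  then show ?case by (intro potential_estimate) auto
qed

end
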